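(* Let $\mathcal F:\mathcal R\to\mathbf{Top}^*$ be a resonance functor such that $\mathcal F(1^l)$ is contractible for all $l\ge 2$. Let $a,k,l$ be positive integers with $a\ge 2$, and write $l=am+\epsilon$ with integers $m\ge 0$ and $0\le\epsilon\le a-1$. (a) If $k\ne 1$ or $\epsilon\ge 2$, then $\mathcal F(a^k,1^l)$ is contractible. (b) If $k=1$ and $\epsilon\in\{0,1\}$, then $\mathcal F(a^k,1^l)\simeq \mathrm{susp}^m\big(\mathcal F(1)^{m+\epsilon+1}\big)$, where $\mathcal F(1)^{m+\epsilon+1}$ denotes the $(m+\epsilon+1)$-fold smash product of $\mathcal F(1)$ with itself.
   Context: Cuts and resonances. $[n]=\{1,\dots,n\}$. For $x\in\{-1,0,1\}^n$ put $\mathrm{Plus}(x)=\{i: x_i=1\}$, $\mathrm{Minus}(x)=\{i:x_i=-1\}$. A set $S\subseteq\{-1,0,1\}^n$ is an $n$-cut if $\mathrm{span}(S)\cap\{-1,0,1\}^n=S$ (linear span in $\mathbb R^n$, so $0\in S$) and every nonzero $x\in S$ has $\mathrm{Plus}(x)\neq\emptyset$ and $\mathrm{Minus}(x)\ne\emptyset$. $\mathcal R_n$ is the set of $n$-cuts. The symmetric group on $n$ letters acts on $\mathcal R_n$ by permuting coordinates; the orbit $[S]$ is called an $n$-resonance. For a vector $\lambda=(\lambda_1,\dots,\lambda_n)$ of positive integers, $S_\lambda=\{x\in\{-1,0,1\}^n:\langle x,\lambda\rangle=0\}$ is an $n$-cut, and $\lambda$ also denotes the resonance $[S_\lambda]$,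 which does not depend on the order of the parts; exponents denote repeated parts, e.g. $(a^k,1^l)$. Partitions. $P(A)$, $OP(A)$ are the sets of set partitions, resp. ordered set partitions, of $A$ (nonempty blocks); $P(n)=P([n])$, $OP(n)=OP([n])$; $\mathrm{un}:OP(A)\to P(A)$ forgets the order. If $\pi=(\pi_1,\dots,\pi_k)\in OP(m)$ and $\nu=(\nu_1,\dots,\nu_m)\in OP(n)$, then $\pi\circ\nu\in OP(n)$ has blocks $\bigcup_{j\in\pi_i}\nu_j$, $i=1,\dots,k$. For disjoint $A,B$ and $\Pi\subseteq P(A)$, $\Lambda\subseteq P(B)$, $\Pi\times\Lambda$ is the set of $\pi\in P(A\cup B)$ whose restriction to $A$ lies in $\Pi$ and whose restriction to $B$ lies in $\Lambda$. For $S\in\mathcal R_n$ and $\pi=(\pi_1,\dots,\pi_m)\in OP(n)$, $\pi S\in\mathcal R_m$ is the set of $(t_1,\dots,t_m)\in\{-1,0,1\}^m$ for which there is $s\in S$ with $s_i=t_j$ for all $j\in[m]$, $i\in\pi_j$. Resonance category $\mathcal R$. Objects: all $n$-cuts, $n\ge1$. Morphisms from $S\in\mathcal R_m$ to $T\in\mathcal R_n$: triples $(S,T,\pi)$ with $\pi\in OP(n)$ having $m$ parts and $S\subseteq\pi T$. Composing $(S,T,\pi)$ with $(T,Q,\nu)$ gives $(S,Q,\pi\circ\nu)$. The morphism $(\pi T,T,\pi)$ is denoted $\pi T\stackrel{\pi}{\hookrightarrow}T$. Closure. Let $A(n)$ be the set of all collections of nonempty multisubsets of $[n]$; $P(n)\subseteq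 A(n)$. For $S\in\mathcal R_n$ and $\mathcal A\in A(n)$, $\mathcal A\Downarrow S\subseteq A(n)$ is the minimal set such that: (1) $\mathcal A\in\mathcal A\Downarrow S$; (2) if $\{B_1,B_2,\dots,B_m\}\in\mathcal A\Downarrow S$ then $\{B_1\cup B_2,B_3,\dots,B_m\}\in\mathcal A\Downarrow S$; (3) if $\{B_1,\dots,B_m\}\in\mathcal A\Downarrow S$ and $x\in S$ satisfies $\mathrm{Plus}(x)\subseteq B_1$, then $\{(B_1\setminus\mathrm{Plus}(x))\cup\mathrm{Minus}(x),B_2,\dots,B_m\}\in\mathcal A\Downarrow S$ (operations on multisets, with multiplicities). For $\pi\in P(n)$, $\pi\downarrow S=(\pi\Downarrow S)\cap P(n)$; for $\pi\in OP(n)$, $\pi\downarrow S$ means $\mathrm{un}(\pi)\downarrow S$. $\Pi\subseteq P(n)$ is $S$-closed if $\bigcup_{\pi\in\Pi}\pi\downarrow S=\Pi$. Relative cuts. $S\setminus\Pi$ is $S$ with all those $s$ removed for which the partition of $[n]$ whose only possibly nonsingleton blocks are $\mathrm{Minus}(s)$ and $\mathrm{Plus}(s)$ lies in $\Pi$. A relative $n$-cut is a pair $(S,\Pi)$, $S\subseteq\{-1,0,1\}^n$, $\Pi\subseteq P(n)$, with $\overline S\setminus\Pi=S$ and $\Pi$ being $\overline S$-closed, where $\overline S=\mathrm{span}(S)\cap\{-1,0,1\}^n$. For $S\in\mathcal R_n$ and $S$-closed $\Pi$, $Q(S,\Pi)$ denotes $(S\setminus\Pi,\Pi)$. Square brackets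 denote orbits under simultaneous permutation of the $n$ coordinates/elements (relative resonances). Product: for a relative $n$-cut $(S,\Pi)$ and a relative $m$-cut $(T,\Lambda)$, $(S,\Pi)\times(T,\Lambda)=(S\times T,(\Pi\times P(m))\cup(P(n)\times\Lambda))$, with the second index set identified with $\{n+1,\dots,n+m\}$. Resonance functors. $\mathbf{Top}^*$ is the category of pointed topological spaces. For a functor $\mathcal F:\mathcal R\to\mathbf{Top}^*$ put $\mathcal F(Q(S,\Pi))=\mathcal F(S)\big/\bigcup_{\mathrm{un}(\pi)\in\Pi}\mathrm{Im}\,\mathcal F(\pi S\stackrel{\pi}{\hookrightarrow}S)$, and $\mathcal F(S,\Pi)=\mathcal F(Q(\overline S,\Pi))$ for a relative cut. $\mathcal F$ is a resonance functor if: (A1) for $S\in\mathcal R_n$, $\pi\in OP(n)$, $\mathcal F(\pi S\stackrel{\pi}{\hookrightarrow}S)$ is an inclusion map and $\mathcal F(S)/\mathrm{Im}\,\mathcal F(\pi S\stackrel{\pi}{\hookrightarrow}S)\simeq\mathcal F(Q(S,\pi\downarrow S))$; (A2) $[Q(S,\Pi)]=[Q(T,\Lambda)]$ implies $\mathcal F(Q(S,\Pi))\simeq\mathcal F(Q(T,\Lambda))$; (A3) for relative cuts, $\mathcal F(S,\Pi)\wedge\mathcal F(T,\Lambda)\simeq\mathcal F((S,\Pi)\times(T,\Lambda))$. Here $\simeq$ is homotopy equivalence and $\wedge$ is the smash product. For a vector $\lambda$ of positive integers $\mathcal F(\lambda)$ means $\mathcal F(S_\lambda)$. $\mathrm{susp}$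 is suspension of pointed spaces.
   Formalization: In (A1), "inclusion map" is taken to mean a topological embedding that is also a pointed cofibration (homotopy extension property); with bare embeddings the statement is false, e.g. a functor with finite non-Hausdorff values where F(2,1,1) is contractible but susp(F(1)^2) is a circle. *)

theory Defs
  imports "HOL-Analysis.Analysis" "HOL-Library.Function_Algebras"
    "HOL-Library.Disjoint_Sets" "HOL-Library.Multiset" "HOL-Combinatorics.Permutations"
begin

section \<open>Cuts\<close>

text \<open>Vectors of \<open>\<real>\<^sup>n\<close> are functions \<^typ>\<open>nat \<Rightarrow> real\<close> vanishing outside \<open>{1..n}\<close>. The length
  \<open>n\<close> cannot be recovered from a set of such vectors, so objects of the resonance category are
  pairs of a length and a set.\<close>

type_synonym rvec = "nat \<Rightarrow> real"

definition signvecs :: "nat \<Rightarrow> rvec set" where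
  "signvecs n = {x. (\<forall>i\<in>{1..n}. x i \<in> {-1, 0, 1}) \<and> (\<forall>i. i \<notin> {1..n} \<longrightarrow> x i = 0)}"

definition Plus :: "rvec \<Rightarrow> nat set" where
  "Plus x = {i. x i = 1}"

definition Minus :: "rvec \<Rightarrow> nat set" where
  "Minus x = {i. x i = -1}"

definition span_closure :: "nat \<Rightarrow> rvec set \<Rightarrow> rvec set" where
  "span_closure n S = module.span (\<lambda>(c::real) x i. c * x i) S \<inter> signvecs n"

definition cuts :: "nat \<Rightarrow> rvec set set" where
  "cuts n = {S. S \<subseteq> signvecs n \<and> span_closure n S = S \<and>
               (\<forall>x\<in>S. x \<noteq> 0 \<longrightarrow> Plus x \<noteq> {} \<and> Minus x \<noteq> {})}"

definition cut_of :: "nat list \<Rightarrow> rvec set" where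
  "cut_of lam = {x \<in> signvecs (length lam). (\<Sum>i=1..length lam. x i * real (lam ! (i - 1))) = 0}"


section \<open>Partitions\<close>

definition partitions :: "nat set \<Rightarrow> nat set set set" where
  "partitions A = {P. partition_on A P}"

definition ordered_partitions :: "nat set \<Rightarrow> nat set list set" where
  "ordered_partitions A = {p. distinct p \<and> partition_on A (set p)}"

text \<open>The forgetful map \<open>un\<close> from ordered to unordered partitions is \<^const>\<open>set\<close>. Blocks and
  coordinates are numbered from 1, list positions from 0.\<close>

definition osp_comp :: "nat set list \<Rightarrow> nat set list \<Rightarrow> nat set list" where
  "osp_comp p q = map (\<lambda>B. \<Union>j\<in>B. q ! (j - 1)) p"

definition osp_id :: "nat \<Rightarrow> nat set list" where
  "osp_id n = map (\<lambda>i. {i}) [1..<Suc n]"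

definition pull :: "nat set list \<Rightarrow> rvec set \<Rightarrow> rvec set" where
  "pull p S = {t \<in> signvecs (length p).
                 \<exists>s\<in>S. \<forall>j\<in>{1..length p}. \<forall>i\<in>p ! (j - 1). s i = t j}"

definition restrict_partition :: "nat set set \<Rightarrow> nat set \<Rightarrow> nat set set" where
  "restrict_partition P A = (\<lambda>B. B \<inter> A) ` P - {{}}"

definition partitions_times ::
    "nat set \<Rightarrow> nat set set set \<Rightarrow> nat set \<Rightarrow> nat set set set \<Rightarrow> nat set set set" where
  "partitions_times A Ps B Ls =
     {P \<in> partitions (A \<union> B). restrict_partition P A \<in> Ps \<and> restrict_partition P B \<in> Ls}"


section \<open>Closure\<close>

text \<open>Elements of \<open>A(n)\<close> are multisets of multisets: in the course of the rewriting two members of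
  a collection may become equal and must still be counted separately.\<close>

inductive_set coll_closure :: "rvec set \<Rightarrow> nat multiset multiset \<Rightarrow> nat multiset multiset set"
  for S :: "rvec set" and A :: "nat multiset multiset" where
  base: "A \<in> coll_closure S A"
| merge: "add_mset B1 (add_mset B2 C) \<in> coll_closure S A
          \<Longrightarrow> add_mset (B1 + B2) C \<in> coll_closure S A"
| swap: "add_mset B C \<in> coll_closure S A \<Longrightarrow> x \<in> S \<Longrightarrow> mset_set (Plus x) \<subseteq># B
          \<Longrightarrow> add_mset (B - mset_set (Plus x) + mset_set (Minus x)) C \<in> coll_closure S A"

definition coll_of :: "nat set set \<Rightarrow> nat multiset multiset" where
  "coll_of P = image_mset mset_set (mset_set P)"

definition down :: "nat \<Rightarrow> rvec set \<Rightarrow> nat set set \<Rightarrow> nat set set set" where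
  "down n S P = {Q \<in> partitions {1..n}. coll_of Q \<in> coll_closure S (coll_of P)}"

definition closed_under :: "nat \<Rightarrow> rvec set \<Rightarrow> nat set set set \<Rightarrow> bool" where
  "closed_under n S Ps \<longleftrightarrow> Ps \<subseteq> partitions {1..n} \<and> (\<Union>P\<in>Ps. down n S P) = Ps"


section \<open>Relative cuts\<close>

definition partition_of_vec :: "nat \<Rightarrow> rvec \<Rightarrow> nat set set" where
  "partition_of_vec n s =
     ({Plus s, Minus s} - {{}}) \<union> (\<lambda>i. {i}) ` ({1..n} - (Plus s \<union> Minus s))"

definition remove_partitions :: "nat \<Rightarrow> rvec set \<Rightarrow> nat set set set \<Rightarrow> rvec set" where
  "remove_partitions n S Ps = {s \<in> S. partition_of_vec n s \<notin> Ps}"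

type_synonym rel_cut = "rvec set \<times> nat set set set"

text \<open>The closure operator is only defined for cuts, hence the requirement that the span closure
  be a cut.\<close>

definition relative_cut :: "nat \<Rightarrow> rel_cut \<Rightarrow> bool" where
  "relative_cut n = (\<lambda>(S, Ps). S \<subseteq> signvecs n \<and> Ps \<subseteq> partitions {1..n} \<and>
      span_closure n S \<in> cuts n \<and> remove_partitions n (span_closure n S) Ps = S \<and>
      closed_under n (span_closure n S) Ps)"

definition Q_cut :: "nat \<Rightarrow> rvec set \<Rightarrow> nat set set set \<Rightarrow> rel_cut" where
  "Q_cut n S Ps = (remove_partitions n S Ps, Ps)"

definition permute_rel_cut :: "(nat \<Rightarrow> nat) \<Rightarrow> rel_cut \<Rightarrow> rel_cut" where
  "permute_rel_cut f = (\<lambda>(S, Ps). ((\<lambda>x. x \<circ> inv f) ` S, (\<lambda>P. (`) f ` P) ` Ps))"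

definition relative_resonance :: "nat \<Rightarrow> rel_cut \<Rightarrow> rel_cut set" where
  "relative_resonance n R = {permute_rel_cut f R | f. f permutes {1..n}}"

definition concat_vec :: "nat \<Rightarrow> rvec \<Rightarrow> rvec \<Rightarrow> rvec" where
  "concat_vec n x y = (\<lambda>i. if i \<le> n then x i else y (i - n))"

definition rel_cut_times :: "nat \<Rightarrow> rel_cut \<Rightarrow> nat \<Rightarrow> rel_cut \<Rightarrow> rel_cut" where
  "rel_cut_times n = (\<lambda>(S, Ps) m (T, Ls).
     let A = {1..n}; B = {n+1..n+m}; Ls' = (\<lambda>P. (`) ((+) n) ` P) ` Ls
     in ({concat_vec n x y | x y. x \<in> S \<and> y \<in> T},
         partitions_times A Ps B (partitions B) \<union> partitions_times A (partitions A) B Ls'))"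


section \<open>Pointed spaces\<close>

type_synonym 'a pspace = "'a topology \<times> 'a"

definition pointed_space :: "'a pspace \<Rightarrow> bool" where
  "pointed_space X \<longleftrightarrow> snd X \<in> topspace (fst X)"

definition pointed_map :: "'a pspace \<Rightarrow> 'b pspace \<Rightarrow> ('a \<Rightarrow> 'b) \<Rightarrow> bool" where
  "pointed_map X Y f \<longleftrightarrow> continuous_map (fst X) (fst Y) f \<and> f (snd X) = snd Y"

definition pointed_homotopic :: "'a pspace \<Rightarrow> 'b pspace \<Rightarrow> ('a \<Rightarrow> 'b) \<Rightarrow> ('a \<Rightarrow> 'b) \<Rightarrow> bool" where
  "pointed_homotopic X Y f g \<longleftrightarrow> homotopic_with (\<lambda>h. h (snd X) = snd Y) (fst X) (fst Y) f g"

definition pointed_equiv :: "'a pspace \<Rightarrow> 'b pspace \<Rightarrow> bool" (infix "\<simeq>\<^sub>*" 50) where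
  "X \<simeq>\<^sub>* Y \<longleftrightarrow> (\<exists>f g. pointed_map X Y f \<and> pointed_map Y X g \<and>
      pointed_homotopic X X (g \<circ> f) id \<and> pointed_homotopic Y Y (f \<circ> g) id)"

definition pointed_contractible :: "'a pspace \<Rightarrow> bool" where
  "pointed_contractible X \<longleftrightarrow> pointed_homotopic X X id (\<lambda>_. snd X)"

definition coinduced_topology :: "'a topology \<Rightarrow> ('a \<Rightarrow> 'b) \<Rightarrow> 'b topology" where
  "coinduced_topology X f =
     topology (\<lambda>U. U \<subseteq> f ` topspace X \<and> openin X {x \<in> topspace X. f x \<in> U})"

lemma openin_coinduced_topology:
  "openin (coinduced_topology X f) U \<longleftrightarrow>
     U \<subseteq> f ` topspace X \<and> openin X {x \<in> topspace X. f x \<in> U}"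
proof -
  have "istopology (\<lambda>U. U \<subseteq> f ` topspace X \<and> openin X {x \<in> topspace X. f x \<in> U})"
    unfolding istopology_def
  proof (intro conjI allI impI)
    fix U V
    assume "U \<subseteq> f ` topspace X \<and> openin X {x \<in> topspace X. f x \<in> U}"
      "V \<subseteq> f ` topspace X \<and> openin X {x \<in> topspace X. f x \<in> V}"
    moreover have "{x \<in> topspace X. f x \<in> U \<inter> V} =
        {x \<in> topspace X. f x \<in> U} \<inter> {x \<in> topspace X. f x \<in> V}" by blast
    ultimately show "U \<inter> V \<subseteq> f ` topspace X" "openin X {x \<in> topspace X. f x \<in> U \<inter> V}"
      by (auto intro: openin_Int)
  next
    fix K
    assume K: "\<forall>U\<in>K. U \<subseteq> f ` topspace X \<and> openin X {x \<in> topspace X. f x \<in> U}"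
    then show "\<Union>K \<subseteq> f ` topspace X" by blast
    have "{x \<in> topspace X. f x \<in> \<Union>K} = (\<Union>U\<in>K. {x \<in> topspace X. f x \<in> U})" by blast
    then show "openin X {x \<in> topspace X. f x \<in> \<Union>K}" using K by auto
  qed
  then show ?thesis by (simp add: coinduced_topology_def topology_inverse')
qed

lemma topspace_coinduced_topology [simp]: "topspace (coinduced_topology X f) = f ` topspace X"
proof -
  have "{x \<in> topspace X. f x \<in> f ` topspace X} = topspace X" by blast
  then have "openin (coinduced_topology X f) (f ` topspace X)"
    by (simp add: openin_coinduced_topology)
  then show ?thesis
    by (meson openin_coinduced_topology openin_subset openin_topspace subset_antisym)
qed

lemma quotient_map_coinduced_topology: "quotient_map X (coinduced_topology X f) f"
  by (auto simp: quotient_map_def openin_coinduced_topology)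

text \<open>The pointed quotient collapses a set together with the base point to the base point; a
  quotient by the empty set is thus the space itself. The points of the quotient are the
  uncollapsed points and the base point.\<close>

definition pquotient :: "'a pspace \<Rightarrow> 'a set \<Rightarrow> 'a pspace" where
  "pquotient X A =
     (coinduced_topology (fst X) (\<lambda>u. if u \<in> insert (snd X) A then snd X else u), snd X)"

definition smash :: "'a pspace \<Rightarrow> 'b pspace \<Rightarrow> ('a \<times> 'b) pspace" where
  "smash X Y = pquotient (prod_topology (fst X) (fst Y), (snd X, snd Y))
     ({snd X} \<times> topspace (fst Y) \<union> topspace (fst X) \<times> {snd Y})"

definition reduced_susp :: "'a pspace \<Rightarrow> ('a \<times> real) pspace" where
  "reduced_susp X = pquotient (prod_topology (fst X) (top_of_set {0..1}), (snd X, 0))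
     (topspace (fst X) \<times> {0, 1} \<union> {snd X} \<times> {0..1})"

text \<open>Smash products and suspensions change the type of points, so they cannot be iterated a
  variable number of times as they stand. The datatype below is closed under both; spaces are
  moved into it by homeomorphic copies along its injective constructors.\<close>

datatype 'a pt = Pt 'a | SmashPt "'a pt" "'a pt" | SuspPt "'a pt" real

definition transport :: "('a \<Rightarrow> 'b) \<Rightarrow> 'a pspace \<Rightarrow> 'b pspace" where
  "transport c X = (coinduced_topology (fst X) c, c (snd X))"

definition smash_pt :: "'a pt pspace \<Rightarrow> 'a pt pspace \<Rightarrow> 'a pt pspace" where
  "smash_pt X Y = transport (\<lambda>(u, v). SmashPt u v) (smash X Y)"

definition susp_pt :: "'a pt pspace \<Rightarrow> 'a pt pspace" where
  "susp_pt X = transport (\<lambda>(u, t). SuspPt u t) (reduced_susp X)"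

text \<open>Meaningful for \<open>r \<ge> 1\<close>: \<open>X \<and> (X \<and> (\<dots> \<and> X))\<close> with \<open>r\<close> factors.\<close>

definition smash_power :: "'a pspace \<Rightarrow> nat \<Rightarrow> 'a pt pspace" where
  "smash_power X r = (smash_pt (transport Pt X) ^^ (r - 1)) (transport Pt X)"

definition iterated_susp :: "nat \<Rightarrow> 'a pt pspace \<Rightarrow> 'a pt pspace" where
  "iterated_susp m X = (susp_pt ^^ m) X"

text \<open>The homotopy extension property in pointed spaces. The reduced mapping cylinder of \<open>i\<close> can
  be realised on \<^typ>\<open>'a \<times> real + 'b\<close>, and extension into it implies extension into every
  pointed space, so it is no restriction to test only spaces of this type.\<close>

definition pointed_cofibration :: "'a pspace \<Rightarrow> 'b pspace \<Rightarrow> ('a \<Rightarrow> 'b) \<Rightarrow> bool" where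
  "pointed_cofibration A X i \<longleftrightarrow> pointed_map A X i \<and>
     (\<forall>(Z :: ('a \<times> real + 'b) pspace) f h.
        pointed_map X Z f \<and>
        continuous_map (prod_topology (top_of_set {0..1}) (fst A)) (fst Z) h \<and>
        (\<forall>u\<in>topspace (fst A). h (0::real, u) = f (i u)) \<and>
        (\<forall>t\<in>{0..1}. h (t, snd A) = snd Z)
        \<longrightarrow> (\<exists>H. continuous_map (prod_topology (top_of_set {0..1}) (fst X)) (fst Z) H \<and>
              (\<forall>x\<in>topspace (fst X). H (0::real, x) = f x) \<and>
              (\<forall>t\<in>{0..1}. \<forall>u\<in>topspace (fst A). H (t, i u) = h (t, u))))"

text \<open>As usual in homotopy theory, inclusion maps are understood to be cofibrations. For bare
  topological embeddings (even closed ones) quotients carry too little homotopical information: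
  let a functor send \<open>{0}\<close> to the discrete space \<open>{*, p}\<close> and every other cut to \<open>{*, p, y}\<close>,
  where the nonempty open sets are those containing \<open>y\<close>. It satisfies the axioms of a resonance
  functor with embeddings in place of cofibrations, and is contractible on all cuts other than
  \<open>{0}\<close>, in particular on \<open>(2,1,1)\<close>, whereas the suspension of \<open>F(1) \<and> F(1)\<close> is a circle.\<close>

definition inclusion_map :: "'a pspace \<Rightarrow> 'b pspace \<Rightarrow> ('a \<Rightarrow> 'b) \<Rightarrow> bool" where
  "inclusion_map A X i \<longleftrightarrow> embedding_map (fst A) (fst X) i \<and> pointed_cofibration A X i"


section \<open>The resonance category and resonance functors\<close>

type_synonym cut = "nat \<times> rvec set"

type_synonym res_mor = "cut \<times> cut \<times> nat set list"

definition res_objects :: "cut set" where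
  "res_objects = {(n, S). 1 \<le> n \<and> S \<in> cuts n}"

definition res_morphisms :: "res_mor set" where
  "res_morphisms = {((m, S), (n, T), p). (m, S) \<in> res_objects \<and> (n, T) \<in> res_objects \<and>
      p \<in> ordered_partitions {1..n} \<and> length p = m \<and> S \<subseteq> pull p T}"

text \<open>A functor to pointed spaces is given by its object part \<open>F\<close> and its morphism part \<open>Fm\<close>; the
  resonance category being small, its values can be taken on a common type of points.\<close>

definition functor_to_pointed_spaces :: "(cut \<Rightarrow> 'a pspace) \<Rightarrow> (res_mor \<Rightarrow> 'a \<Rightarrow> 'a) \<Rightarrow> bool" where
  "functor_to_pointed_spaces F Fm \<longleftrightarrow>
     (\<forall>S\<in>res_objects. pointed_space (F S)) \<and>
     (\<forall>S T p. (S, T, p) \<in> res_morphisms \<longrightarrow> pointed_map (F S) (F T) (Fm (S, T, p))) \<and>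
     (\<forall>S\<in>res_objects. \<forall>u\<in>topspace (fst (F S)). Fm (S, S, osp_id (fst S)) u = u) \<and>
     (\<forall>S T Q p q. (S, T, p) \<in> res_morphisms \<and> (T, Q, q) \<in> res_morphisms \<longrightarrow>
        (\<forall>u\<in>topspace (fst (F S)). Fm (S, Q, osp_comp p q) u = Fm (T, Q, q) (Fm (S, T, p) u)))"

definition incl_mor :: "nat \<Rightarrow> rvec set \<Rightarrow> nat set list \<Rightarrow> res_mor" where
  "incl_mor n S p = ((length p, pull p S), (n, S), p)"

definition F_image ::
    "(cut \<Rightarrow> 'a pspace) \<Rightarrow> (res_mor \<Rightarrow> 'a \<Rightarrow> 'a) \<Rightarrow> nat \<Rightarrow> rvec set \<Rightarrow> nat set list \<Rightarrow> 'a set" where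
  "F_image F Fm n S p = Fm (incl_mor n S p) ` topspace (fst (F (length p, pull p S)))"

text \<open>\<open>F_Q F Fm n S Ps\<close> is \<open>F(Q(S, Ps))\<close>, and \<open>F_rel F Fm n R\<close> is \<open>F(R)\<close> for a relative cut \<open>R\<close>.\<close>

definition F_Q ::
    "(cut \<Rightarrow> 'a pspace) \<Rightarrow> (res_mor \<Rightarrow> 'a \<Rightarrow> 'a) \<Rightarrow> nat \<Rightarrow> rvec set \<Rightarrow> nat set set set \<Rightarrow> 'a pspace" where
  "F_Q F Fm n S Ps =
     pquotient (F (n, S)) (\<Union>p\<in>{p \<in> ordered_partitions {1..n}. set p \<in> Ps}. F_image F Fm n S p)"

definition F_rel ::
    "(cut \<Rightarrow> 'a pspace) \<Rightarrow> (res_mor \<Rightarrow> 'a \<Rightarrow> 'a) \<Rightarrow> nat \<Rightarrow> rel_cut \<Rightarrow> 'a pspace" where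
  "F_rel F Fm n = (\<lambda>(S, Ps). F_Q F Fm n (span_closure n S) Ps)"

definition inclusion_axiom :: "(cut \<Rightarrow> 'a pspace) \<Rightarrow> (res_mor \<Rightarrow> 'a \<Rightarrow> 'a) \<Rightarrow> bool" where
  "inclusion_axiom F Fm \<longleftrightarrow>
     (\<forall>n S p. (n, S) \<in> res_objects \<and> p \<in> ordered_partitions {1..n} \<longrightarrow>
        inclusion_map (F (length p, pull p S)) (F (n, S)) (Fm (incl_mor n S p)) \<and>
        pquotient (F (n, S)) (F_image F Fm n S p) \<simeq>\<^sub>* F_Q F Fm n S (down n S (set p)))"

definition relative_resonance_axiom :: "(cut \<Rightarrow> 'a pspace) \<Rightarrow> (res_mor \<Rightarrow> 'a \<Rightarrow> 'a) \<Rightarrow> bool" where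
  "relative_resonance_axiom F Fm \<longleftrightarrow>
     (\<forall>n S T Ps Ls. (n, S) \<in> res_objects \<and> (n, T) \<in> res_objects \<and>
        closed_under n S Ps \<and> closed_under n T Ls \<and>
        relative_resonance n (Q_cut n S Ps) = relative_resonance n (Q_cut n T Ls) \<longrightarrow>
        F_Q F Fm n S Ps \<simeq>\<^sub>* F_Q F Fm n T Ls)"

definition product_axiom :: "(cut \<Rightarrow> 'a pspace) \<Rightarrow> (res_mor \<Rightarrow> 'a \<Rightarrow> 'a) \<Rightarrow> bool" where
  "product_axiom F Fm \<longleftrightarrow>
     (\<forall>n R m R'. 1 \<le> n \<and> 1 \<le> m \<and> relative_cut n R \<and> relative_cut m R' \<longrightarrow>
        smash (F_rel F Fm n R) (F_rel F Fm m R') \<simeq>\<^sub>* F_rel F Fm (n + m) (rel_cut_times n R m R'))"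

definition resonance_functor :: "(cut \<Rightarrow> 'a pspace) \<Rightarrow> (res_mor \<Rightarrow> 'a \<Rightarrow> 'a) \<Rightarrow> bool" where
  "resonance_functor F Fm \<longleftrightarrow> functor_to_pointed_spaces F Fm \<and>
     inclusion_axiom F Fm \<and> relative_resonance_axiom F Fm \<and> product_axiom F Fm"

definition F_vec :: "(cut \<Rightarrow> 'a pspace) \<Rightarrow> nat list \<Rightarrow> 'a pspace" where
  "F_vec F lam = F (length lam, cut_of lam)"

end

theory Submission
  imports Defs
begin

text \<open>Glue \<open>a\<close> unit parts of \<open>C = (a\<^sup>k, 1\<^sup>l)\<close> into one block, by an ordered partition \<open>p\<close>.
  The closure of \<open>p\<close> consists of all partitions with a block containing at least \<open>a\<close> unit parts,
  and a vector of \<open>C\<close> that survives the removal of these partitions balances the \<open>a\<close>-parts and the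
  unit parts separately. Hence \<open>C\<close> and \<open>D = (1\<^sup>k) \<times> (1\<^sup>l)\<close> give the same relative cut, and
  \<open>F(C) / F(pC) \<simeq> F(D) / F(pD)\<close> with \<open>pC = (a\<^sup>k\<^sup>+\<^sup>1, 1\<^sup>l\<^sup>-\<^sup>a)\<close> and \<open>pD = (1\<^sup>k) \<times> (a, 1\<^sup>l\<^sup>-\<^sup>a)\<close>.
  For \<open>k \<ge> 2\<close> the factor \<open>F(1\<^sup>k)\<close> makes \<open>F(D)\<close> and \<open>F(pD)\<close> contractible, so \<open>F(C)\<close> is contractible by
  induction on \<open>l\<close>. For \<open>k = 1\<close> the spaces \<open>F(pC)\<close> and \<open>F(D)\<close> are contractible, so \<open>F(C)\<close> is the
  suspension of \<open>F(pD)\<close>. Smash products of arbitrary spaces need not commute with suspensions;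
  therefore the induction runs over the cuts \<open>(1)\<^sup>r \<times> (a, 1\<^sup>l)\<close> for all \<open>r\<close>, and the product axiom is
  applied only once all suspensions have been split off.\<close>

section \<open>Pointed homotopy equivalences\<close>

text \<open>The upper bound on the closure comes from a monotone: a block of total weight
  \<open>w\<close> counts \<open>w div a\<close>. As \<open>a \<ge> 2\<close>, loose unit parts
  count nothing, while the glued block counts one. Surviving vectors balance separately by
  divisibility: their net number of unit parts is a multiple of \<open>a\<close> of absolute value
  below \<open>a\<close>. About a quotient by a cofibration only two facts are used: collapsing a
  contractible subspace changes nothing, and collapsing inside a contractible space gives the
  suspension of the subspace. For \<open>k = 1\<close> the space \<open>F(pC)\<close> is
  contractible by the case of two \<open>a\<close>-parts, and \<open>F(D)\<close> because
  \<open>l \<ge> a \<ge> 2\<close>. A single part \<open>a\<close> admits only the zero vector, so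
  \<open>pD\<close> has one more free factor \<open>(1)\<close> than \<open>C\<close>: each
  suspension raises \<open>r\<close> by one and lowers \<open>l\<close> by \<open>a\<close>. After
  \<open>m\<close> steps \<open>(a, 1^e)\<close> is left. For \<open>e \<le> 1\<close> it has only
  the zero vector and adds \<open>1 + e\<close> factors, whence \<open>m + e + 1\<close>; for
  \<open>e \<ge> 2\<close> it contains the contractible factor \<open>(1^e)\<close>.\<close>

abbreviation unit_interval :: "real topology" where
  "unit_interval \<equiv> top_of_set {0..1}"

lemma pointed_homotopic_iff:
  assumes "pointed_space X"
  shows "pointed_homotopic X Y f g \<longleftrightarrow>
    (\<exists>h. continuous_map (prod_topology unit_interval (fst X)) (fst Y) h \<and>
      (\<forall>x\<in>topspace (fst X). h (0, x) = f x) \<and> (\<forall>x\<in>topspace (fst X). h (1, x) = g x) \<and>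
      (\<forall>t\<in>{0..1}. h (t, snd X) = snd Y))"
  unfolding pointed_homotopic_def
  using assms by (subst homotopic_with) (auto simp: pointed_space_def)

lemma pointed_equivI:
  assumes "pointed_space X" "pointed_space Y"
    and "continuous_map (fst X) (fst Y) f" "f (snd X) = snd Y"
    and "continuous_map (fst Y) (fst X) g" "g (snd Y) = snd X"
    and "continuous_map (prod_topology unit_interval (fst X)) (fst X) H"
    and "\<And>x. x \<in> topspace (fst X) \<Longrightarrow> H (0, x) = g (f x)"
    and "\<And>x. x \<in> topspace (fst X) \<Longrightarrow> H (1, x) = x"
    and "\<And>t. t \<in> {0..1} \<Longrightarrow> H (t, snd X) = snd X"
    and "continuous_map (prod_topology unit_interval (fst Y)) (fst Y) K"
    and "\<And>y. y \<in> topspace (fst Y) \<Longrightarrow> K (0, y) = f (g y)"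
    and "\<And>y. y \<in> topspace (fst Y) \<Longrightarrow> K (1, y) = y"
    and "\<And>t. t \<in> {0..1} \<Longrightarrow> K (t, snd Y) = snd Y"
  shows "X \<simeq>\<^sub>* Y"
proof -
  have "pointed_homotopic X X (g \<circ> f) id"
    unfolding pointed_homotopic_iff[OF assms(1)] using assms by (intro exI[of _ H]) auto
  moreover have "pointed_homotopic Y Y (f \<circ> g) id"
    unfolding pointed_homotopic_iff[OF assms(2)] using assms by (intro exI[of _ K]) auto
  ultimately show ?thesis
    using assms unfolding pointed_equiv_def pointed_map_def by blast
qed

lemma pointed_equivE:
  assumes "X \<simeq>\<^sub>* Y" "pointed_space X"
  obtains f g H K where "pointed_space Y"
    "continuous_map (fst X) (fst Y) f" "f (snd X) = snd Y"
    "continuous_map (fst Y) (fst X) g" "g (snd Y) = snd X"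
    "continuous_map (prod_topology unit_interval (fst X)) (fst X) H"
    "\<And>x. x \<in> topspace (fst X) \<Longrightarrow> H (0, x) = g (f x)"
    "\<And>x. x \<in> topspace (fst X) \<Longrightarrow> H (1, x) = x"
    "\<And>t. t \<in> {0..1} \<Longrightarrow> H (t, snd X) = snd X"
    "continuous_map (prod_topology unit_interval (fst Y)) (fst Y) K"
    "\<And>y. y \<in> topspace (fst Y) \<Longrightarrow> K (0, y) = f (g y)"
    "\<And>y. y \<in> topspace (fst Y) \<Longrightarrow> K (1, y) = y"
    "\<And>t. t \<in> {0..1} \<Longrightarrow> K (t, snd Y) = snd Y"
proof -
  obtain f g where fg: "pointed_map X Y f" "pointed_map Y X g"
    "pointed_homotopic X X (g \<circ> f) id" "pointed_homotopic Y Y (f \<circ> g) id"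
    using assms unfolding pointed_equiv_def by blast
  have Y: "pointed_space Y"
    using fg(1) assms(2) unfolding pointed_map_def pointed_space_def continuous_map_def by force
  show ?thesis
    using fg that[OF Y, of f g] unfolding pointed_homotopic_iff[OF Y]
      pointed_homotopic_iff[OF assms(2)] pointed_map_def by (auto 0 4)
qed

lemma pointed_contractible_iff:
  assumes "pointed_space X"
  shows "pointed_contractible X \<longleftrightarrow>
    (\<exists>c. continuous_map (prod_topology unit_interval (fst X)) (fst X) c \<and>
      (\<forall>x\<in>topspace (fst X). c (0, x) = x) \<and> (\<forall>x\<in>topspace (fst X). c (1, x) = snd X) \<and>
      (\<forall>t\<in>{0..1}. c (t, snd X) = snd X))"
  unfolding pointed_contractible_def pointed_homotopic_iff[OF assms] by simp

lemma pointed_space_equiv: "X \<simeq>\<^sub>* Y \<Longrightarrow> pointed_space X \<Longrightarrow> pointed_space Y"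
  by (erule pointed_equivE)

lemma pointed_equiv_refl: "X \<simeq>\<^sub>* X"
  unfolding pointed_equiv_def pointed_map_def pointed_homotopic_def
  by (intro exI[of _ id]) auto

lemma pointed_equiv_sym: "X \<simeq>\<^sub>* Y \<Longrightarrow> Y \<simeq>\<^sub>* X"
  unfolding pointed_equiv_def by blast

lemma pointed_equiv_trans [trans]:
  assumes "X \<simeq>\<^sub>* Y" "Y \<simeq>\<^sub>* Z"
  shows "X \<simeq>\<^sub>* Z"
proof -
  obtain f g where fg: "pointed_map X Y f" "pointed_map Y X g"
    "pointed_homotopic X X (g \<circ> f) id" "pointed_homotopic Y Y (f \<circ> g) id"
    using assms(1) unfolding pointed_equiv_def by blast
  obtain f' g' where fg': "pointed_map Y Z f'" "pointed_map Z Y g'"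
    "pointed_homotopic Y Y (g' \<circ> f') id" "pointed_homotopic Z Z (f' \<circ> g') id"
    using assms(2) unfolding pointed_equiv_def by blast
  \<comment> \<open>Sandwiching a homotopy from \<open>r\<close> to the identity between
    \<open>i\<close> and \<open>j\<close> removes the inner round trip; each of the two composites
    needs this once.\<close>
  have conj: "pointed_homotopic P P (j \<circ> r \<circ> i) (j \<circ> i)"
    if r: "pointed_homotopic R R r id" and i: "pointed_map P R i" and j: "pointed_map R P j"
    for P :: "'x pspace" and R :: "'y pspace" and i j r
  proof -
    have "homotopic_with (\<lambda>h. h (snd R) = snd P) (fst R) (fst P) (j \<circ> r) (j \<circ> id)"
      using r j unfolding pointed_homotopic_def pointed_map_def
      by (intro homotopic_with_compose_continuous_map_left[of "\<lambda>h. h (snd R) = snd R"]) auto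
    then have "homotopic_with (\<lambda>h. h (snd P) = snd P) (fst P) (fst P) (j \<circ> r \<circ> i) (j \<circ> id \<circ> i)"
      using i unfolding pointed_map_def
      by (intro homotopic_with_compose_continuous_map_right[of "\<lambda>h. h (snd R) = snd P"]) auto
    then show ?thesis
      unfolding pointed_homotopic_def by simp
  qed
  have "pointed_homotopic X X ((g \<circ> g') \<circ> (f' \<circ> f)) id"
    using conj[OF fg'(3) fg(1,2)] fg(3) unfolding pointed_homotopic_def o_assoc
    by (rule homotopic_with_trans)
  moreover have "pointed_homotopic Z Z ((f' \<circ> f) \<circ> (g \<circ> g')) id"
    using conj[OF fg(4) fg'(2,1)] fg'(4) unfolding pointed_homotopic_def o_assoc
    by (rule homotopic_with_trans)
  moreover have "pointed_map X Z (f' \<circ> f)" "pointed_map Z X (g \<circ> g')"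
    using fg fg' unfolding pointed_map_def by (auto intro: continuous_map_compose)
  ultimately show ?thesis
    unfolding pointed_equiv_def by blast
qed

text \<open>The interval is locally compact Hausdorff, so its product with a quotient map is again a
  quotient map. This is what lets homotopies descend to quotients of arbitrary spaces.\<close>

lemma continuous_map_prod_quotient:
  assumes "quotient_map X Y q"
    and "continuous_map (prod_topology unit_interval X) Z (\<lambda>(t, x). G (t, q x))"
  shows "continuous_map (prod_topology unit_interval Y) Z G"
proof -
  have "quotient_map (prod_topology unit_interval X) (prod_topology unit_interval Y)
      (\<lambda>(t, x). (t, q x))"
    by (intro quotient_map_prod_right assms(1) compact_imp_locally_compact_space)
      (auto simp: compact_space_subtopology Hausdorff_space_subtopology)
  then show ?thesis
    by (rule continuous_compose_quotient_map) (use assms(2) in \<open>simp add: o_def case_prod_unfold\<close>)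
qed

text \<open>The inverse of \<open>q\<close> is the factorisation of \<open>H (1, _)\<close> through
  \<open>q\<close>. Then \<open>H\<close> deforms the identity of \<open>Y\<close> into one
  composite, and the homotopy it induces on \<open>W\<close> deforms the identity of
  \<open>W\<close> into the other. The last two conditions say that these two factorisations
  exist.\<close>

lemma pointed_equiv_collapse:
  assumes Y: "pointed_space Y"
    and q: "quotient_map (fst Y) (fst W) q" "q (snd Y) = snd W"
    and H: "continuous_map (prod_topology unit_interval (fst Y)) (fst Y) H"
    and H0: "\<And>y. y \<in> topspace (fst Y) \<Longrightarrow> H (0, y) = y"
    and Hb: "\<And>t. t \<in> {0..1} \<Longrightarrow> H (t, snd Y) = snd Y"
    and Hq: "\<And>t y y'. \<lbrakk>t \<in> {0..1}; y \<in> topspace (fst Y); y' \<in> topspace (fst Y); q y = q y'\<rbrakk>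
        \<Longrightarrow> q (H (t, y)) = q (H (t, y'))"
    and H1: "\<And>y y'. \<lbrakk>y \<in> topspace (fst Y); y' \<in> topspace (fst Y); q y = q y'\<rbrakk>
        \<Longrightarrow> H (1, y) = H (1, y')"
  shows "Y \<simeq>\<^sub>* W"
proof -
  have YH: "snd Y \<in> topspace (fst Y)"
    using Y by (simp add: pointed_space_def)
  have W: "topspace (fst W) = q ` topspace (fst Y)"
    using q by (simp add: quotient_imp_surjective_map)
  have qc: "continuous_map (fst Y) (fst W) q"
    using q by (simp add: quotient_imp_continuous_map)
  have "continuous_map (fst Y) (fst Y) (\<lambda>y. H (1, y))"
    using continuous_map_o_Pair[OF H, of 1] by (simp add: o_def)
  then obtain g where g: "continuous_map (fst W) (fst Y) g"
    and gq: "\<And>y. y \<in> topspace (fst Y) \<Longrightarrow> g (q y) = H (1, y)"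
    using quotient_map_lift_exists[OF q(1), of "fst Y" "\<lambda>y. H (1, y)"] H1 by metis
  \<comment> \<open>A mere choice of representatives, not a continuous section; the continuity of
    \<open>L\<close> comes from \<open>q \<circ> H\<close> through the quotient map.\<close>
  define s where "s = inv_into (topspace (fst Y)) q"
  have s: "s w \<in> topspace (fst Y)" "q (s w) = w" if "w \<in> topspace (fst W)" for w
    using that W by (auto simp: s_def inv_into_into f_inv_into_f)
  define L where "L = (\<lambda>(t, w). q (H (t, s w)))"
  have Lq: "L (t, q y) = q (H (t, y))" if "t \<in> {0..1}" "y \<in> topspace (fst Y)" for t y
    unfolding L_def using that s[of "q y"] W by (auto intro: Hq)
  have L: "continuous_map (prod_topology unit_interval (fst W)) (fst W) L"
  proof (rule continuous_map_prod_quotient[OF q(1)])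
    have "continuous_map (prod_topology unit_interval (fst Y)) (fst W) (q \<circ> H)"
      using H qc by (rule continuous_map_compose)
    then show "continuous_map (prod_topology unit_interval (fst Y)) (fst W) (\<lambda>(t, y). L (t, q y))"
      by (rule continuous_map_eq) (auto simp: Lq)
  qed
  \<comment> \<open>\<open>H\<close> and \<open>L\<close> start at the identity, whereas
    \<open>pointed_equivI\<close> expects homotopies that end there: time is reversed.\<close>
  define r :: "real \<times> 'a \<Rightarrow> real \<times> 'a" where "r = (\<lambda>(t, x). (1 - t, x))"
  define r' :: "real \<times> 'b \<Rightarrow> real \<times> 'b" where "r' = (\<lambda>(t, x). (1 - t, x))"
  have flip: "continuous_map unit_interval unit_interval (\<lambda>t. 1 - t)"
    by (auto simp: continuous_map_in_subtopology intro!: continuous_intros)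
  have r: "continuous_map (prod_topology unit_interval (fst Y)) (prod_topology unit_interval (fst Y)) r"
    unfolding r_def case_prod_unfold
    by (intro continuous_map_pairedI continuous_map_compose[OF continuous_map_fst flip, unfolded o_def]
        continuous_map_snd)
  have r': "continuous_map (prod_topology unit_interval (fst W)) (prod_topology unit_interval (fst W)) r'"
    unfolding r'_def case_prod_unfold
    by (intro continuous_map_pairedI continuous_map_compose[OF continuous_map_fst flip, unfolded o_def]
        continuous_map_snd)
  show ?thesis
  proof (rule pointed_equivI[where f = q and g = g and H = "H \<circ> r" and K = "L \<circ> r'"])
    show "pointed_space W"
      using W YH q(2) unfolding pointed_space_def by (metis imageI)
    show "g (snd W) = snd Y"
      using gq[OF YH] Hb[of 1] q(2) by simp
    show "(L \<circ> r') (t, snd W) = snd W" if "t \<in> {0..1}" for t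
      using Lq[of "1 - t" "snd Y"] Hb[of "1 - t"] YH q(2) that by (simp add: r'_def)
    show "(L \<circ> r') (0, w) = q (g w)" "(L \<circ> r') (1, w) = w" if "w \<in> topspace (fst W)" for w
      using that W by (auto simp: r'_def Lq gq H0)
  qed (use Y q H H0 Hb g gq r r' L qc in \<open>auto simp: r_def intro: continuous_map_compose\<close>)
qed

section \<open>Quotients\<close>

definition collapse :: "'a pspace \<Rightarrow> 'a set \<Rightarrow> 'a \<Rightarrow> 'a" where
  "collapse X A u = (if u \<in> insert (snd X) A then snd X else u)"

lemma pquotient_collapse: "pquotient X A = (coinduced_topology (fst X) (collapse X A), snd X)"
  by (simp add: pquotient_def collapse_def [abs_def])

lemma snd_pquotient [simp]: "snd (pquotient X A) = snd X"
  by (simp add: pquotient_def)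

lemma quotient_map_collapse: "quotient_map (fst X) (fst (pquotient X A)) (collapse X A)"
  by (simp add: pquotient_collapse quotient_map_coinduced_topology)

lemma continuous_map_collapse: "continuous_map (fst X) (fst (pquotient X A)) (collapse X A)"
  by (intro quotient_imp_continuous_map quotient_map_collapse)

lemma topspace_pquotient: "topspace (fst (pquotient X A)) = collapse X A ` topspace (fst X)"
  by (simp add: pquotient_collapse)

lemma collapse_base [simp]: "collapse X A (snd X) = snd X"
  by (simp add: collapse_def)

lemma collapse_eq_base_iff: "collapse X A u = snd X \<longleftrightarrow> u \<in> insert (snd X) A"
  by (auto simp: collapse_def)

lemma collapse_eq_iff:
  "collapse X A u = collapse X A v \<longleftrightarrow> u = v \<or> (u \<in> insert (snd X) A \<and> v \<in> insert (snd X) A)"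
  by (auto simp: collapse_def)

lemma pointed_space_pquotient [simp]: "pointed_space X \<Longrightarrow> pointed_space (pquotient X A)"
  unfolding pointed_space_def snd_pquotient topspace_pquotient by (metis collapse_base imageI)

lemma pquotient_empty [simp]: "pquotient X {} = X"
proof -
  have "collapse X {} = id"
    by (auto simp: collapse_def)
  moreover have "openin (coinduced_topology (fst X) id) U \<longleftrightarrow> openin (fst X) U" for U
  proof (cases "U \<subseteq> topspace (fst X)")
    case True
    then have "{x \<in> topspace (fst X). x \<in> U} = U" by blast
    then show ?thesis by (simp add: openin_coinduced_topology True)
  qed (auto simp: openin_coinduced_topology dest: openin_subset)
  then have "coinduced_topology (fst X) id = fst X"
    by (simp add: topology_eq)
  ultimately show ?thesis
    by (simp add: pquotient_collapse)
qed

section \<open>Homeomorphic copies along injections\<close>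

lemma snd_transport [simp]: "snd (transport c X) = c (snd X)"
  by (simp add: transport_def)

lemma topspace_transport [simp]: "topspace (fst (transport c X)) = c ` topspace (fst X)"
  by (simp add: transport_def)

lemma pointed_space_transport [simp]: "pointed_space X \<Longrightarrow> pointed_space (transport c X)"
  by (simp add: pointed_space_def)

lemma continuous_map_transport: "continuous_map (fst X) (fst (transport c X)) c"
  unfolding transport_def by (simp add: quotient_imp_continuous_map quotient_map_coinduced_topology)

lemma continuous_map_transport_inv:
  assumes "inj c"
  shows "continuous_map (fst (transport c X)) (fst X) (inv c)"
proof -
  have "quotient_map (fst X) (fst (transport c X)) c"
    by (simp add: transport_def quotient_map_coinduced_topology)
  then show ?thesis
    by (rule continuous_compose_quotient_map) (simp add: assms)
qed

text \<open>Coinducing the topology along an injection makes it a homeomorphism onto its image, so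
  both homotopies are constant in time, that is, \<open>snd\<close>.\<close>

lemma pointed_equiv_transport:
  assumes "inj c" "pointed_space X"
  shows "X \<simeq>\<^sub>* transport c X"
  by (rule pointed_equivI[where f = c and g = "inv c" and H = snd and K = snd])
    (use assms in \<open>auto simp: continuous_map_snd continuous_map_transport
       continuous_map_transport_inv simp del: split_paired_All\<close>)

lemma pointed_cofibrationE:
  fixes Z :: "('a \<times> real + 'b) pspace" and A :: "'a pspace" and X :: "'b pspace"
  assumes i: "pointed_cofibration A X i" and f: "pointed_map X Z f"
    and h: "continuous_map (prod_topology unit_interval (fst A)) (fst Z) h"
    "\<And>u. u \<in> topspace (fst A) \<Longrightarrow> h (0, u) = f (i u)"
    "\<And>t. t \<in> {0..1} \<Longrightarrow> h (t, snd A) = snd Z"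
  obtains H where "continuous_map (prod_topology unit_interval (fst X)) (fst Z) H"
    "\<And>x. x \<in> topspace (fst X) \<Longrightarrow> H (0, x) = f x"
    "\<And>t u. t \<in> {0..1} \<Longrightarrow> u \<in> topspace (fst A) \<Longrightarrow> H (t, i u) = h (t, u)"
proof -
  note * = i[unfolded pointed_cofibration_def, THEN conjunct2, THEN spec, of Z, THEN spec, of f,
      THEN spec, of h]
  show ?thesis
    by (rule exE[OF mp[OF *]]) (use f h that in blast)+
qed

text \<open>The contraction of \<open>A\<close> extends to a homotopy of \<open>X\<close> that keeps
  the image of \<open>A\<close> in itself and ends by squashing it to the base point;
  \<open>pointed_equiv_collapse\<close> then applies to the collapse map.\<close>

lemma pointed_equiv_quotient_contractible:
  fixes A :: "'a pspace" and X :: "'b pspace"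
  assumes i: "pointed_cofibration A X i" and A: "pointed_space A" and X: "pointed_space X"
    and contr: "pointed_contractible A"
  shows "X \<simeq>\<^sub>* pquotient X (i ` topspace (fst A))"
proof -
  \<comment> \<open>Homotopies are extended into spaces of this type, so \<open>X\<close> enters as
    its copy under \<open>Inr\<close> and \<open>inv Inr\<close> brings the extension back.\<close>
  define Z :: "('a \<times> real + 'b) pspace" where "Z = transport Inr X"
  have iA: "continuous_map (fst A) (fst X) i" "i (snd A) = snd X"
    using i by (auto simp: pointed_cofibration_def pointed_map_def)
  have pA: "snd A \<in> topspace (fst A)"
    using A by (simp add: pointed_space_def)
  obtain c where c: "continuous_map (prod_topology unit_interval (fst A)) (fst A) c"
    and c0: "\<And>u. u \<in> topspace (fst A) \<Longrightarrow> c (0, u) = u"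
    and c1: "\<And>u. u \<in> topspace (fst A) \<Longrightarrow> c (1, u) = snd A"
    and cb: "\<And>t. t \<in> {0..1} \<Longrightarrow> c (t, snd A) = snd A"
    using contr unfolding pointed_contractible_iff[OF A] by blast
  have cA: "c (t, u) \<in> topspace (fst A)" if "t \<in> {0..1}" "u \<in> topspace (fst A)" for t u
    using c that by (auto simp: continuous_map_def)
  have h: "continuous_map (prod_topology unit_interval (fst A)) (fst Z) (Inr \<circ> (i \<circ> c))"
    unfolding Z_def by (intro continuous_map_compose[OF c] continuous_map_compose[OF _ continuous_map_transport] iA)
  have f: "pointed_map X Z Inr"
    by (simp add: pointed_map_def Z_def continuous_map_transport)
  obtain H where H: "continuous_map (prod_topology unit_interval (fst X)) (fst Z) H"
    and H0: "\<And>x. x \<in> topspace (fst X) \<Longrightarrow> H (0, x) = Inr x"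
    and HA: "\<And>t u. t \<in> {0..1} \<Longrightarrow> u \<in> topspace (fst A) \<Longrightarrow> H (t, i u) = (Inr \<circ> (i \<circ> c)) (t, u)"
    by (rule pointed_cofibrationE[OF i f h, rotated 2]) (simp_all add: c0 cb iA Z_def)
  define H' where "H' = inv Inr \<circ> H"
  have H'A: "H' (t, i u) = i (c (t, u))" if "t \<in> {0..1}" "u \<in> topspace (fst A)" for t u
    using HA[OF that] by (simp add: H'_def inj_on_def)
  have H'b: "H' (t, snd X) = snd X" if "t \<in> {0..1}" for t
    using H'A[OF that pA] cb[OF that] iA by simp
  have H'in: "H' (t, y) \<in> insert (snd X) (i ` topspace (fst A))"
    if "t \<in> {0..1}" "y \<in> insert (snd X) (i ` topspace (fst A))" for t y
    using that H'b H'A cA by force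
  show ?thesis
  proof (rule pointed_equiv_collapse[OF X quotient_map_collapse _ _ , where H = H'])
    show "continuous_map (prod_topology unit_interval (fst X)) (fst X) H'"
      unfolding H'_def using H unfolding Z_def
      by (rule continuous_map_compose) (simp add: continuous_map_transport_inv)
    show "H' (0, y) = y" if "y \<in> topspace (fst X)" for y
      using H0[OF that] by (simp add: H'_def inj_on_def)
    show "H' (1, y) = H' (1, y')"
      if "collapse X (i ` topspace (fst A)) y = collapse X (i ` topspace (fst A)) y'" for y y'
    proof -
      have "H' (1, z) = snd X" if "z \<in> insert (snd X) (i ` topspace (fst A))" for z
        using that H'b[of 1] H'A[of 1] c1 iA by auto
      then show ?thesis
        using that unfolding collapse_eq_iff by metis
    qed
    show "collapse X (i ` topspace (fst A)) (H' (t, y)) = collapse X (i ` topspace (fst A)) (H' (t, y'))"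
      if "t \<in> {0..1}" "collapse X (i ` topspace (fst A)) y = collapse X (i ` topspace (fst A)) y'" for t y y'
      using that H'in unfolding collapse_eq_iff by metis
  qed (use H'b in auto)
qed

text \<open>An equivalence of pairs descends: maps and homotopies that respect the collapsed sets
  factor through the collapse maps, the homotopies by
  \<open>continuous_map_prod_quotient\<close>.\<close>

lemma pquotient_pointed_equiv:
  assumes P: "pointed_space P" and R: "pointed_space R"
    and f: "continuous_map (fst P) (fst R) f" "f (snd P) = snd R" "\<And>x. x \<in> A \<Longrightarrow> f x \<in> insert (snd R) B"
    and g: "continuous_map (fst R) (fst P) g" "g (snd R) = snd P" "\<And>x. x \<in> B \<Longrightarrow> g x \<in> insert (snd P) A"
    and H: "continuous_map (prod_topology unit_interval (fst P)) (fst P) H"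
    "\<And>x. x \<in> topspace (fst P) \<Longrightarrow> H (0, x) = g (f x)"
    "\<And>x. x \<in> topspace (fst P) \<Longrightarrow> H (1, x) = x"
    "\<And>t. t \<in> {0..1} \<Longrightarrow> H (t, snd P) = snd P"
    "\<And>t x. t \<in> {0..1} \<Longrightarrow> x \<in> A \<Longrightarrow> H (t, x) \<in> insert (snd P) A"
    and K: "continuous_map (prod_topology unit_interval (fst R)) (fst R) K"
    "\<And>x. x \<in> topspace (fst R) \<Longrightarrow> K (0, x) = f (g x)"
    "\<And>x. x \<in> topspace (fst R) \<Longrightarrow> K (1, x) = x"
    "\<And>t. t \<in> {0..1} \<Longrightarrow> K (t, snd R) = snd R"
    "\<And>t x. t \<in> {0..1} \<Longrightarrow> x \<in> B \<Longrightarrow> K (t, x) \<in> insert (snd R) B"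
  shows "pquotient P A \<simeq>\<^sub>* pquotient R B"
proof -
  let ?p = "collapse P A" and ?r = "collapse R B"
  have map: "continuous_map (fst (pquotient U C)) (fst (pquotient V D)) (\<lambda>x. collapse V D (j x))"
    and desc: "collapse V D (j (collapse U C x)) = collapse V D (j x)"
    if "continuous_map (fst U) (fst V) j" "j (snd U) = snd V" "\<And>x. x \<in> C \<Longrightarrow> j x \<in> insert (snd V) D"
    for j x and U :: "'x pspace" and V :: "'y pspace" and C D
  proof -
    have *: "collapse V D (j (collapse U C x)) = collapse V D (j x)" for x
      using that(2,3) by (auto simp: collapse_def)
    have "continuous_map (fst U) (fst (pquotient V D)) ((\<lambda>x. collapse V D (j x)) \<circ> collapse U C)"
      using continuous_map_compose[OF that(1) continuous_map_collapse[of V D]] by (simp add: o_def *)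
    then show "continuous_map (fst (pquotient U C)) (fst (pquotient V D)) (\<lambda>x. collapse V D (j x))"
      by (rule continuous_compose_quotient_map[OF quotient_map_collapse])
    show "collapse V D (j (collapse U C x)) = collapse V D (j x)"
      by (rule *)
  qed
  have hom: "continuous_map (prod_topology unit_interval (fst (pquotient U C))) (fst (pquotient U C))
      (\<lambda>x. collapse U C (h x))"
    and hdesc: "\<And>t x. t \<in> {0..1} \<Longrightarrow> collapse U C (h (t, collapse U C x)) = collapse U C (h (t, x))"
    if "continuous_map (prod_topology unit_interval (fst U)) (fst U) h"
      "\<And>t. t \<in> {0..1} \<Longrightarrow> h (t, snd U) = snd U"
      "\<And>t x. t \<in> {0..1} \<Longrightarrow> x \<in> C \<Longrightarrow> h (t, x) \<in> insert (snd U) C"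
    for h and U :: "'x pspace" and C
  proof -
    show *: "collapse U C (h (t, collapse U C x)) = collapse U C (h (t, x))" if "t \<in> {0..1}" for t x
      using that \<open>\<And>t. t \<in> {0..1} \<Longrightarrow> h (t, snd U) = snd U\<close>[OF that]
        \<open>\<And>t x. t \<in> {0..1} \<Longrightarrow> x \<in> C \<Longrightarrow> h (t, x) \<in> insert (snd U) C\<close>[OF that, of x]
      by (auto simp: collapse_def)
    have "continuous_map (prod_topology unit_interval (fst U)) (fst (pquotient U C)) (collapse U C \<circ> h)"
      using that(1) continuous_map_collapse by (rule continuous_map_compose)
    then have "continuous_map (prod_topology unit_interval (fst U)) (fst (pquotient U C))
        (\<lambda>(t, x). collapse U C (h (t, collapse U C x)))"
      by (rule continuous_map_eq) (auto simp: *)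
    then show "continuous_map (prod_topology unit_interval (fst (pquotient U C))) (fst (pquotient U C))
      (\<lambda>x. collapse U C (h x))"
      by (intro continuous_map_prod_quotient[OF quotient_map_collapse[of U C]]) (simp add: case_prod_unfold)
  qed
  \<comment> \<open>Points of a quotient represent themselves, so the conditions at times 0 and 1
    can be checked in the original spaces.\<close>
  have top: "x \<in> topspace (fst U) \<and> collapse U C x = x"
    if "pointed_space U" "x \<in> topspace (fst (pquotient U C))" for U :: "'x pspace" and C x
    using that by (auto simp: topspace_pquotient collapse_def pointed_space_def)
  note pf = map[of P R f A B, OF f] and pg = map[of R P g B A, OF g]
    and pH = hom[of P H A, OF H(1,4,5)] and pK = hom[of R K B, OF K(1,4,5)]
    and dg = desc[of R P g B A, OF g] and df = desc[of P R f A B, OF f]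
  show ?thesis
  proof (rule pointed_equivI[where f = "\<lambda>x. ?r (f x)" and g = "\<lambda>x. ?p (g x)"
        and H = "\<lambda>x. ?p (H x)" and K = "\<lambda>x. ?r (K x)"])
    show "?p (H (0, x)) = ?p (g (?r (f x)))" "?p (H (1, x)) = x"
      if "x \<in> topspace (fst (pquotient P A))" for x
      using top[OF P that] by (simp_all add: dg H)
    show "?r (K (0, x)) = ?r (f (?p (g x)))" "?r (K (1, x)) = x"
      if "x \<in> topspace (fst (pquotient R B))" for x
      using top[OF R that] by (simp_all add: df K)
  qed (simp_all only: snd_pquotient collapse_base pf pg pH pK f(2) g(2) H(4) K(4)
      pointed_space_pquotient P R)
qed

section \<open>Contractibility, smash products and suspensions\<close>

text \<open>Reduces the invariance of contractibility to transitivity, and its behaviour under smash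
  and suspension to the case of a point. The point \<open>b\<close> may have any type.\<close>

lemma pointed_contractible_iff_point:
  assumes "pointed_space X"
  shows "pointed_contractible X \<longleftrightarrow> X \<simeq>\<^sub>* (discrete_topology {b}, b)"
proof
  assume "pointed_contractible X"
  then have "pointed_homotopic X X (\<lambda>_. snd X) id"
    unfolding pointed_contractible_def pointed_homotopic_def by (rule homotopic_with_symD)
  moreover have "pointed_homotopic (discrete_topology {b}, b) (discrete_topology {b}, b) (\<lambda>_. b) id"
    unfolding pointed_homotopic_def by (rule homotopic_with_equal) auto
  ultimately show "X \<simeq>\<^sub>* (discrete_topology {b}, b)"
    unfolding pointed_equiv_def pointed_map_def using assms
    by (intro exI[of _ "\<lambda>_. b"] exI[of _ "\<lambda>_. snd X"]) (simp add: pointed_space_def o_def)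
next
  assume "X \<simeq>\<^sub>* (discrete_topology {b}, b)"
  then obtain f g where fg: "pointed_map X (discrete_topology {b}, b) f"
      "pointed_map (discrete_topology {b}, b) X g" "pointed_homotopic X X (g \<circ> f) id"
    unfolding pointed_equiv_def by blast
  from fg(3) have "pointed_homotopic X X id (g \<circ> f)"
    unfolding pointed_homotopic_def by (rule homotopic_with_symD)
  moreover have "(g \<circ> f) x = snd X" if "x \<in> topspace (fst X)" for x
  proof -
    have "f x = b" "g b = snd X"
      using fg(1,2) that by (auto simp: pointed_map_def continuous_map_def)
    then show ?thesis by simp
  qed
  ultimately show "pointed_contractible X"
    unfolding pointed_contractible_def pointed_homotopic_iff[OF assms] by simp
qed

lemma pointed_contractible_singleton:
  "topspace (fst X) = {snd X} \<Longrightarrow> pointed_contractible X"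
  unfolding pointed_contractible_def pointed_homotopic_def by (rule homotopic_with_equal) auto

lemma pointed_contractible_cong:
  assumes "X \<simeq>\<^sub>* Y" "pointed_space X"
  shows "pointed_contractible X \<longleftrightarrow> pointed_contractible Y"
  unfolding pointed_contractible_iff_point[OF assms(2), of "()"]
    pointed_contractible_iff_point[OF pointed_space_equiv[OF assms], of "()"]
  by (rule iffI[OF pointed_equiv_trans[OF pointed_equiv_sym[OF assms(1)]]
      pointed_equiv_trans[OF assms(1)]])

section \<open>Homotopy invariance of smash products and suspensions\<close>

lemma pointed_space_smash: "pointed_space X \<Longrightarrow> pointed_space Y \<Longrightarrow> pointed_space (smash X Y)"
  unfolding smash_def by (intro pointed_space_pquotient) (simp add: pointed_space_def)

lemma continuous_map_in_topspace:
  "continuous_map U V h \<Longrightarrow> x \<in> topspace U \<Longrightarrow> h x \<in> topspace V"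
  by (auto simp: continuous_map_def)

lemma homotopy_in_topspace:
  "continuous_map (prod_topology unit_interval U) V h \<Longrightarrow> x \<in> topspace U \<Longrightarrow> t \<in> {0..1} \<Longrightarrow> h (t, x) \<in> topspace V"
  by (auto simp: continuous_map_def)

lemma continuous_map_prod_maps:
  assumes "continuous_map U U' h" "continuous_map V V' k"
  shows "continuous_map (prod_topology U V) (prod_topology U' V') (\<lambda>(x, y). (h x, k y))"
  unfolding case_prod_unfold
  by (intro continuous_map_pairedI continuous_map_compose[OF continuous_map_fst assms(1), unfolded o_def]
      continuous_map_compose[OF continuous_map_snd assms(2), unfolded o_def])

lemma continuous_map_prod_homotopies:
  assumes "continuous_map (prod_topology unit_interval U) U' h"
    and "continuous_map (prod_topology unit_interval V) V' k"
  shows "continuous_map (prod_topology unit_interval (prod_topology U V)) (prod_topology U' V')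
      (\<lambda>(t, x, y). (h (t, x), k (t, y)))"
proof -
  have p: "continuous_map (prod_topology unit_interval (prod_topology U V)) (prod_topology unit_interval U)
        (\<lambda>p. (fst p, fst (snd p)))"
      "continuous_map (prod_topology unit_interval (prod_topology U V)) (prod_topology unit_interval V)
        (\<lambda>p. (fst p, snd (snd p)))"
    by (intro continuous_map_pairedI continuous_map_fst
        continuous_map_compose[OF continuous_map_snd continuous_map_fst, unfolded o_def]
        continuous_map_compose[OF continuous_map_snd continuous_map_snd, unfolded o_def])+
  show ?thesis
    unfolding case_prod_unfold
    by (rule continuous_map_pairedI
        [OF continuous_map_compose[OF p(1) assms(1), unfolded o_def]
          continuous_map_compose[OF p(2) assms(2), unfolded o_def]])
qed

text \<open>Products of pointed maps and of pointed homotopies carry the wedge of the two axes into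
  the wedge, so they pass to the smash products.\<close>

lemma smash_cong:
  assumes "X \<simeq>\<^sub>* X'" "Y \<simeq>\<^sub>* Y'" "pointed_space X" "pointed_space Y"
  shows "smash X Y \<simeq>\<^sub>* smash X' Y'"
proof -
  obtain f g H K where X: "pointed_space X'"
    "continuous_map (fst X) (fst X') f" "f (snd X) = snd X'"
    "continuous_map (fst X') (fst X) g" "g (snd X') = snd X"
    "continuous_map (prod_topology unit_interval (fst X)) (fst X) H"
    "\<And>x. x \<in> topspace (fst X) \<Longrightarrow> H (0, x) = g (f x)"
    "\<And>x. x \<in> topspace (fst X) \<Longrightarrow> H (1, x) = x"
    "\<And>t. t \<in> {0..1} \<Longrightarrow> H (t, snd X) = snd X"
    "continuous_map (prod_topology unit_interval (fst X')) (fst X') K"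
    "\<And>y. y \<in> topspace (fst X') \<Longrightarrow> K (0, y) = f (g y)"
    "\<And>y. y \<in> topspace (fst X') \<Longrightarrow> K (1, y) = y"
    "\<And>t. t \<in> {0..1} \<Longrightarrow> K (t, snd X') = snd X'"
    proof (rule pointed_equivE[OF assms(1,3)], goal_cases)
      case (1 f g H K)
      show ?case by (rule 1(1)[of f g H K, OF 1(2-)])
    qed
  obtain f' g' H' K' where Y: "pointed_space Y'"
    "continuous_map (fst Y) (fst Y') f'" "f' (snd Y) = snd Y'"
    "continuous_map (fst Y') (fst Y) g'" "g' (snd Y') = snd Y"
    "continuous_map (prod_topology unit_interval (fst Y)) (fst Y) H'"
    "\<And>x. x \<in> topspace (fst Y) \<Longrightarrow> H' (0, x) = g' (f' x)"
    "\<And>x. x \<in> topspace (fst Y) \<Longrightarrow> H' (1, x) = x"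
    "\<And>t. t \<in> {0..1} \<Longrightarrow> H' (t, snd Y) = snd Y"
    "continuous_map (prod_topology unit_interval (fst Y')) (fst Y') K'"
    "\<And>y. y \<in> topspace (fst Y') \<Longrightarrow> K' (0, y) = f' (g' y)"
    "\<And>y. y \<in> topspace (fst Y') \<Longrightarrow> K' (1, y) = y"
    "\<And>t. t \<in> {0..1} \<Longrightarrow> K' (t, snd Y') = snd Y'"
    proof (rule pointed_equivE[OF assms(2,4)], goal_cases)
      case (1 f g H K)
      show ?case by (rule 1(1)[of f g H K, OF 1(2-)])
    qed
  note mem = continuous_map_in_topspace[OF X(2)] continuous_map_in_topspace[OF X(4)]
    continuous_map_in_topspace[OF Y(2)] continuous_map_in_topspace[OF Y(4)]
    homotopy_in_topspace[OF X(6)] homotopy_in_topspace[OF Y(6)]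
    homotopy_in_topspace[OF X(10)] homotopy_in_topspace[OF Y(10)]
  show ?thesis
    unfolding smash_def
  proof (rule pquotient_pointed_equiv[where f = "\<lambda>(x, y). (f x, f' y)" and g = "\<lambda>(x, y). (g x, g' y)"
          and H = "\<lambda>(t, x, y). (H (t, x), H' (t, y))" and K = "\<lambda>(t, x, y). (K (t, x), K' (t, y))"],
        goal_cases)
    case 1
    show ?case using assms(3,4) by (simp add: pointed_space_def)
  next
    case 2
    show ?case using X(1) Y(1) by (simp add: pointed_space_def)
  next
    case 3
    show ?case using continuous_map_prod_maps[OF X(2) Y(2)] by (simp only: fst_conv)
  next
    case (5 x)
    then show ?case using X(3) Y(3) mem(1,3) by force
  next
    case 6
    show ?case using continuous_map_prod_maps[OF X(4) Y(4)] by (simp only: fst_conv)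
  next
    case (8 x)
    then show ?case using X(5) Y(5) mem(2,4) by force
  next
    case 9
    show ?case using continuous_map_prod_homotopies[OF X(6) Y(6)] by (simp only: fst_conv)
  next
    case (13 t x)
    then show ?case using X(9)[of t] Y(9)[of t] mem(5)[of _ t] mem(6)[of _ t] by force
  next
    case 14
    show ?case using continuous_map_prod_homotopies[OF X(10) Y(10)] by (simp only: fst_conv)
  next
    case (18 t x)
    then show ?case using X(13)[of t] Y(13)[of t] mem(7)[of _ t] mem(8)[of _ t] by force
  next
    case 4
    show ?case by (simp add: X(3) Y(3))
  next
    case 7
    show ?case by (simp add: X(5) Y(5))
  next
    case (10 x)
    then show ?case by (cases x) (simp add: X(7) Y(7))
  next
    case (11 x)
    then show ?case by (cases x) (simp add: X(8) Y(8))
  next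
    case (12 t)
    then show ?case by (simp add: X(9) Y(9))
  next
    case (15 x)
    then show ?case by (cases x) (simp add: X(11) Y(11))
  next
    case (16 x)
    then show ?case by (cases x) (simp add: X(12) Y(12))
  next
    case (17 t)
    then show ?case by (simp add: X(13) Y(13))
  qed
qed

text \<open>Up to equivalence the contractible factor is a point, and the smash product with a point
  is a point.\<close>

lemma pointed_contractible_smash_left:
  assumes "pointed_contractible X" "pointed_space X" "pointed_space Y"
  shows "pointed_contractible (smash X Y)"
proof -
  let ?P = "(discrete_topology {snd X}, snd X)"
  have "X \<simeq>\<^sub>* ?P"
    by (rule iffD1[OF pointed_contractible_iff_point[OF assms(2)] assms(1)])
  then have "smash X Y \<simeq>\<^sub>* smash ?P Y"
    by (rule smash_cong[OF _ pointed_equiv_refl assms(2,3)])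
  moreover have "topspace (fst (smash ?P Y)) = {snd (smash ?P Y)}"
    using assms(3) by (auto simp: smash_def topspace_pquotient collapse_def pointed_space_def)
  then have "pointed_contractible (smash ?P Y)"
    by (rule pointed_contractible_singleton)
  ultimately show ?thesis
    by (rule iffD2[OF pointed_contractible_cong[OF _ pointed_space_smash[OF assms(2,3)]]])
qed

lemma pointed_contractible_smash_right:
  assumes "pointed_contractible Y" "pointed_space X" "pointed_space Y"
  shows "pointed_contractible (smash X Y)"
proof -
  let ?P = "(discrete_topology {snd Y}, snd Y)"
  have "Y \<simeq>\<^sub>* ?P"
    by (rule iffD1[OF pointed_contractible_iff_point[OF assms(3)] assms(1)])
  then have "smash X Y \<simeq>\<^sub>* smash X ?P"
    by (rule smash_cong[OF pointed_equiv_refl _ assms(2,3)])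
  moreover have "topspace (fst (smash X ?P)) = {snd (smash X ?P)}"
    using assms(2) by (auto simp: smash_def topspace_pquotient collapse_def pointed_space_def)
  then have "pointed_contractible (smash X ?P)"
    by (rule pointed_contractible_singleton)
  ultimately show ?thesis
    by (rule iffD2[OF pointed_contractible_cong[OF _ pointed_space_smash[OF assms(2,3)]]])
qed

lemma pointed_space_reduced_susp: "pointed_space X \<Longrightarrow> pointed_space (reduced_susp X)"
  unfolding reduced_susp_def by (intro pointed_space_pquotient) (simp add: pointed_space_def)

lemma reduced_susp_cong:
  assumes "X \<simeq>\<^sub>* X'" "pointed_space X"
  shows "reduced_susp X \<simeq>\<^sub>* reduced_susp X'"
proof -
  obtain f g H K where X: "pointed_space X'"
    "continuous_map (fst X) (fst X') f" "f (snd X) = snd X'"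
    "continuous_map (fst X') (fst X) g" "g (snd X') = snd X"
    "continuous_map (prod_topology unit_interval (fst X)) (fst X) H"
    "\<And>x. x \<in> topspace (fst X) \<Longrightarrow> H (0, x) = g (f x)"
    "\<And>x. x \<in> topspace (fst X) \<Longrightarrow> H (1, x) = x"
    "\<And>t. t \<in> {0..1} \<Longrightarrow> H (t, snd X) = snd X"
    "continuous_map (prod_topology unit_interval (fst X')) (fst X') K"
    "\<And>y. y \<in> topspace (fst X') \<Longrightarrow> K (0, y) = f (g y)"
    "\<And>y. y \<in> topspace (fst X') \<Longrightarrow> K (1, y) = y"
    "\<And>t. t \<in> {0..1} \<Longrightarrow> K (t, snd X') = snd X'"
    proof (rule pointed_equivE[OF assms(1,2)], goal_cases)
      case (1 f g H K)
      show ?case by (rule 1(1)[of f g H K, OF 1(2-)])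
    qed
  note mem = continuous_map_in_topspace[OF X(2)] continuous_map_in_topspace[OF X(4)]
    homotopy_in_topspace[OF X(6)] homotopy_in_topspace[OF X(10)]
  \<comment> \<open>The constant homotopy of the suspension coordinate, in the form that
    \<open>continuous_map_prod_homotopies\<close> takes.\<close>
  have snd: "continuous_map (prod_topology unit_interval unit_interval) unit_interval snd"
    by (rule continuous_map_snd)
  show ?thesis
    unfolding reduced_susp_def
  proof (rule pquotient_pointed_equiv[where f = "\<lambda>(x, s). (f x, s)" and g = "\<lambda>(x, s). (g x, s)"
          and H = "\<lambda>(t, x, s). (H (t, x), s)" and K = "\<lambda>(t, x, s). (K (t, x), s)"], goal_cases)
    case 1
    show ?case using assms(2) by (simp add: pointed_space_def)
  next
    case 2
    show ?case using X(1) by (simp add: pointed_space_def)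
  next
    case 3
    show ?case using continuous_map_prod_maps[OF X(2) continuous_map_id] by (simp only: fst_conv id_apply)
  next
    case (5 x)
    then show ?case using X(3) mem(1) by force
  next
    case 6
    show ?case using continuous_map_prod_maps[OF X(4) continuous_map_id] by (simp only: fst_conv id_apply)
  next
    case (8 x)
    then show ?case using X(5) mem(2) by force
  next
    case 9
    show ?case using continuous_map_prod_homotopies[OF X(6) snd] by (simp only: fst_conv snd_conv)
  next
    case (13 t x)
    then show ?case using X(9)[of t] mem(3)[of _ t] by force
  next
    case 14
    show ?case using continuous_map_prod_homotopies[OF X(10) snd] by (simp only: fst_conv snd_conv)
  next
    case (18 t x)
    then show ?case using X(13)[of t] mem(4)[of _ t] by force
  next
    case 4
    show ?case by (simp add: X(3))
  next
    case 7
    show ?case by (simp add: X(5))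
  next
    case (10 x)
    then show ?case by (cases x) (simp add: X(7))
  next
    case (11 x)
    then show ?case by (cases x) (simp add: X(8))
  next
    case (12 t)
    then show ?case by (simp add: X(9))
  next
    case (15 x)
    then show ?case by (cases x) (simp add: X(11))
  next
    case (16 x)
    then show ?case by (cases x) (simp add: X(12))
  next
    case (17 t)
    then show ?case by (simp add: X(13))
  qed
qed

lemma pointed_contractible_reduced_susp:
  assumes "pointed_contractible X" "pointed_space X"
  shows "pointed_contractible (reduced_susp X)"
proof -
  let ?P = "(discrete_topology {snd X}, snd X)"
  have "X \<simeq>\<^sub>* ?P"
    by (rule iffD1[OF pointed_contractible_iff_point[OF assms(2)] assms(1)])
  then have "reduced_susp X \<simeq>\<^sub>* reduced_susp ?P"
    by (rule reduced_susp_cong[OF _ assms(2)])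
  moreover have "topspace (fst (reduced_susp ?P)) = {snd (reduced_susp ?P)}"
    by (auto simp: reduced_susp_def topspace_pquotient collapse_def intro!: image_eqI[of _ _ "(snd X, 0)"])
  then have "pointed_contractible (reduced_susp ?P)"
    by (rule pointed_contractible_singleton)
  ultimately show ?thesis
    by (rule iffD2[OF pointed_contractible_cong[OF _ pointed_space_reduced_susp[OF assms(2)]]])
qed

section \<open>Quotients of contractible spaces\<close>

definition coprod_topology :: "'a topology \<Rightarrow> 'b topology \<Rightarrow> ('a + 'b) topology" where
  "coprod_topology P Q = topology (\<lambda>U. openin P (Inl -` U) \<and> openin Q (Inr -` U))"

lemma openin_coprod_topology:
  "openin (coprod_topology P Q) U \<longleftrightarrow> openin P (Inl -` U) \<and> openin Q (Inr -` U)"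
proof -
  have "istopology (\<lambda>U. openin P (Inl -` U) \<and> openin Q (Inr -` U))"
    unfolding istopology_def
  proof (intro conjI allI impI)
    fix \<K> assume K: "\<forall>K\<in>\<K>. openin P (Inl -` K) \<and> openin Q (Inr -` K)"
    show "openin P (Inl -` \<Union>\<K>)" "openin Q (Inr -` \<Union>\<K>)"
      unfolding vimage_Union by (rule openin_Union, use K in blast)+
  qed (simp_all add: openin_Int)
  then show ?thesis
    by (simp add: coprod_topology_def topology_inverse')
qed

lemma topspace_coprod_topology: "topspace (coprod_topology P Q) = Inl ` topspace P \<union> Inr ` topspace Q"
proof
  have "openin (coprod_topology P Q) (topspace (coprod_topology P Q))" by blast
  then have "Inl -` topspace (coprod_topology P Q) \<subseteq> topspace P" "Inr -` topspace (coprod_topology P Q) \<subseteq> topspace Q"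
    unfolding openin_coprod_topology by (simp_all add: openin_subset)
  then have "z \<in> Inl ` topspace P \<union> Inr ` topspace Q" if "z \<in> topspace (coprod_topology P Q)" for z
    using that by (cases z) auto
  then show "topspace (coprod_topology P Q) \<subseteq> Inl ` topspace P \<union> Inr ` topspace Q"
    by blast
  have "Inl -` (Inl ` topspace P \<union> Inr ` topspace Q) = topspace P"
    "Inr -` (Inl ` topspace P \<union> Inr ` topspace Q) = topspace Q" by auto
  then have "openin (coprod_topology P Q) (Inl ` topspace P \<union> Inr ` topspace Q)"
    unfolding openin_coprod_topology by simp
  then show "Inl ` topspace P \<union> Inr ` topspace Q \<subseteq> topspace (coprod_topology P Q)"
    by (rule openin_subset)
qed

lemma continuous_map_Inl: "continuous_map P (coprod_topology P Q) Inl"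
  unfolding continuous_map_def
proof (intro conjI allI impI)
  fix U assume "openin (coprod_topology P Q) U"
  then have "openin P (Inl -` U)" by (simp add: openin_coprod_topology)
  moreover from this have "{x \<in> topspace P. Inl x \<in> U} = Inl -` U"
    by (auto dest: openin_subset)
  ultimately show "openin P {x \<in> topspace P. Inl x \<in> U}" by simp
qed (auto simp: topspace_coprod_topology)

lemma continuous_map_Inr: "continuous_map Q (coprod_topology P Q) Inr"
  unfolding continuous_map_def
proof (intro conjI allI impI)
  fix U assume "openin (coprod_topology P Q) U"
  then have "openin Q (Inr -` U)" by (simp add: openin_coprod_topology)
  moreover from this have "{x \<in> topspace Q. Inr x \<in> U} = Inr -` U"
    by (auto dest: openin_subset)
  ultimately show "openin Q {x \<in> topspace Q. Inr x \<in> U}" by simp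
qed (auto simp: topspace_coprod_topology)

lemma continuous_map_coprod:
  assumes "continuous_map P Z (\<lambda>x. g (Inl x))" "continuous_map Q Z (\<lambda>y. g (Inr y))"
  shows "continuous_map (coprod_topology P Q) Z g"
  unfolding continuous_map_def
proof (intro conjI allI impI)
  show "g \<in> topspace (coprod_topology P Q) \<rightarrow> topspace Z"
    using assms by (auto simp: topspace_coprod_topology continuous_map_def)
  fix W assume W: "openin Z W"
  have "Inl -` {z \<in> topspace (coprod_topology P Q). g z \<in> W} = {x \<in> topspace P. g (Inl x) \<in> W}"
    "Inr -` {z \<in> topspace (coprod_topology P Q). g z \<in> W} = {x \<in> topspace Q. g (Inr x) \<in> W}"
    by (auto simp: topspace_coprod_topology)
  then show "openin (coprod_topology P Q) {z \<in> topspace (coprod_topology P Q). g z \<in> W}"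
    using assms W by (simp add: openin_coprod_topology continuous_map_def)
qed

text \<open>Openness in a product is tested on rectangles, and a rectangle for one summand stays a
  rectangle because \<open>Inl\<close> and \<open>Inr\<close> send open sets to open sets.\<close>

lemma continuous_map_prod_coprod:
  assumes l: "continuous_map (prod_topology T P) Z (\<lambda>(t, x). G (t, Inl x))"
    and r: "continuous_map (prod_topology T Q) Z (\<lambda>(t, y). G (t, Inr y))"
  shows "continuous_map (prod_topology T (coprod_topology P Q)) Z G"
  unfolding continuous_map_def
proof (intro conjI allI impI)
  show "G \<in> topspace (prod_topology T (coprod_topology P Q)) \<rightarrow> topspace Z"
  proof
    fix z assume "z \<in> topspace (prod_topology T (coprod_topology P Q))"
    then consider t x where "z = (t, Inl x)" "(t, x) \<in> topspace (prod_topology T P)"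
      | t x where "z = (t, Inr x)" "(t, x) \<in> topspace (prod_topology T Q)"
      by (auto simp: topspace_coprod_topology)
    then show "G z \<in> topspace Z"
    proof cases
      case 1
      then show ?thesis using continuous_map_in_topspace[OF l 1(2)] by simp
    next
      case 2
      then show ?thesis using continuous_map_in_topspace[OF r 2(2)] by simp
    qed
  qed
  fix W assume W: "openin Z W"
  show "openin (prod_topology T (coprod_topology P Q))
      {z \<in> topspace (prod_topology T (coprod_topology P Q)). G z \<in> W}" (is "openin _ ?S")
    unfolding openin_prod_topology_alt
  proof (intro allI impI)
    fix t z assume tz: "(t, z) \<in> ?S"
    show "\<exists>U V. openin T U \<and> openin (coprod_topology P Q) V \<and> t \<in> U \<and> z \<in> V \<and> U \<times> V \<subseteq> ?S"
    proof (cases z)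
      case (Inl x)
      define R where "R = {p \<in> topspace (prod_topology T P). (\<lambda>(t, x). G (t, Inl x)) p \<in> W}"
      have "openin (prod_topology T P) R"
        unfolding R_def using l W by (rule openin_continuous_map_preimage)
      moreover have "(t, x) \<in> R"
        using tz unfolding Inl by (auto simp: R_def topspace_coprod_topology)
      ultimately have "\<exists>U V. openin T U \<and> openin P V \<and> t \<in> U \<and> x \<in> V \<and> U \<times> V \<subseteq> R"
        by (rule openin_prod_topology_alt[THEN iffD1, rule_format])
      then obtain U V where UV: "openin T U" "openin P V" "t \<in> U" "x \<in> V" "U \<times> V \<subseteq> R"
        by blast
      have "openin (coprod_topology P Q) (Inl ` V)"
        using UV(2) by (simp add: openin_coprod_topology vimage_def image_iff)
      moreover have *: "(t', Inl x') \<in> ?S" if "t' \<in> U" "x' \<in> V" for t' x'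
        using subsetD[OF UV(5), of "(t', x')"] that by (simp add: R_def topspace_coprod_topology)
      have "U \<times> Inl ` V \<subseteq> ?S"
        by (rule subsetI, elim SigmaE imageE) (simp only: *)
      ultimately show ?thesis
        unfolding Inl using UV(1,3,4) by (intro exI[of _ U] exI[of _ "Inl ` V"] conjI imageI)
    next
      case (Inr x)
      define R where "R = {p \<in> topspace (prod_topology T Q). (\<lambda>(t, x). G (t, Inr x)) p \<in> W}"
      have "openin (prod_topology T Q) R"
        unfolding R_def using r W by (rule openin_continuous_map_preimage)
      moreover have "(t, x) \<in> R"
        using tz unfolding Inr by (auto simp: R_def topspace_coprod_topology)
      ultimately have "\<exists>U V. openin T U \<and> openin Q V \<and> t \<in> U \<and> x \<in> V \<and> U \<times> V \<subseteq> R"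
        by (rule openin_prod_topology_alt[THEN iffD1, rule_format])
      then obtain U V where UV: "openin T U" "openin Q V" "t \<in> U" "x \<in> V" "U \<times> V \<subseteq> R"
        by blast
      have "openin (coprod_topology P Q) (Inr ` V)"
        using UV(2) by (simp add: openin_coprod_topology vimage_def image_iff)
      moreover have *: "(t', Inr x') \<in> ?S" if "t' \<in> U" "x' \<in> V" for t' x'
        using subsetD[OF UV(5), of "(t', x')"] that by (simp add: R_def topspace_coprod_topology)
      have "U \<times> Inr ` V \<subseteq> ?S"
        by (rule subsetI, elim SigmaE imageE) (simp only: *)
      ultimately show ?thesis
        unfolding Inr using UV(1,3,4) by (intro exI[of _ U] exI[of _ "Inr ` V"] conjI imageI)
    qed
  qed
qed

text \<open>A point of the mapping cone is represented by itself, except that the base of the cone is glued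
  to \<open>X\<close>, and its apex and the segment over the base point are collapsed to the base point.\<close>

definition cone_rep :: "'a pspace \<Rightarrow> 'b pspace \<Rightarrow> ('a \<Rightarrow> 'b) \<Rightarrow> 'a \<times> real + 'b \<Rightarrow> 'a \<times> real + 'b" where
  "cone_rep A X i z = (case z of Inr x \<Rightarrow> Inr x
     | Inl (u, s) \<Rightarrow> if s = 0 then Inr (i u) else if s = 1 \<or> u = snd A then Inr (snd X) else Inl (u, s))"

text \<open>The reduced mapping cone. Its points have the type of the test spaces in
  \<open>pointed_cofibration\<close>, so homotopies on \<open>A\<close> can be extended with the
  cone itself as target.\<close>

definition mapping_cone :: "'a pspace \<Rightarrow> 'b pspace \<Rightarrow> ('a \<Rightarrow> 'b) \<Rightarrow> ('a \<times> real + 'b) pspace" where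
  "mapping_cone A X i =
     (coinduced_topology (coprod_topology (prod_topology (fst A) unit_interval) (fst X)) (cone_rep A X i),
      Inr (snd X))"

lemma cone_rep_simps [simp]:
  "cone_rep A X i (Inr x) = Inr x"
  "cone_rep A X i (Inl (u, 0)) = Inr (i u)"
  "cone_rep A X i (Inl (u, 1)) = Inr (snd X)"
  by (simp_all add: cone_rep_def)

lemma cone_rep_base [simp]: "i (snd A) = snd X \<Longrightarrow> cone_rep A X i (Inl (snd A, s)) = Inr (snd X)"
  by (simp add: cone_rep_def)

lemma snd_mapping_cone [simp]: "snd (mapping_cone A X i) = Inr (snd X)"
  by (simp add: mapping_cone_def)

lemma quotient_map_cone_rep:
  "quotient_map (coprod_topology (prod_topology (fst A) unit_interval) (fst X)) (fst (mapping_cone A X i))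
     (cone_rep A X i)"
  by (simp add: mapping_cone_def quotient_map_coinduced_topology)

lemma topspace_mapping_cone:
  "topspace (fst (mapping_cone A X i)) =
     (\<lambda>p. cone_rep A X i (Inl p)) ` (topspace (fst A) \<times> {0..1}) \<union> Inr ` topspace (fst X)"
  unfolding mapping_cone_def fst_conv topspace_coinduced_topology topspace_coprod_topology
  by (auto simp: image_Un image_image)

lemma continuous_map_cone_Inl:
  "continuous_map (prod_topology (fst A) unit_interval) (fst (mapping_cone A X i)) (\<lambda>p. cone_rep A X i (Inl p))"
  using continuous_map_compose[OF continuous_map_Inl quotient_imp_continuous_map[OF quotient_map_cone_rep]]
  by (simp add: o_def)

lemma continuous_map_cone_Inr: "continuous_map (fst X) (fst (mapping_cone A X i)) Inr"
  using continuous_map_compose[OF continuous_map_Inr quotient_imp_continuous_map[OF quotient_map_cone_rep]]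
  by (simp add: o_def)

text \<open>Composing with \<open>cone_rep\<close> moves the question to the disjoint union, where a
  quotient map on either summand already determines the topology of \<open>W\<close>.\<close>

lemma quotient_map_mapping_cone:
  assumes l: "continuous_map (prod_topology (fst A) unit_interval) W (\<lambda>p. q (cone_rep A X i (Inl p)))"
    and r: "continuous_map (fst X) W (\<lambda>x. q (Inr x))"
    and "quotient_map (prod_topology (fst A) unit_interval) W (\<lambda>p. q (cone_rep A X i (Inl p)))
      \<or> quotient_map (fst X) W (\<lambda>x. q (Inr x))"
  shows "quotient_map (fst (mapping_cone A X i)) W q"
proof -
  let ?S = "coprod_topology (prod_topology (fst A) unit_interval) (fst X)"
  have c: "continuous_map ?S W (q \<circ> cone_rep A X i)"
    by (rule continuous_map_coprod) (simp_all add: l r)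
  have "quotient_map ?S W (q \<circ> cone_rep A X i)"
    using assms(3)
  proof
    assume "quotient_map (prod_topology (fst A) unit_interval) W (\<lambda>p. q (cone_rep A X i (Inl p)))"
    then show ?thesis
      by (intro quotient_map_from_composition[OF continuous_map_Inl c]) (simp add: o_def)
  next
    assume "quotient_map (fst X) W (\<lambda>x. q (Inr x))"
    then show ?thesis
      by (intro quotient_map_from_composition[OF continuous_map_Inr c]) (simp add: o_def)
  qed
  then show ?thesis
    by (rule iffD1[OF quotient_map_compose_eq[OF quotient_map_cone_rep]])
qed

lemma continuous_map_cone_homotopy:
  assumes "continuous_map (prod_topology unit_interval (prod_topology (fst A) unit_interval)) Z
      (\<lambda>(t, p). G (t, cone_rep A X i (Inl p)))"
    and "continuous_map (prod_topology unit_interval (fst X)) Z (\<lambda>(t, x). G (t, Inr x))"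
  shows "continuous_map (prod_topology unit_interval (fst (mapping_cone A X i))) Z G"
  by (rule continuous_map_prod_quotient[OF quotient_map_cone_rep])
    (rule continuous_map_prod_coprod; use assms in simp)

lemma continuous_map_unit_interval:
  assumes "continuous_map T euclideanreal f" "\<And>x. x \<in> topspace T \<Longrightarrow> f x \<in> {0..1}"
  shows "continuous_map T unit_interval f"
  using assms by (auto simp: continuous_map_in_subtopology)

lemma continuous_map_unit_intervalD: "continuous_map T unit_interval f \<Longrightarrow> continuous_map T euclideanreal f"
  by (simp add: continuous_map_in_subtopology)

text \<open>The homotopy extension property extends the motion of the base of the cone up to the
  apex to a motion of all of \<open>X\<close> inside the cone. At its end everything that the
  quotient identifies sits at the base point.\<close>

lemma mapping_cone_equiv_quotient:
  fixes A :: "'a pspace" and X :: "'b pspace"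
  assumes i: "pointed_cofibration A X i" and A: "pointed_space A" and X: "pointed_space X"
  shows "mapping_cone A X i \<simeq>\<^sub>* pquotient X (i ` topspace (fst A))"
proof -
  let ?\<rho> = "cone_rep A X i" and ?B = "i ` topspace (fst A)"
  have iA: "continuous_map (fst A) (fst X) i" and ib: "i (snd A) = snd X"
    using i by (auto simp: pointed_cofibration_def pointed_map_def)
  have pA: "snd A \<in> topspace (fst A)" and pX: "snd X \<in> topspace (fst X)"
    using A X by (simp_all add: pointed_space_def)
  define h where "h = (\<lambda>(t, u). ?\<rho> (Inl (u, t)))"
  have h: "continuous_map (prod_topology unit_interval (fst A)) (fst (mapping_cone A X i)) h"
    unfolding h_def case_prod_unfold
    by (rule continuous_map_compose[OF continuous_map_pairedI[OF continuous_map_snd continuous_map_fst]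
          continuous_map_cone_Inl, unfolded o_def])
  obtain H where H: "continuous_map (prod_topology unit_interval (fst X)) (fst (mapping_cone A X i)) H"
    and H0: "\<And>x. x \<in> topspace (fst X) \<Longrightarrow> H (0, x) = Inr x"
    and HA: "\<And>t u. t \<in> {0..1} \<Longrightarrow> u \<in> topspace (fst A) \<Longrightarrow> H (t, i u) = h (t, u)"
    by (rule pointed_cofibrationE[OF i _ h, of Inr])
      (auto simp: pointed_map_def h_def continuous_map_cone_Inr ib)
  have Hb: "H (t, snd X) = Inr (snd X)" if "t \<in> {0..1}" for t
    using HA[OF that pA] by (simp add: h_def ib)
  \<comment> \<open>Height \<open>s\<close> moves to
    \<open>s + t - s * t = 1 - (1 - s) * (1 - t)\<close>: for \<open>s = 0\<close> this is the
    prescribed motion \<open>h\<close>, and for \<open>t = 1\<close> the whole cone has reached the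
    apex.\<close>
  define G where "G = (\<lambda>(t, z). case z of Inr x \<Rightarrow> H (t, x) | Inl (u, s) \<Rightarrow> ?\<rho> (Inl (u, s + t - s * t)))"
  have G_Inr: "G (t, Inr x) = H (t, x)" for t x
    by (simp add: G_def)
  have G_Inl: "G (t, ?\<rho> (Inl (u, s))) = ?\<rho> (Inl (u, s + t - s * t))"
    if "t \<in> {0..1}" "u \<in> topspace (fst A)" for t u s
    using HA[OF that] Hb[OF that(1)] ib by (auto simp: G_def h_def cone_rep_def)
  define q where "q = (\<lambda>z :: 'a \<times> real + 'b. case z of Inr x \<Rightarrow> collapse X ?B x | Inl _ \<Rightarrow> snd X)"
  have q_Inl: "q (?\<rho> (Inl (u, s))) = snd X" if "u \<in> topspace (fst A)" for u s
    using that by (auto simp: q_def cone_rep_def collapse_def)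
  \<comment> \<open>The fibre of \<open>q\<close> over the base point is the whole cone on
    \<open>A\<close> with its base; by \<open>q_inj\<close> all other fibres are single
    points.\<close>
  have q_base: "\<exists>u\<in>topspace (fst A). \<exists>s\<in>{0..1}. y = ?\<rho> (Inl (u, s))"
    if y: "y \<in> topspace (fst (mapping_cone A X i))" and "q y = snd X" for y
  proof (cases "\<exists>x. y = Inr x")
    case True
    then obtain x where "y = Inr x" "x \<in> insert (snd X) ?B"
      using \<open>q y = snd X\<close> by (auto simp: q_def collapse_eq_base_iff)
    then obtain u where "u \<in> topspace (fst A)" "y = ?\<rho> (Inl (u, 0))"
      using pA ib by auto
    then show ?thesis by force
  next
    case False
    with y show ?thesis by (auto simp: topspace_mapping_cone)
  qed
  have q_inj: "y = y'" if "q y = q y'" "q y \<noteq> snd X" for y y'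
    using that by (auto simp: q_def collapse_def split: sum.splits if_splits)
  have step: "s + t - s * t \<in> {0..1}" if "s \<in> {0..1}" "t \<in> {0..1}" for s t :: real
  proof -
    have "s + t - s * t = 1 - (1 - s) * (1 - t)" by (simp add: algebra_simps)
    moreover have "0 \<le> (1 - s) * (1 - t)" "(1 - s) * (1 - t) \<le> 1"
      using that by (auto intro: mult_le_one)
    ultimately show ?thesis by simp
  qed
  show ?thesis
  proof (rule pointed_equiv_collapse[where q = q and H = G])
    show "pointed_space (mapping_cone A X i)"
      using pX by (simp add: pointed_space_def topspace_mapping_cone)
    show "quotient_map (fst (mapping_cone A X i)) (fst (pquotient X ?B)) q"
    proof (rule quotient_map_mapping_cone)
      have "continuous_map (prod_topology (fst A) unit_interval) (fst (pquotient X ?B)) (\<lambda>p. snd X)"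
        using pointed_space_pquotient[OF X, of ?B] by (simp add: pointed_space_def)
      then show "continuous_map (prod_topology (fst A) unit_interval) (fst (pquotient X ?B)) (\<lambda>p. q (?\<rho> (Inl p)))"
        by (rule continuous_map_eq) (auto simp: q_Inl)
      have "(\<lambda>x. q (Inr x)) = collapse X ?B"
        by (simp add: q_def)
      then show "continuous_map (fst X) (fst (pquotient X ?B)) (\<lambda>x. q (Inr x))"
        "quotient_map (prod_topology (fst A) unit_interval) (fst (pquotient X ?B)) (\<lambda>p. q (?\<rho> (Inl p)))
          \<or> quotient_map (fst X) (fst (pquotient X ?B)) (\<lambda>x. q (Inr x))"
        by (simp_all add: continuous_map_collapse quotient_map_collapse)
    qed
    show "continuous_map (prod_topology unit_interval (fst (mapping_cone A X i))) (fst (mapping_cone A X i)) G"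
    proof (rule continuous_map_cone_homotopy)
      have "continuous_map (prod_topology unit_interval (prod_topology (fst A) unit_interval)) unit_interval
          (\<lambda>p. snd (snd p) + fst p - snd (snd p) * fst p)"
      proof (rule continuous_map_unit_interval)
        have "continuous_map (prod_topology unit_interval (prod_topology (fst A) unit_interval)) euclideanreal fst"
          "continuous_map (prod_topology unit_interval (prod_topology (fst A) unit_interval)) euclideanreal (\<lambda>p. snd (snd p))"
          by (intro continuous_map_unit_intervalD continuous_map_fst
            continuous_map_compose[OF continuous_map_snd continuous_map_snd, unfolded o_def])+
        then show "continuous_map (prod_topology unit_interval (prod_topology (fst A) unit_interval)) euclideanreal
            (\<lambda>p. snd (snd p) + fst p - snd (snd p) * fst p)"
          by (intro continuous_map_add continuous_map_diff continuous_map_real_mult)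
      qed (use step in auto)
      then have "continuous_map (prod_topology unit_interval (prod_topology (fst A) unit_interval))
          (fst (mapping_cone A X i)) (\<lambda>p. ?\<rho> (Inl (fst (snd p), snd (snd p) + fst p - snd (snd p) * fst p)))"
        by (intro continuous_map_compose[OF continuous_map_pairedI continuous_map_cone_Inl, unfolded o_def]
          continuous_map_compose[OF continuous_map_snd continuous_map_fst, unfolded o_def])
      then show "continuous_map (prod_topology unit_interval (prod_topology (fst A) unit_interval))
          (fst (mapping_cone A X i)) (\<lambda>(t, p). G (t, ?\<rho> (Inl p)))"
        by (rule continuous_map_eq) (auto simp: G_Inl)
      show "continuous_map (prod_topology unit_interval (fst X)) (fst (mapping_cone A X i)) (\<lambda>(t, x). G (t, Inr x))"
        using H by (simp add: G_Inr)
    qed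
    show "G (0, y) = y" if "y \<in> topspace (fst (mapping_cone A X i))" for y
      using that by (auto simp: topspace_mapping_cone G_Inl G_Inr H0)
    show "G (t, snd (mapping_cone A X i)) = snd (mapping_cone A X i)" if "t \<in> {0..1}" for t
      using Hb[OF that] by (simp add: G_Inr)
    show "q (snd (mapping_cone A X i)) = snd (pquotient X ?B)"
      by (simp add: q_def)
    show "q (G (t, y)) = q (G (t, y'))"
      if t: "t \<in> {0..1}" and y: "y \<in> topspace (fst (mapping_cone A X i))"
        "y' \<in> topspace (fst (mapping_cone A X i))" "q y = q y'" for t y y'
    proof (cases "q y = snd X")
      case True
      have "q (G (t, z)) = snd X" if "z \<in> topspace (fst (mapping_cone A X i))" "q z = snd X" for z
        using q_base[OF that] by (auto simp: G_Inl q_Inl t[simplified])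
      then show ?thesis using True y by simp
    next
      case False
      then show ?thesis using q_inj[OF y(3)] by simp
    qed
    show "G (1, y) = G (1, y')"
      if y: "y \<in> topspace (fst (mapping_cone A X i))"
        "y' \<in> topspace (fst (mapping_cone A X i))" "q y = q y'" for y y'
    proof (cases "q y = snd X")
      case True
      have "G (1, z) = Inr (snd X)" if "z \<in> topspace (fst (mapping_cone A X i))" "q z = snd X" for z
        using q_base[OF that] by (auto simp: G_Inl)
      then show ?thesis using True y by simp
    next
      case False
      then show ?thesis using q_inj[OF y(3)] by simp
    qed
  qed
qed

text \<open>Collapsing \<open>X\<close> inside the cone leaves the suspension of \<open>A\<close>.
  The cone is a collar of \<open>X\<close>, so the contraction of \<open>X\<close> extends over it
  by an explicit formula.\<close>

lemma mapping_cone_equiv_susp: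
  fixes A :: "'a pspace" and X :: "'b pspace"
  assumes i: "pointed_map A X i" and A: "pointed_space A" and X: "pointed_space X"
    and contr: "pointed_contractible X"
  shows "mapping_cone A X i \<simeq>\<^sub>* reduced_susp A"
proof -
  let ?\<rho> = "cone_rep A X i"
  let ?P = "(prod_topology (fst A) unit_interval, (snd A, 0))"
  let ?B = "topspace (fst A) \<times> {0, 1} \<union> {snd A} \<times> {0..1}"
  have W: "reduced_susp A = pquotient ?P ?B"
    by (simp add: reduced_susp_def)
  have iA: "continuous_map (fst A) (fst X) i" and ib: "i (snd A) = snd X"
    using i by (auto simp: pointed_map_def)
  have pA: "snd A \<in> topspace (fst A)" and pX: "snd X \<in> topspace (fst X)"
    using A X by (simp_all add: pointed_space_def)
  have iX: "i u \<in> topspace (fst X)" if "u \<in> topspace (fst A)" for u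
    using iA that by (rule continuous_map_in_topspace)
  obtain c where c: "continuous_map (prod_topology unit_interval (fst X)) (fst X) c"
    and c0: "\<And>x. x \<in> topspace (fst X) \<Longrightarrow> c (0, x) = x"
    and c1: "\<And>x. x \<in> topspace (fst X) \<Longrightarrow> c (1, x) = snd X"
    and cb: "\<And>t. t \<in> {0..1} \<Longrightarrow> c (t, snd X) = snd X"
    using contr unfolding pointed_contractible_iff[OF X] by blast
  text \<open>At time \<open>t\<close> the cone is stretched to heights from \<open>-t\<close> to \<open>1\<close>; its points of negative height
    \<open>-v\<close> are moved into \<open>X\<close> by the contraction at time \<open>v\<close>.\<close>
  define E where "E = (\<lambda>t u s. if 0 \<le> s * (1 + t) - t then ?\<rho> (Inl (u, max 0 (s * (1 + t) - t)))
    else Inr (c (max 0 (t - s * (1 + t)), i u)))"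
  define G where "G = (\<lambda>(t, z). case z of Inr x \<Rightarrow> Inr (c (t, x)) | Inl (u, s) \<Rightarrow> E t u s)"
  have G_Inr: "G (t, Inr x) = Inr (c (t, x))" for t x
    by (simp add: G_def)
  have up: "s * (1 + t) - t \<le> 1" and lo: "t - s * (1 + t) \<le> 1"
    if "s \<in> {0..1}" "t \<in> {0..1}" for s t :: real
  proof -
    have "s * (1 + t) \<le> 1 * (1 + t)" using that by (intro mult_right_mono) auto
    then show "s * (1 + t) - t \<le> 1" by simp
    have "0 \<le> s * (1 + t)" using that by simp
    moreover have "t \<le> 1" using that by simp
    ultimately show "t - s * (1 + t) \<le> 1" by linarith
  qed
  have G_Inl: "G (t, ?\<rho> (Inl (u, s))) = E t u s"
    if t: "t \<in> {0..1}" and u: "u \<in> topspace (fst A)" and s: "s \<in> {0..1}" for t u s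
  proof -
    \<comment> \<open>\<open>cone_rep\<close> identifies points at the base, at the apex and over
      the base point; \<open>E\<close> has to respect each of these identifications.\<close>
    consider "s = 0" | "s = 1" | "s \<noteq> 0" "s \<noteq> 1" "u = snd A" | "s \<noteq> 0" "s \<noteq> 1" "u \<noteq> snd A" by blast
    then show ?thesis
    proof cases
      case 1
      then show ?thesis
        using t c0[OF iX[OF u]] by (auto simp: E_def G_Inr)
    next
      case 2
      then show ?thesis
        using t cb[OF t] by (simp add: E_def G_Inr)
    next
      case 3
      have "max 0 (t - s * (1 + t)) \<in> {0..1}" using lo[OF s t] by simp
      then show ?thesis
        using 3 cb[OF t] by (simp add: E_def G_Inr ib cb)
    next
      case 4
      then show ?thesis by (simp add: cone_rep_def G_def)
    qed
  qed
  define q where "q = (\<lambda>z :: 'a \<times> real + 'b. case z of Inr x \<Rightarrow> (snd A, 0) | Inl p \<Rightarrow> collapse ?P ?B p)"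
  have q_Inl: "q (?\<rho> (Inl (u, s))) = collapse ?P ?B (u, s)" if "u \<in> topspace (fst A)" "s \<in> {0..1}" for u s
    using that by (auto simp: q_def cone_rep_def collapse_def)
  \<comment> \<open>This time the fibre over the base point is the copy of \<open>X\<close>, on
    which \<open>G\<close> is the contraction.\<close>
  have q_base: "\<exists>x\<in>topspace (fst X). y = Inr x"
    if y: "y \<in> topspace (fst (mapping_cone A X i))" and "q y = (snd A, 0)" for y
  proof (cases y)
    case (Inl p)
    then obtain u s where us: "y = ?\<rho> (Inl (u, s))" "u \<in> topspace (fst A)" "s \<in> {0..1}"
      using y by (auto simp: topspace_mapping_cone)
    then have "s \<noteq> 0" "s \<noteq> 1" "u \<noteq> snd A"
      using Inl by (auto simp: cone_rep_def split: if_splits)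
    then show ?thesis
      using us \<open>q y = (snd A, 0)\<close> by (simp add: q_Inl collapse_def split: if_splits)
  next
    case (Inr x)
    then show ?thesis
      using y iX pX by (auto simp: topspace_mapping_cone cone_rep_def split: if_splits)
  qed
  have q_inj: "y = y'" if "q y = q y'" "q y \<noteq> (snd A, 0)" for y y'
    using that by (auto simp: q_def collapse_def split: sum.splits if_splits)
  let ?T = "prod_topology unit_interval (prod_topology (fst A) unit_interval)"
  have s': "continuous_map ?T euclideanreal (\<lambda>p. snd (snd p) * (1 + fst p) - fst p)"
  proof -
    have "continuous_map ?T euclideanreal fst"
      "continuous_map ?T euclideanreal (\<lambda>p. snd (snd p))"
      by (intro continuous_map_unit_intervalD continuous_map_fst
          continuous_map_compose[OF continuous_map_snd continuous_map_snd, unfolded o_def])+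
    then show ?thesis
      by (intro continuous_map_add continuous_map_diff continuous_map_real_mult) simp_all
  qed
  have s'': "continuous_map ?T euclideanreal (\<lambda>p. fst p - snd (snd p) * (1 + fst p))"
    using continuous_map_minus[OF s'] by simp
  have E_cont: "continuous_map ?T (fst (mapping_cone A X i)) (\<lambda>p. E (fst p) (fst (snd p)) (snd (snd p)))"
    unfolding E_def
  proof (rule continuous_map_cases_le)
    show "continuous_map ?T euclideanreal (\<lambda>p. 0)" by simp
    show "continuous_map ?T euclideanreal (\<lambda>p. snd (snd p) * (1 + fst p) - fst p)"
      by (rule s')
    have fs: "continuous_map ?T (fst A) (\<lambda>p. fst (snd p))"
      by (rule continuous_map_compose[OF continuous_map_snd continuous_map_fst, unfolded o_def])
    \<comment> \<open>The cut-off by \<open>max 0\<close> keeps the height in the interval on the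
      whole domain, so each branch is continuous everywhere before it is restricted to its
      half.\<close>
    have "continuous_map ?T unit_interval (\<lambda>p. max 0 (snd (snd p) * (1 + fst p) - fst p))"
      by (rule continuous_map_unit_interval)
        (use up in \<open>auto intro!: continuous_map_real_max s'\<close>)
    then have "continuous_map ?T (fst (mapping_cone A X i))
        (\<lambda>p. ?\<rho> (Inl (fst (snd p), max 0 (snd (snd p) * (1 + fst p) - fst p))))"
      by (intro continuous_map_compose[OF continuous_map_pairedI continuous_map_cone_Inl, unfolded o_def] fs)
    then show "continuous_map (subtopology ?T {p \<in> topspace ?T. 0 \<le> snd (snd p) * (1 + fst p) - fst p})
        (fst (mapping_cone A X i)) (\<lambda>p. ?\<rho> (Inl (fst (snd p), max 0 (snd (snd p) * (1 + fst p) - fst p))))"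
      by (rule continuous_map_from_subtopology)
    have "continuous_map ?T unit_interval (\<lambda>p. max 0 (fst p - snd (snd p) * (1 + fst p)))"
      by (rule continuous_map_unit_interval)
        (use lo in \<open>auto intro!: continuous_map_real_max s''\<close>)
    then have "continuous_map ?T (fst X) (\<lambda>p. c (max 0 (fst p - snd (snd p) * (1 + fst p)), i (fst (snd p))))"
      by (intro continuous_map_compose[OF continuous_map_pairedI c, unfolded o_def]
          continuous_map_compose[OF fs iA, unfolded o_def])
    then have "continuous_map ?T (fst (mapping_cone A X i))
        (\<lambda>p. Inr (c (max 0 (fst p - snd (snd p) * (1 + fst p)), i (fst (snd p)))))"
      by (rule continuous_map_compose[OF _ continuous_map_cone_Inr, unfolded o_def])
    then show "continuous_map (subtopology ?T {p \<in> topspace ?T. snd (snd p) * (1 + fst p) - fst p \<le> 0})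
        (fst (mapping_cone A X i)) (\<lambda>p. Inr (c (max 0 (fst p - snd (snd p) * (1 + fst p)), i (fst (snd p)))))"
      by (rule continuous_map_from_subtopology)
    fix p assume p: "p \<in> topspace ?T" "0 = snd (snd p) * (1 + fst p) - fst p"
    then have "c (0, i (fst (snd p))) = i (fst (snd p))"
      by (intro c0 iX) auto
    then show "?\<rho> (Inl (fst (snd p), max 0 (snd (snd p) * (1 + fst p) - fst p))) =
        Inr (c (max 0 (fst p - snd (snd p) * (1 + fst p)), i (fst (snd p))))"
      using p(2) by simp
  qed
  show ?thesis
    unfolding W
  proof (rule pointed_equiv_collapse[where q = q and H = G])
    show "pointed_space (mapping_cone A X i)"
      using pX by (simp add: pointed_space_def topspace_mapping_cone)
    show "quotient_map (fst (mapping_cone A X i)) (fst (pquotient ?P ?B)) q"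
    proof (rule quotient_map_mapping_cone)
      have "pointed_space (pquotient ?P ?B)"
        by (rule pointed_space_pquotient) (simp add: pointed_space_def pA)
      then show "continuous_map (fst X) (fst (pquotient ?P ?B)) (\<lambda>x. q (Inr x))"
        by (simp add: q_def pointed_space_def)
      have qc: "quotient_map (prod_topology (fst A) unit_interval) (fst (pquotient ?P ?B)) (collapse ?P ?B)"
        using quotient_map_collapse[of ?P ?B] by (simp only: fst_conv)
      then have "quotient_map (prod_topology (fst A) unit_interval) (fst (pquotient ?P ?B)) (\<lambda>p. q (?\<rho> (Inl p)))"
        by (rule quotient_map_eq) (auto simp: q_Inl)
      then show "continuous_map (prod_topology (fst A) unit_interval) (fst (pquotient ?P ?B)) (\<lambda>p. q (?\<rho> (Inl p)))"
        "quotient_map (prod_topology (fst A) unit_interval) (fst (pquotient ?P ?B)) (\<lambda>p. q (?\<rho> (Inl p)))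
          \<or> quotient_map (fst X) (fst (pquotient ?P ?B)) (\<lambda>x. q (Inr x))"
        by (simp_all add: quotient_imp_continuous_map)
    qed
    show "continuous_map (prod_topology unit_interval (fst (mapping_cone A X i))) (fst (mapping_cone A X i)) G"
    proof (rule continuous_map_cone_homotopy)
      show "continuous_map ?T (fst (mapping_cone A X i)) (\<lambda>(t, p). G (t, ?\<rho> (Inl p)))"
        using E_cont by (rule continuous_map_eq) (auto simp: G_Inl)
      show "continuous_map (prod_topology unit_interval (fst X)) (fst (mapping_cone A X i)) (\<lambda>(t, x). G (t, Inr x))"
        using continuous_map_compose[OF c continuous_map_cone_Inr] by (simp add: G_Inr o_def case_prod_unfold)
    qed
    show "G (0, y) = y" if "y \<in> topspace (fst (mapping_cone A X i))" for y
      using that by (auto simp: topspace_mapping_cone G_Inl G_Inr c0 E_def)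
    show "G (t, snd (mapping_cone A X i)) = snd (mapping_cone A X i)" if "t \<in> {0..1}" for t
      using cb[OF that] by (simp add: G_Inr)
    show "q (snd (mapping_cone A X i)) = snd (pquotient ?P ?B)"
      by (simp add: q_def)
    show "q (G (t, y)) = q (G (t, y'))"
      if t: "t \<in> {0..1}" and y: "y \<in> topspace (fst (mapping_cone A X i))"
        "y' \<in> topspace (fst (mapping_cone A X i))" "q y = q y'" for t y y'
    proof (cases "q y = (snd A, 0)")
      case True
      have "q (G (t, z)) = (snd A, 0)" if "z \<in> topspace (fst (mapping_cone A X i))" "q z = (snd A, 0)" for z
        using q_base[OF that] by (auto simp: G_Inr q_def)
      then show ?thesis using True y by simp
    next
      case False
      then show ?thesis using q_inj[OF y(3)] by simp
    qed
    show "G (1, y) = G (1, y')"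
      if y: "y \<in> topspace (fst (mapping_cone A X i))"
        "y' \<in> topspace (fst (mapping_cone A X i))" "q y = q y'" for y y'
    proof (cases "q y = (snd A, 0)")
      case True
      have "G (1, z) = Inr (snd X)" if "z \<in> topspace (fst (mapping_cone A X i))" "q z = (snd A, 0)" for z
        using q_base[OF that] by (auto simp: G_Inr c1)
      then show ?thesis using True y by simp
    next
      case False
      then show ?thesis using q_inj[OF y(3)] by simp
    qed
  qed
qed

text \<open>The mapping cone is compared with both sides: shrinking the cone gives the quotient,
  shrinking the contractible \<open>X\<close> gives the suspension.\<close>

lemma quotient_equiv_reduced_susp:
  assumes i: "pointed_cofibration A X i" and A: "pointed_space A" and X: "pointed_space X"
    and contr: "pointed_contractible X"
  shows "pquotient X (i ` topspace (fst A)) \<simeq>\<^sub>* reduced_susp A"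
proof -
  have "pointed_map A X i"
    using i by (simp add: pointed_cofibration_def)
  then show ?thesis
    by (intro pointed_equiv_trans[OF pointed_equiv_sym[OF mapping_cone_equiv_quotient]
          mapping_cone_equiv_susp] assms)
qed

section \<open>Products of cuts and the cuts of the vectors (a^k, 1^l)\<close>

lemma module_rvec: "module (\<lambda>(c::real) (x::rvec) i. c * x i)"
  by unfold_locales (auto simp: algebra_simps fun_eq_iff)

lemma signvecs_eq_0: "x \<in> signvecs n \<Longrightarrow> i = 0 \<or> i > n \<Longrightarrow> x i = 0"
  by (auto simp: signvecs_def)

lemma signvecs_cases: "x \<in> signvecs n \<Longrightarrow> x i = 0 \<or> x i = 1 \<or> x i = -1"
  by (cases "i \<in> {1..n}") (auto simp: signvecs_def)

lemma signvecs_iff: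
  "x \<in> signvecs n \<longleftrightarrow> (\<forall>i. x i = 0 \<or> x i = 1 \<or> x i = -1) \<and> (\<forall>i. i = 0 \<or> i > n \<longrightarrow> x i = 0)"
proof
  assume "x \<in> signvecs n"
  then show "(\<forall>i. x i = 0 \<or> x i = 1 \<or> x i = -1) \<and> (\<forall>i. i = 0 \<or> i > n \<longrightarrow> x i = 0)"
    by (intro conjI allI impI signvecs_cases[of x n] signvecs_eq_0[of x n])
next
  assume *: "(\<forall>i. x i = 0 \<or> x i = 1 \<or> x i = -1) \<and> (\<forall>i. i = 0 \<or> i > n \<longrightarrow> x i = 0)"
  show "x \<in> signvecs n"
    unfolding signvecs_def
  proof (intro CollectI conjI ballI allI impI)
    show "x i \<in> {-1, 0, 1}" for i
      using * by blast
    show "x i = 0" if "i \<notin> {1..n}" for i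
      using * that by (metis atLeastAtMost_iff leI less_one)
  qed
qed

lemma Plus_subset: "x \<in> signvecs n \<Longrightarrow> Plus x \<subseteq> {1..n}"
  unfolding Plus_def signvecs_def by (rule subsetI, rule ccontr) simp

lemma Minus_subset: "x \<in> signvecs n \<Longrightarrow> Minus x \<subseteq> {1..n}"
  unfolding Minus_def signvecs_def by (rule subsetI, rule ccontr) simp

lemma span_closure_superset: "S \<subseteq> signvecs n \<Longrightarrow> S \<subseteq> span_closure n S"
  using module.span_superset[OF module_rvec, of S] by (auto simp: span_closure_def)

text \<open>The sign vectors of a linear subspace are closed under span, so only the sign condition
  remains to be checked for a cut.\<close>

lemma cuts_linear:
  assumes zero: "P 0" and add: "\<And>x y. P x \<Longrightarrow> P y \<Longrightarrow> P (x + y)"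
    and scale: "\<And>c x. P x \<Longrightarrow> P (\<lambda>i. c * x i)"
    and sign: "\<And>x. \<lbrakk>x \<in> signvecs n; P x; x \<noteq> 0\<rbrakk> \<Longrightarrow> Plus x \<noteq> {} \<and> Minus x \<noteq> {}"
  shows "{x \<in> signvecs n. P x} \<in> cuts n"
proof -
  have "module.subspace (\<lambda>(c::real) (x::rvec) i. c * x i) {x. P x}"
    unfolding module.subspace_def[OF module_rvec] using zero add scale by blast
  then have "module.span (\<lambda>(c::real) (x::rvec) i. c * x i) {x \<in> signvecs n. P x} \<subseteq> {x. P x}"
    by (intro module.span_minimal[OF module_rvec]) auto
  then have "span_closure n {x \<in> signvecs n. P x} \<subseteq> {x \<in> signvecs n. P x}"
    by (auto simp: span_closure_def)
  then have "span_closure n {x \<in> signvecs n. P x} = {x \<in> signvecs n. P x}"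
    using span_closure_superset[of "{x \<in> signvecs n. P x}" n] by blast
  then show ?thesis
    using sign by (auto simp: cuts_def)
qed

definition prod_cut :: "nat \<Rightarrow> rvec set \<Rightarrow> rvec set \<Rightarrow> rvec set" where
  "prod_cut n S T = {concat_vec n x y | x y. x \<in> S \<and> y \<in> T}"

definition left_part :: "nat \<Rightarrow> rvec \<Rightarrow> rvec" where
  "left_part n z = (\<lambda>i. if i \<le> n then z i else 0)"

text \<open>Index 0 is treated apart because \<open>z (n + 0)\<close> still belongs to the left
  part.\<close>

definition right_part :: "nat \<Rightarrow> rvec \<Rightarrow> rvec" where
  "right_part n z = (\<lambda>i. if i = 0 then 0 else z (n + i))"

lemma concat_parts: "concat_vec n (left_part n z) (right_part n z) = z"
  by (auto simp: concat_vec_def left_part_def right_part_def fun_eq_iff)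

lemma left_part_concat: "x \<in> signvecs n \<Longrightarrow> left_part n (concat_vec n x y) = x"
  by (auto simp: concat_vec_def left_part_def fun_eq_iff signvecs_eq_0)

lemma right_part_concat: "y \<in> signvecs m \<Longrightarrow> right_part n (concat_vec n x y) = y"
  by (auto simp: concat_vec_def right_part_def fun_eq_iff signvecs_eq_0)

lemma concat_signvecs: "x \<in> signvecs n \<Longrightarrow> y \<in> signvecs m \<Longrightarrow> concat_vec n x y \<in> signvecs (n + m)"
  by (auto simp: concat_vec_def signvecs_iff)

lemma prod_cut_iff:
  assumes "S \<subseteq> signvecs n" "T \<subseteq> signvecs m"
  shows "z \<in> prod_cut n S T \<longleftrightarrow> z \<in> signvecs (n + m) \<and> left_part n z \<in> S \<and> right_part n z \<in> T"
proof
  assume "z \<in> prod_cut n S T"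
  then obtain x y where "z = concat_vec n x y" "x \<in> S" "y \<in> T"
    by (auto simp: prod_cut_def)
  with assms show "z \<in> signvecs (n + m) \<and> left_part n z \<in> S \<and> right_part n z \<in> T"
    using left_part_concat right_part_concat concat_signvecs by (metis subsetD)
next
  assume "z \<in> signvecs (n + m) \<and> left_part n z \<in> S \<and> right_part n z \<in> T"
  then have "\<exists>x y. z = concat_vec n x y \<and> x \<in> S \<and> y \<in> T"
    by (intro exI[of _ "left_part n z"] exI[of _ "right_part n z"]) (simp add: concat_parts)
  then show "z \<in> prod_cut n S T"
    by (simp add: prod_cut_def)
qed

lemma cuts_subset: "S \<in> cuts n \<Longrightarrow> S \<subseteq> signvecs n"
  by (simp add: cuts_def)

text \<open>Membership of both parts in the spans of \<open>S\<close> and \<open>T\<close> is a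
  linear condition, so \<open>cuts_linear\<close> applies. A nonzero vector has a nonzero part,
  which already contributes both signs.\<close>

lemma prod_cut_in_cuts:
  assumes S: "S \<in> cuts n" and T: "T \<in> cuts m"
  shows "prod_cut n S T \<in> cuts (n + m)"
proof -
  let ?span = "module.span (\<lambda>(c::real) (x::rvec) i. c * x i)"
  have SV: "x \<in> S \<longleftrightarrow> x \<in> signvecs n \<and> x \<in> ?span S" for x
    using S by (auto simp: cuts_def span_closure_def)
  have TV: "x \<in> T \<longleftrightarrow> x \<in> signvecs m \<and> x \<in> ?span T" for x
    using T by (auto simp: cuts_def span_closure_def)
  have parts: "left_part n z \<in> signvecs n" "right_part n z \<in> signvecs m" if "z \<in> signvecs (n + m)" for z
    using that by (auto simp: signvecs_def left_part_def right_part_def)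
  let ?P = "\<lambda>z. left_part n z \<in> ?span S \<and> right_part n z \<in> ?span T"
  have "prod_cut n S T = {z \<in> signvecs (n + m). ?P z}"
    using prod_cut_iff[OF cuts_subset[OF S] cuts_subset[OF T]] parts SV TV by blast
  also have "\<dots> \<in> cuts (n + m)"
  proof (rule cuts_linear)
    have "left_part n 0 = 0" "right_part n 0 = 0"
      by (auto simp: left_part_def right_part_def fun_eq_iff)
    then show "?P 0"
      by (simp add: module.span_zero[OF module_rvec])
  next
    fix x y assume "?P x" "?P y"
    moreover have "left_part n (x + y) = left_part n x + left_part n y"
      "right_part n (x + y) = right_part n x + right_part n y"
      by (auto simp: left_part_def right_part_def fun_eq_iff)
    ultimately show "?P (x + y)"
      by (simp add: module.span_add[OF module_rvec])
  next
    fix c x assume P: "?P x"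
    have "left_part n (\<lambda>i. c * x i) = (\<lambda>i. c * left_part n x i)"
      "right_part n (\<lambda>i. c * x i) = (\<lambda>i. c * right_part n x i)"
      by (auto simp: left_part_def right_part_def fun_eq_iff)
    then show "?P (\<lambda>i. c * x i)"
      using P by (simp add: module.span_scale[OF module_rvec])
  next
    fix z assume z: "z \<in> signvecs (n + m)" "?P z" "z \<noteq> 0"
    have LR: "left_part n z \<in> S" "right_part n z \<in> T"
      using parts[OF z(1)] z(2) SV TV by auto
    obtain i where i: "z i \<noteq> 0"
      using z(3) by (auto simp: fun_eq_iff)
    show "Plus z \<noteq> {} \<and> Minus z \<noteq> {}"
    proof (cases "i \<le> n")
      case True
      then have "left_part n z \<noteq> 0"
        using i by (auto simp: left_part_def fun_eq_iff intro!: exI[of _ i])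
      then have "Plus (left_part n z) \<noteq> {} \<and> Minus (left_part n z) \<noteq> {}"
        using S LR by (auto simp: cuts_def)
      then show ?thesis
        by (auto simp: Plus_def Minus_def left_part_def split: if_splits)
    next
      case False
      then have "right_part n z (i - n) \<noteq> 0"
        using i by (auto simp: right_part_def)
      then have "right_part n z \<noteq> 0"
        by (auto simp: fun_eq_iff)
      then have "Plus (right_part n z) \<noteq> {} \<and> Minus (right_part n z) \<noteq> {}"
        using T LR by (auto simp: cuts_def)
      then show ?thesis
        by (auto simp: Plus_def Minus_def right_part_def split: if_splits)
    qed
  qed
  finally show ?thesis .
qed

text \<open>The cut \<open>(1)\<^sup>r \<times> (a\<^sup>k, 1\<^sup>l)\<close>.\<close>

definition mixed_cut :: "nat \<Rightarrow> nat \<Rightarrow> nat \<Rightarrow> nat \<Rightarrow> rvec set" where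
  "mixed_cut a r k l = {x \<in> signvecs (r + k + l). (\<forall>i\<in>{1..r}. x i = 0) \<and>
     real a * sum x {r+1..r+k} + sum x {r+k+1..r+k+l} = 0}"

text \<open>The first \<open>r\<close> coordinates vanish on the cut; weight 0 makes them invisible
  when blocks are weighed.\<close>

definition weight :: "nat \<Rightarrow> nat \<Rightarrow> nat \<Rightarrow> nat \<Rightarrow> nat" where
  "weight a r k i = (if i \<le> r then 0 else if i \<le> r + k then a else 1)"

lemma mixed_cut_subset: "mixed_cut a r k l \<subseteq> signvecs (r + k + l)"
  by (auto simp: mixed_cut_def)

lemma sum_signvec:
  assumes "x \<in> signvecs n"
  shows "(\<Sum>i=1..n. x i * g i) = sum g (Plus x) - sum g (Minus x)"
proof -
  have "(\<Sum>i=1..n. x i * g i) = (\<Sum>i=1..n. (if i \<in> Plus x then g i else 0) - (if i \<in> Minus x then g i else 0))"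
    using signvecs_cases[OF assms] by (intro sum.cong) (auto simp: Plus_def Minus_def)
  also have "\<dots> = sum g ({1..n} \<inter> Plus x) - sum g ({1..n} \<inter> Minus x)"
    by (simp add: sum_subtractf sum.inter_restrict)
  finally show ?thesis
    using Plus_subset[OF assms] Minus_subset[OF assms] by (simp add: Int_absorb1)
qed

lemma sum_split3: "sum (f :: nat \<Rightarrow> real) {1..r+k+l} = sum f {1..r} + sum f {r+1..r+k} + sum f {r+k+1..r+k+l}"
  using sum.ub_add_nat[of 1 r f k] sum.ub_add_nat[of 1 "r+k" f l] by simp

lemma mixed_cut_weight_sum:
  assumes "\<forall>i\<in>{1..r}. x i = 0"
  shows "(\<Sum>i=1..r+k+l. x i * real (weight a r k i)) =
    real a * sum x {r+1..r+k} + sum x {r+k+1..r+k+l}"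
proof -
  have "(\<Sum>i=1..r. x i * real (weight a r k i)) = 0"
    using assms by simp
  moreover have "(\<Sum>i=r+1..r+k. x i * real (weight a r k i)) = (\<Sum>i=r+1..r+k. real a * x i)"
    by (intro sum.cong) (auto simp: weight_def)
  moreover have "(\<Sum>i=r+k+1..r+k+l. x i * real (weight a r k i)) = (\<Sum>i=r+k+1..r+k+l. x i)"
    by (intro sum.cong) (auto simp: weight_def)
  ultimately show ?thesis
    by (simp only: sum_split3 sum_distrib_left add_0_left)
qed

lemma mixed_cut_weight:
  assumes "x \<in> mixed_cut a r k l"
  shows "sum (weight a r k) (Plus x) = sum (weight a r k) (Minus x)"
proof -
  have x: "x \<in> signvecs (r + k + l)"
    using assms by (simp add: mixed_cut_def)
  have "(\<Sum>i=1..r+k+l. x i * real (weight a r k i)) =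
      real (sum (weight a r k) (Plus x)) - real (sum (weight a r k) (Minus x))"
    using sum_signvec[OF x, of "\<lambda>i. real (weight a r k i)"] by simp
  moreover have "(\<Sum>i=1..r+k+l. x i * real (weight a r k i)) = 0"
    using assms mixed_cut_weight_sum[where r = r and k = k and l = l and a = a and x = x] by (simp add: mixed_cut_def)
  ultimately show ?thesis by linarith
qed

text \<open>Off the first \<open>r\<close> coordinates all weights are positive, so a nonzero vector
  whose positive and negative weights agree has entries of both signs.\<close>

lemma mixed_cut_in_cuts:
  assumes "a \<ge> 1"
  shows "mixed_cut a r k l \<in> cuts (r + k + l)"
  unfolding mixed_cut_def
proof (rule cuts_linear)
  fix x assume x: "x \<in> signvecs (r + k + l)"
    "(\<forall>i\<in>{1..r}. x i = 0) \<and> real a * sum x {r+1..r+k} + sum x {r+k+1..r+k+l} = 0" "x \<noteq> 0"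
  then have eq: "sum (weight a r k) (Plus x) = sum (weight a r k) (Minus x)"
    by (intro mixed_cut_weight[of _ a r k l]) (simp add: mixed_cut_def)
  have pos: "weight a r k i > 0" if "x i \<noteq> 0" for i
  proof -
    have "i > r"
      using x that signvecs_eq_0[OF x(1), of i] by (metis atLeastAtMost_iff leI not_less_eq_eq One_nat_def le_zero_eq not_gr0 Suc_leI)
    then show ?thesis using assms by (simp add: weight_def)
  qed
  have fin: "finite (Plus x)" "finite (Minus x)"
    using Plus_subset[OF x(1)] Minus_subset[OF x(1)] finite_subset by auto
  have "sum (weight a r k) (Plus x) > 0" if "Plus x \<noteq> {}"
    using that fin by (intro sum_pos) (auto simp: Plus_def intro!: pos)
  moreover have "sum (weight a r k) (Minus x) > 0" if "Minus x \<noteq> {}"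
    using that fin by (intro sum_pos) (auto simp: Minus_def intro!: pos)
  moreover have "Plus x \<noteq> {} \<or> Minus x \<noteq> {}"
  proof -
    obtain i where "x i \<noteq> 0" using x(3) by (auto simp: fun_eq_iff)
    then show ?thesis using signvecs_cases[OF x(1), of i] by (auto simp: Plus_def Minus_def)
  qed
  ultimately show "Plus x \<noteq> {} \<and> Minus x \<noteq> {}"
    using eq by (metis sum.empty less_irrefl)
next
  fix x y :: rvec
  assume "(\<forall>i\<in>{1..r}. x i = 0) \<and> real a * sum x {r+1..r+k} + sum x {r+k+1..r+k+l} = 0"
    "(\<forall>i\<in>{1..r}. y i = 0) \<and> real a * sum y {r+1..r+k} + sum y {r+k+1..r+k+l} = 0"
  then show "(\<forall>i\<in>{1..r}. (x + y) i = 0) \<and> real a * sum (x + y) {r+1..r+k} + sum (x + y) {r+k+1..r+k+l} = 0"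
    by (simp add: sum.distrib algebra_simps)
next
  fix c and x :: rvec
  assume x: "(\<forall>i\<in>{1..r}. x i = 0) \<and> real a * sum x {r+1..r+k} + sum x {r+k+1..r+k+l} = 0"
  have "real a * (\<Sum>i=r+1..r+k. c * x i) + (\<Sum>i=r+k+1..r+k+l. c * x i) =
      c * (real a * sum x {r+1..r+k} + sum x {r+k+1..r+k+l})"
    by (simp add: sum_distrib_left algebra_simps)
  then show "(\<forall>i\<in>{1..r}. c * x i = 0) \<and> real a * (\<Sum>i=r+1..r+k. c * x i) + (\<Sum>i=r+k+1..r+k+l. c * x i) = 0"
    using x by simp
qed simp

definition ones_cut :: "nat \<Rightarrow> rvec set" where
  "ones_cut l = mixed_cut 1 0 0 l"

lemma ones_cut_eq: "ones_cut l = {x \<in> signvecs l. sum x {1..l} = 0}"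
  by (simp add: ones_cut_def mixed_cut_def)

lemma sum_left_part: "A \<subseteq> {..n} \<Longrightarrow> sum (left_part n x) A = sum x A"
  by (intro sum.cong) (auto simp: left_part_def)

lemma sum_right_part:
  assumes "1 \<le> i"
  shows "sum (right_part n x) {i..j} = sum x {n+i..n+j}"
proof -
  have "sum x {n+i..n+j} = (\<Sum>t\<in>{i..j}. x (t + n))"
    using sum.shift_bounds_cl_nat_ivl[of x i n j] by (simp add: add.commute)
  also have "\<dots> = sum (right_part n x) {i..j}"
    using assms by (intro sum.cong) (auto simp: right_part_def add.commute)
  finally show ?thesis by simp
qed

lemma left_part_signvecs: "z \<in> signvecs (n + m) \<Longrightarrow> left_part n z \<in> signvecs n"
  by (auto simp: signvecs_def left_part_def)

lemma right_part_signvecs: "z \<in> signvecs (n + m) \<Longrightarrow> right_part n z \<in> signvecs m"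
  by (auto simp: signvecs_def right_part_def)

lemma in_prod_ones:
  assumes "S \<subseteq> signvecs n"
  shows "z \<in> prod_cut n S (ones_cut l) \<longleftrightarrow>
    z \<in> signvecs (n + l) \<and> left_part n z \<in> S \<and> sum z {n+1..n+l} = 0"
proof -
  have "ones_cut l \<subseteq> signvecs l" by (auto simp: ones_cut_eq)
  from prod_cut_iff[OF assms this] show ?thesis
    using right_part_signvecs[of z n l] sum_right_part[of 1 n z l] by (auto simp: ones_cut_eq)
qed

text \<open>In the left factor the equation \<open>a * sum = 0\<close> loses its coefficient, which
  leaves separate balances for the two kinds of parts.\<close>

lemma prod_mixed_ones_iff:
  assumes "a \<ge> 1"
  shows "z \<in> prod_cut (r + k) (mixed_cut a r k 0) (ones_cut l) \<longleftrightarrow>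
    z \<in> signvecs (r + k + l) \<and> (\<forall>i\<in>{1..r}. z i = 0) \<and> sum z {r+1..r+k} = 0 \<and> sum z {r+k+1..r+k+l} = 0"
proof -
  have "sum (left_part (r + k) z) {r+1..r+k} = sum z {r+1..r+k}"
    by (rule sum_left_part) auto
  moreover have "(\<forall>i\<in>{1..r}. left_part (r + k) z i = 0) \<longleftrightarrow> (\<forall>i\<in>{1..r}. z i = 0)"
    by (auto simp: left_part_def)
  moreover have "mixed_cut a r k 0 \<subseteq> signvecs (r + k)"
    using mixed_cut_subset[of a r k 0] by simp
  ultimately show ?thesis
    using left_part_signvecs[of z "r+k" l] assms by (auto simp: in_prod_ones mixed_cut_def)
qed

lemma prod_mixed_ones_subset:
  "a \<ge> 1 \<Longrightarrow> prod_cut (r + k) (mixed_cut a r k 0) (ones_cut l) \<subseteq> mixed_cut a r k l"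
  unfolding mixed_cut_def[of a r k l]
  by (rule subsetI, drule prod_mixed_ones_iff[THEN iffD1, rotated]) simp_all

text \<open>Serves in both directions: to split off the \<open>r\<close> free coordinates as a
  factor, and to absorb a factor that contains only the zero vector.\<close>

lemma prod_zero_mixed:
  "prod_cut r (mixed_cut a r 0 0) (mixed_cut a 0 k l) = mixed_cut a r k l"
proof -
  have S: "mixed_cut a r 0 0 \<subseteq> signvecs r" "mixed_cut a 0 k l \<subseteq> signvecs (k + l)"
    using mixed_cut_subset[of a r 0 0] mixed_cut_subset[of a 0 k l] by simp_all
  have "z \<in> prod_cut r (mixed_cut a r 0 0) (mixed_cut a 0 k l) \<longleftrightarrow> z \<in> mixed_cut a r k l" for z
  proof -
    have "sum (right_part r z) {1..k} = sum z {r+1..r+k}"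
      "sum (right_part r z) {k+1..k+l} = sum z {r+k+1..r+k+l}"
      using sum_right_part[of 1 r z k] sum_right_part[of "k+1" r z "k+l"] by (simp_all add: add.assoc)
    moreover have "(\<forall>i\<in>{1..r}. left_part r z i = 0) \<longleftrightarrow> (\<forall>i\<in>{1..r}. z i = 0)"
      by (auto simp: left_part_def)
    ultimately show ?thesis
      unfolding prod_cut_iff[OF S]
      using left_part_signvecs[of z r "k+l"] right_part_signvecs[of z r "k+l"]
      by (auto simp: mixed_cut_def add.assoc)
  qed
  then show ?thesis by blast
qed

section \<open>Gluing unit parts\<close>

text \<open>The number of the block that contains \<open>i\<close>. Indices outside the range stay
  outside it, so precomposition with this map turns a sign vector on the blocks into one on all
  coordinates.\<close>

definition block_index :: "nat \<Rightarrow> nat \<Rightarrow> nat \<Rightarrow> nat" where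
  "block_index n a i = (if i \<le> n then i else if i \<le> n + a then n + 1 else i + 1 - a)"

definition block_partition :: "nat \<Rightarrow> nat \<Rightarrow> nat \<Rightarrow> nat set list" where
  "block_partition n a l = map (\<lambda>j. {i \<in> {1..n+l}. block_index n a i = j}) [1..<n + 2 + (l - a)]"

lemma length_block_partition [simp]: "length (block_partition n a l) = n + 1 + (l - a)"
  by (auto simp: block_partition_def)

lemma nth_block_partition:
  assumes "j \<in> {1..n + 1 + (l - a)}"
  shows "block_partition n a l ! (j - 1) = {i \<in> {1..n+l}. block_index n a i = j}"
proof -
  have "[1..<n + 2 + (l - a)] ! (j - 1) = j"
    using assms by (subst nth_upt) auto
  then show ?thesis
    unfolding block_partition_def using assms by (subst nth_map) auto
qed

lemma block_index_range:
  assumes "1 \<le> a" "a \<le> l" "i \<in> {1..n+l}"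
  shows "block_index n a i \<in> {1..n + 1 + (l - a)}"
  using assms by (auto simp: block_index_def)

lemma fibre_block_index:
  assumes "1 \<le> a" "a \<le> l"
  shows "{i \<in> {1..n+l}. block_index n a i = n + 1} = {n+1..n+a}"
    and "i \<in> {1..n+l} - {n+1..n+a} \<Longrightarrow> {j \<in> {1..n+l}. block_index n a j = block_index n a i} = {i}"
  using assms by (auto simp: block_index_def split: if_splits)

lemma set_block_partition:
  assumes "1 \<le> a" "a \<le> l"
  shows "set (block_partition n a l) = insert {n+1..n+a} ((\<lambda>i. {i}) ` ({1..n+l} - {n+1..n+a}))"
proof -
  let ?f = "\<lambda>j. {i \<in> {1..n+l}. block_index n a i = j}"
  have "set (block_partition n a l) = ?f ` {1..<n + 2 + (l - a)}"
    unfolding block_partition_def by (simp only: set_map set_upt)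
  also have "{1..<n + 2 + (l - a)} = insert (n + 1) (block_index n a ` ({1..n+l} - {n+1..n+a}))" (is "?L = ?R")
  proof
    have "block_index n a i \<in> ?L" if "i \<in> {1..n+l}" for i
      using block_index_range[OF assms that] by simp
    moreover have "n + 1 \<in> ?L" by simp
    ultimately show "?R \<subseteq> ?L" by blast
    show "?L \<subseteq> ?R"
    proof
      fix j assume j: "j \<in> ?L"
      consider "j \<le> n" | "j = n + 1" | "j > n + 1" by linarith
      then show "j \<in> ?R"
      proof cases
        case 1
        then have "j = block_index n a j" "j \<in> {1..n+l} - {n+1..n+a}"
          using j by (auto simp: block_index_def)
        then show ?thesis by blast
      next
        case 3
        \<comment> \<open>Beyond the glued block, block \<open>j\<close> holds the single element
          \<open>j + a - 1\<close>.\<close>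
        then have "j = block_index n a (j + a - 1)" "j + a - 1 \<in> {1..n+l} - {n+1..n+a}"
          using j assms by (auto simp: block_index_def)
        then show ?thesis by blast
      qed simp
    qed
  qed
  also have "?f ` \<dots> = insert (?f (n + 1)) ((\<lambda>i. ?f (block_index n a i)) ` ({1..n+l} - {n+1..n+a}))"
    by (simp only: image_insert image_image)
  also have "\<dots> = insert {n+1..n+a} ((\<lambda>i. {i}) ` ({1..n+l} - {n+1..n+a}))"
    using fibre_block_index[OF assms] by (intro arg_cong2[of _ _ _ _ insert] image_cong) auto
  finally show ?thesis .
qed

lemma block_partition_ordered:
  assumes "1 \<le> a" "a \<le> l"
  shows "block_partition n a l \<in> ordered_partitions {1..n+l}"
proof -
  have ne: "{i \<in> {1..n+l}. block_index n a i = j} \<noteq> {}" if "j \<in> {1..<n + 2 + (l - a)}" for j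
  proof -
    consider "j \<le> n" | "j = n + 1" | "j > n + 1" by linarith
    then show ?thesis
    proof cases
      case 1
      then have "j \<in> {i \<in> {1..n+l}. block_index n a i = j}"
        using that by (auto simp: block_index_def)
      then show ?thesis by blast
    next
      case 2
      then have "n + 1 \<in> {i \<in> {1..n+l}. block_index n a i = j}"
        using assms by (auto simp: block_index_def)
      then show ?thesis by blast
    next
      case 3
      then have "j + a - 1 \<in> {i \<in> {1..n+l}. block_index n a i = j}"
        using that assms by (auto simp: block_index_def)
      then show ?thesis by blast
    qed
  qed
  have "inj_on (\<lambda>j. {i \<in> {1..n+l}. block_index n a i = j}) {1..<n + 2 + (l - a)}"
  proof (rule inj_onI)
    fix j j' assume j: "j \<in> {1..<n + 2 + (l - a)}"
      and eq: "{i \<in> {1..n+l}. block_index n a i = j} = {i \<in> {1..n+l}. block_index n a i = j'}"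
    from ne[OF j] obtain i where "i \<in> {i \<in> {1..n+l}. block_index n a i = j}" by blast
    moreover from this have "i \<in> {i \<in> {1..n+l}. block_index n a i = j'}" using eq by blast
    ultimately show "j = j'" by simp
  qed
  then have "distinct (block_partition n a l)"
    unfolding block_partition_def distinct_map by (simp only: distinct_upt set_upt simp_thms)
  moreover have "partition_on {1..n+l} (set (block_partition n a l))"
  proof (rule partition_onI, goal_cases)
    case 1
    show ?case unfolding set_block_partition[OF assms] using assms by auto
  next
    case (2 p q)
    then show ?case unfolding set_block_partition[OF assms] by (auto simp: disjnt_def)
  next
    case 3
    show ?case using assms unfolding set_block_partition[OF assms] by auto
  qed
  ultimately show ?thesis
    by (simp add: ordered_partitions_def)
qed

text \<open>The witness \<open>s\<close> is forced: \<open>t\<close> fixes it on every block, and it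
  vanishes outside the range.\<close>

lemma pull_block_partition:
  assumes a: "1 \<le> a" "a \<le> l" and S: "S \<subseteq> signvecs (n + l)"
  shows "pull (block_partition n a l) S = {t \<in> signvecs (n + 1 + (l - a)). t \<circ> block_index n a \<in> S}"
proof -
  have "(\<exists>s\<in>S. \<forall>j\<in>{1..n + 1 + (l - a)}. \<forall>i\<in>block_partition n a l ! (j - 1). s i = t j)
      \<longleftrightarrow> t \<circ> block_index n a \<in> S" if t: "t \<in> signvecs (n + 1 + (l - a))" for t
  proof
    assume "t \<circ> block_index n a \<in> S"
    moreover have "\<forall>j\<in>{1..n + 1 + (l - a)}. \<forall>i\<in>block_partition n a l ! (j - 1). (t \<circ> block_index n a) i = t j"
      by (intro ballI) (simp only: nth_block_partition, simp)
    ultimately show "\<exists>s\<in>S. \<forall>j\<in>{1..n + 1 + (l - a)}. \<forall>i\<in>block_partition n a l ! (j - 1). s i = t j"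
      by blast
  next
    assume "\<exists>s\<in>S. \<forall>j\<in>{1..n + 1 + (l - a)}. \<forall>i\<in>block_partition n a l ! (j - 1). s i = t j"
    then obtain s where s: "s \<in> S" and
      eq: "\<And>j i. j \<in> {1..n + 1 + (l - a)} \<Longrightarrow> i \<in> block_partition n a l ! (j - 1) \<Longrightarrow> s i = t j"
      by blast
    have "s i = t (block_index n a i)" for i
    proof (cases "i \<in> {1..n+l}")
      case True
      have r: "block_index n a i \<in> {1..n + 1 + (l - a)}"
        by (rule block_index_range[OF a True])
      show ?thesis
        by (rule eq[OF r]) (simp only: nth_block_partition[OF r] mem_Collect_eq True simp_thms)
    next
      case False
      then have i: "i = 0 \<or> i > n + l" by auto
      then have "block_index n a i = 0 \<or> block_index n a i > n + 1 + (l - a)"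
        using a by (auto simp: block_index_def)
      then show ?thesis
        using signvecs_eq_0[OF t, of "block_index n a i"] signvecs_eq_0[of s "n+l" i] i s S by auto
    qed
    then have "s = t \<circ> block_index n a" by auto
    with s show "t \<circ> block_index n a \<in> S" by simp
  qed
  then show ?thesis
    unfolding pull_def length_block_partition by blast
qed

lemma sum_block_index:
  fixes t :: "nat \<Rightarrow> real"
  assumes "1 \<le> a" "a \<le> l"
  shows "(\<Sum>i=n+1..n+l. t (block_index n a i)) = real a * t (n + 1) + (\<Sum>j=n+2..n + 1 + (l - a). t j)"
proof -
  have "(\<Sum>i=n+1..n+l. t (block_index n a i)) =
      (\<Sum>i=n+1..n+a. t (block_index n a i)) + (\<Sum>i=n+a+1..n+a+(l-a). t (block_index n a i))"
    using sum.ub_add_nat[of "n+1" "n+a" "\<lambda>i. t (block_index n a i)" "l - a"] assms by simp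
  moreover have "(\<Sum>i=n+1..n+a. t (block_index n a i)) = (\<Sum>i=n+1..n+a. t (n + 1))"
    by (intro sum.cong) (auto simp: block_index_def)
  moreover have "(\<Sum>i=n+a+1..n+a+(l-a). t (block_index n a i)) = (\<Sum>j=n+2..n+1+(l-a). t j)"
    by (rule sum.reindex_bij_witness[of _ "\<lambda>j. j + a - 1" "block_index n a"])
      (use assms in \<open>auto simp: block_index_def\<close>)
  ultimately show ?thesis
    by simp
qed

lemma comp_block_index_signvecs:
  assumes "1 \<le> a" "a \<le> l" "t \<in> signvecs (n + 1 + (l - a))"
  shows "t \<circ> block_index n a \<in> signvecs (n + l)"
proof -
  have "t (block_index n a i) = 0" if "i = 0 \<or> i > n + l" for i
    by (rule signvecs_eq_0[OF assms(3)]) (use that assms in \<open>auto simp: block_index_def\<close>)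
  then show ?thesis
    using assms(3) unfolding signvecs_iff by simp
qed

text \<open>The glued block weighs \<open>a\<close> and comes right after the \<open>k\<close> parts
  equal to \<open>a\<close>, so it becomes their successor without any reordering.\<close>

lemma pull_mixed_cut:
  assumes "1 \<le> a" "a \<le> l"
  shows "pull (block_partition (r + k) a l) (mixed_cut a r k l) = mixed_cut a r (k + 1) (l - a)"
proof -
  have "t \<circ> block_index (r + k) a \<in> mixed_cut a r k l \<longleftrightarrow> t \<in> mixed_cut a r (k + 1) (l - a)"
    if t: "t \<in> signvecs (r + k + 1 + (l - a))" for t
  proof -
    have "(\<forall>i\<in>{1..r}. (t \<circ> block_index (r + k) a) i = 0) \<longleftrightarrow> (\<forall>i\<in>{1..r}. t i = 0)"
      by (auto simp: block_index_def)
    moreover have "sum (t \<circ> block_index (r + k) a) {r+1..r+k} = sum t {r+1..r+k}"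
      by (intro sum.cong) (auto simp: block_index_def)
    moreover have "sum (t \<circ> block_index (r + k) a) {r+k+1..r+k+l} =
        real a * t (r + k + 1) + sum t {r+k+2..r+k+1+(l-a)}"
      using sum_block_index[OF assms, of t "r + k"] by (simp add: o_def)
    moreover have "sum t {r+1..r+(k+1)} = sum t {r+1..r+k} + t (r + k + 1)"
      by simp
    ultimately show ?thesis
      using comp_block_index_signvecs[OF assms t] t
      by (simp add: mixed_cut_def algebra_simps)
  qed
  moreover have "mixed_cut a r (k + 1) (l - a) \<subseteq> signvecs (r + k + 1 + (l - a))"
    using mixed_cut_subset[of a r "k+1" "l-a"] by simp
  ultimately show ?thesis
    unfolding pull_block_partition[OF assms mixed_cut_subset] by blast
qed

text \<open>All glued coordinates lie in the second factor, so the first one is untouched and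
  \<open>(1^l)\<close> becomes \<open>(a, 1^(l-a))\<close>.\<close>

lemma pull_prod_ones:
  assumes a: "1 \<le> a" "a \<le> l" and S: "S \<subseteq> signvecs n"
  shows "pull (block_partition n a l) (prod_cut n S (ones_cut l)) = prod_cut n S (mixed_cut a 0 1 (l - a))"
proof -
  have T: "mixed_cut a 0 1 (l - a) \<subseteq> signvecs (1 + (l - a))"
    using mixed_cut_subset[of a 0 1 "l - a"] by simp
  have ones: "ones_cut l \<subseteq> signvecs l" by (auto simp: ones_cut_eq)
  have sub: "prod_cut n S (ones_cut l) \<subseteq> signvecs (n + l)"
    using prod_cut_iff[OF S ones] by blast
  have "t \<circ> block_index n a \<in> prod_cut n S (ones_cut l) \<longleftrightarrow> t \<in> prod_cut n S (mixed_cut a 0 1 (l - a))"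
    if t: "t \<in> signvecs (n + 1 + (l - a))" for t
  proof -
    have t': "t \<in> signvecs (n + (1 + (l - a)))" using t by (simp add: add.assoc)
    have "left_part n (t \<circ> block_index n a) = left_part n t"
      by (auto simp: left_part_def block_index_def)
    moreover have "sum (t \<circ> block_index n a) {n+1..n+l} = real a * t (n + 1) + sum t {n+2..n+1+(l-a)}"
      using sum_block_index[OF a, of t n] by (simp add: o_def)
    moreover have "sum (right_part n t) {1..1} = t (n + 1)"
      by (simp add: right_part_def)
    moreover have "sum (right_part n t) {2..1+(l-a)} = sum t {n+2..n+1+(l-a)}"
      using sum_right_part[of 2 n t "1 + (l - a)"] by (simp add: add.assoc)
    ultimately have "t \<circ> block_index n a \<in> prod_cut n S (ones_cut l) \<longleftrightarrow> left_part n t \<in> S \<and> right_part n t \<in> mixed_cut a 0 1 (l - a)"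
      unfolding in_prod_ones[OF S]
      using comp_block_index_signvecs[OF a t] right_part_signvecs[OF t']
      by (simp add: mixed_cut_def numeral_2_eq_2)
    then show ?thesis
      unfolding prod_cut_iff[OF S T] using t' by simp
  qed
  moreover have "prod_cut n S (mixed_cut a 0 1 (l - a)) \<subseteq> signvecs (n + 1 + (l - a))"
    using prod_cut_iff[OF S T] by (auto simp: add.assoc)
  ultimately show ?thesis
    unfolding pull_block_partition[OF a sub] by blast
qed

section \<open>The closure of the glued partition\<close>

definition big_block_partitions :: "nat \<Rightarrow> nat \<Rightarrow> nat \<Rightarrow> nat set set set" where
  "big_block_partitions n a l = {P \<in> partitions {1..n+l}. \<exists>B\<in>P. a \<le> card (B \<inter> {n+1..n+l})}"

definition diff_vec :: "nat \<Rightarrow> nat \<Rightarrow> rvec" where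
  "diff_vec i j = (\<lambda>t. if t = i then 1 else if t = j then -1 else 0)"

lemma Plus_diff_vec: "Plus (diff_vec i j) = {i}"
  by (auto simp: Plus_def diff_vec_def)

lemma Minus_diff_vec: "i \<noteq> j \<Longrightarrow> Minus (diff_vec i j) = {j}"
  by (auto simp: Minus_def diff_vec_def)

definition block_coll :: "nat set \<Rightarrow> nat set \<Rightarrow> nat multiset multiset" where
  "block_coll A N = add_mset (mset_set A) (image_mset (\<lambda>i. {#i#}) (mset_set (N - A)))"

lemma coll_of_block_partition:
  assumes "1 \<le> a" "a \<le> l"
  shows "coll_of (set (block_partition n a l)) = block_coll {n+1..n+a} {1..n+l}"
proof -
  let ?A = "{n+1..n+a}" and ?R = "{1..n+l} - {n+1..n+a}"
  have "?A \<notin> (\<lambda>i. {i}) ` ?R"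
  proof
    assume "?A \<in> (\<lambda>i. {i}) ` ?R"
    then obtain i where "?A = {i}" "i \<notin> ?A" by blast
    then show False by blast
  qed
  then have "coll_of (set (block_partition n a l)) =
      add_mset (mset_set ?A) (image_mset mset_set (mset_set ((\<lambda>i. {i}) ` ?R)))"
    unfolding set_block_partition[OF assms] coll_of_def by simp
  also have "mset_set ((\<lambda>i. {i}) ` ?R) = image_mset (\<lambda>i. {i}) (mset_set ?R)"
    by (rule image_mset_mset_set[symmetric]) simp
  finally show ?thesis
    by (simp add: block_coll_def image_mset.compositionality o_def)
qed

lemma coll_closure_trans:
  assumes "A \<in> coll_closure S A'"
  shows "B \<in> coll_closure S A \<Longrightarrow> B \<in> coll_closure S A'"
  by (induction rule: coll_closure.induct) (blast intro: assms coll_closure.intros)+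

section \<open>Partitions reachable by rewriting\<close>

lemma closed_under_down: "closed_under n S (down n S P)"
proof -
  have "Q \<in> down n S Q" if "Q \<in> down n S P" for Q
    using that by (simp add: down_def coll_closure.base)
  moreover have "R \<in> down n S P" if "Q \<in> down n S P" "R \<in> down n S Q" for Q R
    using that by (auto simp: down_def intro: coll_closure_trans)
  moreover have "down n S P \<subseteq> partitions {1..n}"
    by (auto simp: down_def)
  ultimately show ?thesis
    unfolding closed_under_def by blast
qed

text \<open>\<open>M\<close> is nonempty because no rewriting rule adds a member to a
  collection.\<close>

lemma coll_closure_merge_all:
  assumes "M \<noteq> {#}" "M + C \<in> coll_closure S A"
  shows "add_mset (\<Sum>\<^sub># M) C \<in> coll_closure S A"
  using assms
proof (induction M arbitrary: C)
  case (add B M)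
  show ?case
  proof (cases "M = {#}")
    case True
    then show ?thesis using add.prems by simp
  next
    case False
    have "M + add_mset B C \<in> coll_closure S A"
      using add.prems by simp
    then have "add_mset (\<Sum>\<^sub># M) (add_mset B C) \<in> coll_closure S A"
      by (rule add.IH[OF False])
    then have "add_mset (\<Sum>\<^sub># M + B) C \<in> coll_closure S A"
      by (rule coll_closure.merge)
    then show ?thesis by (simp add: add.commute)
  qed
qed simp

text \<open>\<open>g B\<close> is the collection of fragments from which the block \<open>B\<close>
  is assembled; the blocks are completed one by one, with everything else carried along in
  \<open>C\<close>.\<close>

lemma coll_closure_merge_blocks:
  assumes "finite R" "\<And>B. B \<in> R \<Longrightarrow> g B \<noteq> {#} \<and> \<Sum>\<^sub># (g B) = mset_set B"
    and "(\<Sum>B\<in>R. g B) + C \<in> coll_closure S A"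
  shows "image_mset mset_set (mset_set R) + C \<in> coll_closure S A"
  using assms
proof (induction R arbitrary: C)
  case (insert B R)
  have "(\<Sum>B\<in>R. g B) + (g B + C) \<in> coll_closure S A"
    using insert by (simp add: ac_simps)
  then have "image_mset mset_set (mset_set R) + (g B + C) \<in> coll_closure S A"
    using insert by blast
  then have "g B + (image_mset mset_set (mset_set R) + C) \<in> coll_closure S A"
    by (simp add: ac_simps)
  then have "add_mset (\<Sum>\<^sub># (g B)) (image_mset mset_set (mset_set R) + C) \<in> coll_closure S A"
    using insert.prems(1)[of B] by (intro coll_closure_merge_all) auto
  then show ?case
    using insert by simp
qed simp

text \<open>One swap trades \<open>i\<close> for \<open>j\<close> in the block, a second one repairs the singleton.\<close>

lemma block_coll_exchange:
  assumes fin: "finite N" "A \<subseteq> N" and ij: "i \<in> A" "j \<in> N - A"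
    and S: "diff_vec i j \<in> S" "diff_vec j i \<in> S"
    and K: "block_coll A N \<in> coll_closure S K"
  shows "block_coll (insert j (A - {i})) N \<in> coll_closure S K"
proof -
  have finA: "finite A" using fin finite_subset by blast
  have ne: "i \<noteq> j" using ij by blast
  let ?sing = "image_mset (\<lambda>i. {#i#})"
  define R where "R = N - insert j A"
  have R: "N - A = insert j R" "j \<notin> R" "N - insert j (A - {i}) = insert i R" "i \<notin> R" "finite R"
    using ij fin by (auto simp: R_def)
  have 1: "block_coll A N = add_mset (mset_set A) (add_mset {#j#} (?sing (mset_set R)))"
    unfolding block_coll_def R(1) mset_set.insert[OF R(5,2)] by simp
  have 2: "block_coll (insert j (A - {i})) N =
      add_mset (mset_set (insert j (A - {i}))) (add_mset {#i#} (?sing (mset_set R)))"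
    unfolding block_coll_def R(3) mset_set.insert[OF R(5,4)] by simp
  have "mset_set (Plus (diff_vec i j)) \<subseteq># mset_set A"
    using ij finA by (simp add: Plus_diff_vec)
  then have "add_mset (mset_set A - {#i#} + {#j#}) (add_mset {#j#} (?sing (mset_set R))) \<in> coll_closure S K"
    using coll_closure.swap[OF K[unfolded 1] S(1)] by (simp add: Plus_diff_vec Minus_diff_vec ne)
  moreover have "mset_set A - {#i#} + {#j#} = mset_set (insert j (A - {i}))"
    using ij finA by (subst mset_set.insert) (auto simp: mset_set_Diff)
  ultimately have "add_mset {#j#} (add_mset (mset_set (insert j (A - {i}))) (?sing (mset_set R))) \<in> coll_closure S K"
    by (simp add: add_mset_commute)
  from coll_closure.swap[OF this S(2)]
  have "add_mset {#i#} (add_mset (mset_set (insert j (A - {i}))) (?sing (mset_set R))) \<in> coll_closure S K"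
    using ne by (simp add: Plus_diff_vec Minus_diff_vec)
  then show ?thesis
    unfolding 2 by (simp add: add_mset_commute)
qed

text \<open>Each exchange trades an element of \<open>A - A'\<close> for one of
  \<open>A' - A\<close>, which lowers \<open>card (A' - A)\<close> by one and preserves the size of
  the block.\<close>

lemma block_coll_reachable:
  assumes fin: "finite N" and ON: "Ones \<subseteq> N"
    and S: "\<And>i j. i \<in> Ones \<Longrightarrow> j \<in> Ones \<Longrightarrow> i \<noteq> j \<Longrightarrow> diff_vec i j \<in> S"
    and A: "A \<subseteq> Ones" "A' \<subseteq> Ones" "card A = card A'"
    and K: "block_coll A N \<in> coll_closure S K"
  shows "block_coll A' N \<in> coll_closure S K"
  using A K
proof (induction "card (A' - A)" arbitrary: A)
  case 0
  have "finite A" "finite A'" using 0 ON fin by (meson finite_subset)+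
  then have "A' \<subseteq> A" using 0(1) by simp
  then have "A' = A" using \<open>finite A\<close> 0 by (simp add: card_subset_eq)
  then show ?case using 0 by simp
next
  case (Suc m)
  have f: "finite A" "finite A'" using Suc.prems ON fin by (meson finite_subset)+
  obtain j where j: "j \<in> A'" "j \<notin> A"
    using Suc.hyps(2) by (metis Diff_iff card.empty ex_in_conv nat.distinct(1))
  have "\<not> A \<subseteq> A'"
    using j f Suc.prems(3) card_subset_eq by metis
  then obtain i where i: "i \<in> A" "i \<notin> A'" by blast
  let ?A = "insert j (A - {i})"
  have "A' - A = insert j (A' - ?A)" "j \<notin> A' - ?A" using i j by auto
  then have "Suc m = Suc (card (A' - ?A))"
    using Suc.hyps(2) f by (metis card_insert_disjoint finite_Diff)
  then have "m = card (A' - ?A)" by simp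
  moreover have "?A \<subseteq> Ones" using Suc.prems j by blast
  moreover have "card ?A = card A'"
    using i j f Suc.prems(3) by (metis Diff_iff card_Suc_Diff1 card_insert_disjoint finite_Diff)
  moreover have "block_coll ?A N \<in> coll_closure S K"
    using i j Suc.prems ON fin by (intro block_coll_exchange S) auto
  ultimately show ?case
    using Suc.hyps(1) Suc.prems(2) by blast
qed

lemma mset_set_Union_disjoint:
  assumes "finite R" "\<And>B. B \<in> R \<Longrightarrow> finite B" "disjoint R"
  shows "mset_set (\<Union>R) = (\<Sum>B\<in>R. mset_set B)"
  using assms
proof (induction R)
  case (insert B R)
  have "B \<inter> \<Union>R = {}"
    using insert.prems(2) insert.hyps(2) by (auto simp: disjoint_def pairwise_def disjnt_def)
  then have "mset_set (B \<union> \<Union>R) = mset_set B + mset_set (\<Union>R)"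
    using insert by (intro mset_set_Union) auto
  then show ?case
    using insert by (simp add: pairwise_insert)
qed simp

text \<open>Every block of \<open>P\<close> falls into singletons, except that \<open>B0\<close> has
  \<open>A\<close> as one fragment. All these fragments together are \<open>block_coll A N\<close>,
  so merging rebuilds \<open>P\<close>.\<close>

lemma refine_block_coll:
  assumes P: "partition_on N P" "finite N" and B: "B0 \<in> P" "A \<subseteq> B0" "A \<noteq> {}"
    and K: "block_coll A N \<in> coll_closure S K"
  shows "coll_of P \<in> coll_closure S K"
proof -
  let ?sing = "image_mset (\<lambda>i. {#i#}) :: nat multiset \<Rightarrow> nat multiset multiset"
  have finP: "finite P" using P finite_elements by blast
  have finB: "finite B" if "B \<in> P" for B
  proof -
    have "B \<subseteq> N" using that partition_onD1[OF P(1)] by blast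
    then show ?thesis using P(2) finite_subset by blast
  qed
  have dis: "disjoint P" using P partition_onD2 by blast
  define g where "g B = (if B = B0 then add_mset (mset_set A) (?sing (mset_set (B0 - A)))
     else ?sing (mset_set B))" for B
  have sing: "\<Sum>\<^sub># (?sing M) = M" for M
    by (induction M) auto
  have g: "g B \<noteq> {#} \<and> \<Sum>\<^sub># (g B) = mset_set B" if "B \<in> P" for B
  proof (cases "B = B0")
    case True
    have "mset_set A + mset_set (B0 - A) = mset_set B0"
      using mset_set_Union[of A "B0 - A"] B finB[OF B(1)] finite_subset[OF B(2)]
      by (simp add: Un_absorb1)
    then show ?thesis using True by (simp add: g_def sing)
  next
    case False
    have "B \<noteq> {}" using that P partition_onD3 by blast
    then show ?thesis using False finB[OF that] by (simp add: g_def sing mset_set_empty_iff)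
  qed
  have N: "N - A = \<Union>(P - {B0}) \<union> (B0 - A)"
  proof -
    have "N = \<Union>P" using P partition_onD1 by blast
    moreover have "B \<inter> B0 = {}" if "B \<in> P - {B0}" for B
      using dis that B by (auto simp: disjoint_def)
    ultimately show ?thesis using B by blast
  qed
  have "\<Union>(P - {B0}) \<inter> (B0 - A) = {}"
    using dis B by (auto simp: disjoint_def)
  then have "mset_set (N - A) = mset_set (\<Union>(P - {B0})) + mset_set (B0 - A)"
    unfolding N using finP finB B by (intro mset_set_Union) auto
  also have "mset_set (\<Union>(P - {B0})) = (\<Sum>B\<in>P - {B0}. mset_set B)"
    using finP finB dis by (intro mset_set_Union_disjoint) (auto intro: pairwise_subset)
  finally have e1: "?sing (mset_set (N - A)) = (\<Sum>B\<in>P - {B0}. ?sing (mset_set B)) + ?sing (mset_set (B0 - A))"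
    using sum_comp_morphism[of ?sing mset_set "P - {B0}"] by (simp add: o_def)
  have e2: "(\<Sum>B\<in>P - {B0}. ?sing (mset_set B)) = (\<Sum>B\<in>P - {B0}. g B)"
    by (intro sum.cong) (auto simp: g_def)
  have e3: "(\<Sum>B\<in>P. g B) = g B0 + (\<Sum>B\<in>P - {B0}. g B)"
    by (rule sum.remove[OF finP B(1)])
  have e4: "g B0 = add_mset (mset_set A) (?sing (mset_set (B0 - A)))"
    by (simp add: g_def)
  have "block_coll A N = (\<Sum>B\<in>P. g B) + {#}"
    unfolding block_coll_def e1 e2 e3 e4 by (simp add: add.commute)
  then have "image_mset mset_set (mset_set P) + {#} \<in> coll_closure S K"
    using K by (intro coll_closure_merge_blocks[OF finP g]) simp_all
  then show ?thesis by (simp add: coll_of_def)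
qed

text \<open>Under the rewriting this weight never decreases: swaps preserve the total of each block, and
  merging two blocks is superadditive for \<open>\<lambda>w. w div a\<close>. It separates partitions with only small
  blocks (weight \<open>k\<close>) from the glued partition (weight \<open>k + 1\<close>).\<close>

definition block_weight :: "nat \<Rightarrow> nat \<Rightarrow> nat \<Rightarrow> nat multiset multiset \<Rightarrow> nat" where
  "block_weight a r k M = (\<Sum>B\<in>#M. (\<Sum>i\<in>#B. weight a r k i) div a)"

lemma block_weight_coll_closure:
  assumes T: "T \<subseteq> mixed_cut a r k l" and "M \<in> coll_closure T K"
  shows "block_weight a r k K \<le> block_weight a r k M"
  using assms(2)
proof (induction rule: coll_closure.induct)
  case (merge B1 B2 C)
  have "x div a + y div a \<le> (x + y) div a" for x y
    by (metis div_add1_eq le_add1)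
  then show ?case
    using merge by (auto simp: block_weight_def intro: order_trans)
next
  case (swap B C x)
  have x: "x \<in> mixed_cut a r k l" using swap T by blast
  let ?w = "\<lambda>B. \<Sum>i\<in>#B. weight a r k i"
  have "?w (mset_set (Plus x)) = ?w (mset_set (Minus x))"
    using mixed_cut_weight[OF x] by (simp add: sum_unfold_sum_mset)
  moreover have "?w B = ?w (B - mset_set (Plus x)) + ?w (mset_set (Plus x))"
    using swap(3) by (metis image_mset_union subset_mset.diff_add sum_mset.union)
  ultimately have "?w (B - mset_set (Plus x) + mset_set (Minus x)) = ?w B"
    by simp
  then show ?case
    using swap by (simp add: block_weight_def)
qed simp

lemma sum_indicator_card:
  "finite I \<Longrightarrow> (\<Sum>i\<in>I. if i \<in> J then c else 0) = of_nat (card (I \<inter> J)) * (c :: 'a :: semiring_1)"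
  by (simp add: sum.inter_restrict[symmetric])

text \<open>The glued block contributes \<open>a div a = 1\<close> and each \<open>a\<close>-part
  contributes 1. The remaining singletons contribute 0, since \<open>1 div a = 0\<close> for
  \<open>a \<ge> 2\<close>.\<close>

lemma block_weight_block_coll:
  assumes "2 \<le> a" "a \<le> l"
  shows "block_weight a r k (block_coll {r+k+1..r+k+a} {1..r+k+l}) = k + 1"
proof -
  let ?N = "{1..r+k+l} - {r+k+1..r+k+a}"
  have "(\<Sum>i\<in>{r+k+1..r+k+a}. weight a r k i) = (\<Sum>i\<in>{r+k+1..r+k+a}. 1)"
    by (intro sum.cong) (auto simp: weight_def)
  then have "(\<Sum>i\<in>{r+k+1..r+k+a}. weight a r k i) = a" by simp
  moreover have "(\<Sum>i\<in>?N. weight a r k i div a) = k"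
  proof -
    have "(\<Sum>i\<in>?N. weight a r k i div a) = (\<Sum>i\<in>?N. if i \<in> {r+1..r+k} then 1 else 0)"
      using assms by (intro sum.cong) (auto simp: weight_def)
    also have "\<dots> = card (?N \<inter> {r+1..r+k})"
      by (subst sum_indicator_card) simp_all
    also have "?N \<inter> {r+1..r+k} = {r+1..r+k}" by auto
    finally show ?thesis by simp
  qed
  ultimately show ?thesis
    using assms by (simp add: block_weight_def block_coll_def image_mset.compositionality o_def
        sum_unfold_sum_mset)
qed

text \<open>A block with \<open>c\<close> parts equal to \<open>a\<close> and fewer than
  \<open>a\<close> unit parts has quotient exactly \<open>c\<close>, so the sum just counts the
  \<open>a\<close>-parts.\<close>

lemma block_weight_small_blocks:
  assumes a: "2 \<le> a" and P: "partition_on {1..r+k+l} P"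
    and small: "\<And>B. B \<in> P \<Longrightarrow> card (B \<inter> {r+k+1..r+k+l}) < a"
  shows "block_weight a r k (coll_of P) = k"
proof -
  let ?As = "{r+1..r+k}" and ?Ones = "{r+k+1..r+k+l}"
  have finP: "finite P" using P finite_elements by blast
  have sub: "B \<subseteq> {1..r+k+l}" if "B \<in> P" for B
    using that P partition_onD1 by blast
  have w: "(\<Sum>i\<in>B. weight a r k i) div a = card (B \<inter> ?As)" if "B \<in> P" for B
  proof -
    have fB: "finite B" using sub[OF that] finite_subset by blast
    have "(\<Sum>i\<in>B. weight a r k i) = (\<Sum>i\<in>B. (if i \<in> ?As then a else 0) + (if i \<in> ?Ones then 1 else 0))"
      using sub[OF that] by (intro sum.cong) (auto simp: weight_def)
    also have "\<dots> = a * card (B \<inter> ?As) + card (B \<inter> ?Ones)"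
      unfolding sum.distrib sum_indicator_card[OF fB] by simp
    finally show ?thesis
      using small[OF that] a by simp
  qed
  have "block_weight a r k (coll_of P) = (\<Sum>B\<in>P. (\<Sum>i\<in>B. weight a r k i) div a)"
    by (simp add: block_weight_def coll_of_def image_mset.compositionality o_def sum_unfold_sum_mset)
  also have "\<dots> = (\<Sum>B\<in>P. card (B \<inter> ?As))"
    by (intro sum.cong w refl)
  also have "\<dots> = card (\<Union>B\<in>P. B \<inter> ?As)"
  proof (rule card_UN_disjoint[symmetric])
    show "\<forall>B\<in>P. \<forall>B'\<in>P. B \<noteq> B' \<longrightarrow> B \<inter> ?As \<inter> (B' \<inter> ?As) = {}"
      using partition_onD2[OF P] by (auto simp: disjoint_def)
  qed (use finP in auto)
  also have "(\<Union>B\<in>P. B \<inter> ?As) = ?As"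
    using partition_onD1[OF P] by auto
  finally show ?thesis by simp
qed

text \<open>\<open>T\<close> may be any set between the exchange vectors of the unit parts and the
  mixed cut, so one statement covers both cuts that are compared. The lower bound makes all
  partitions with a big block reachable; the upper bound keeps the weight from decreasing, which
  excludes the others.\<close>

lemma down_block_partition:
  assumes a: "2 \<le> a" "a \<le> l" and T: "T \<subseteq> mixed_cut a r k l"
    and E: "\<And>i j. i \<in> {r+k+1..r+k+l} \<Longrightarrow> j \<in> {r+k+1..r+k+l} \<Longrightarrow> i \<noteq> j \<Longrightarrow> diff_vec i j \<in> T"
  shows "down (r + k + l) T (set (block_partition (r + k) a l)) = big_block_partitions (r + k) a l"
proof -
  have a1: "1 \<le> a" using a by simp
  let ?K = "block_coll {r+k+1..r+k+a} {1..r+k+l}"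
  have "coll_of Q \<in> coll_closure T ?K \<longleftrightarrow> (\<exists>B\<in>Q. a \<le> card (B \<inter> {r+k+1..r+k+l}))"
    if Q: "partition_on {1..r+k+l} Q" for Q
  proof
    assume "coll_of Q \<in> coll_closure T ?K"
    then have "k + 1 \<le> block_weight a r k (coll_of Q)"
      using block_weight_coll_closure[OF T] block_weight_block_coll[OF a, of r k] by metis
    then have "block_weight a r k (coll_of Q) \<noteq> k" by simp
    then show "\<exists>B\<in>Q. a \<le> card (B \<inter> {r+k+1..r+k+l})"
      using block_weight_small_blocks[OF a(1) Q] by (meson not_le)
  next
    assume "\<exists>B\<in>Q. a \<le> card (B \<inter> {r+k+1..r+k+l})"
    then obtain B where B: "B \<in> Q" "a \<le> card (B \<inter> {r+k+1..r+k+l})" by blast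
    obtain A where A: "A \<subseteq> B \<inter> {r+k+1..r+k+l}" "card A = a"
      using obtain_subset_with_card_n[OF B(2)] by metis
    have "block_coll A {1..r+k+l} \<in> coll_closure T ?K"
    proof (rule block_coll_reachable[where Ones = "{r+k+1..r+k+l}"])
      show "?K \<in> coll_closure T ?K" by (rule coll_closure.base)
    qed (use A E a in auto)
    moreover have "A \<noteq> {}" using A a by auto
    ultimately show "coll_of Q \<in> coll_closure T ?K"
      using A B by (intro refine_block_coll[OF Q _ B(1)]) auto
  qed
  then show ?thesis
    unfolding down_def big_block_partitions_def partitions_def coll_of_block_partition[OF a1 a(2)]
    by (simp add: add.assoc cong: conj_cong)
qed

section \<open>Vectors that survive the removal\<close>

lemma partition_of_vec_partition:
  assumes x: "x \<in> signvecs n"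
  shows "partition_on {1..n} (partition_of_vec n x)"
proof (rule partition_onI)
  have dis: "Plus x \<inter> Minus x = {}" by (auto simp: Plus_def Minus_def)
  show "\<Union>(partition_of_vec n x) = {1..n}"
    using Plus_subset[OF x] Minus_subset[OF x] by (auto simp: partition_of_vec_def)
  show "{} \<notin> partition_of_vec n x"
    by (auto simp: partition_of_vec_def)
  show "disjnt p q" if "p \<in> partition_of_vec n x" "q \<in> partition_of_vec n x" "p \<noteq> q" for p q
    using that dis by (auto simp: partition_of_vec_def disjnt_def)
qed

text \<open>A surviving vector has fewer than \<open>a\<close> unit parts of either sign, so its
  units cannot compensate even one part \<open>a\<close>: both kinds of parts balance on their
  own.\<close>

lemma remove_big_blocks_eq:
  assumes a: "2 \<le> a"
  shows "remove_partitions (r + k + l) (mixed_cut a r k l) (big_block_partitions (r + k) a l) =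
    remove_partitions (r + k + l) (prod_cut (r + k) (mixed_cut a r k 0) (ones_cut l))
      (big_block_partitions (r + k) a l)"
proof -
  let ?O = "{r+k+1..r+k+l}"
  have a1: "1 \<le> a" using a by simp
  have "x \<in> prod_cut (r + k) (mixed_cut a r k 0) (ones_cut l)"
    if x: "x \<in> mixed_cut a r k l" and small: "partition_of_vec (r + k + l) x \<notin> big_block_partitions (r + k) a l" for x
  proof -
    have xs: "x \<in> signvecs (r + k + l)" using x by (simp add: mixed_cut_def)
    have card: "card (B \<inter> ?O) < a" if "B \<in> partition_of_vec (r + k + l) x" for B
      using small that partition_of_vec_partition[OF xs]
      by (auto simp: big_block_partitions_def partitions_def)
    \<comment> \<open>\<open>Plus x\<close> is a block of the partition unless it is empty, and then
      the bound is trivial.\<close>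
    have P: "card (Plus x \<inter> ?O) < a"
      using card[of "Plus x"] a by (cases "Plus x = {}") (auto simp: partition_of_vec_def)
    have M: "card (Minus x \<inter> ?O) < a"
      using card[of "Minus x"] a by (cases "Minus x = {}") (auto simp: partition_of_vec_def)
    have int: "sum x I = real_of_int (int (card (Plus x \<inter> I)) - int (card (Minus x \<inter> I)))" if "finite I" for I
    proof -
      have "sum x I = (\<Sum>i\<in>I. (if i \<in> Plus x then 1 else 0) - (if i \<in> Minus x then 1 else 0))"
        using signvecs_cases[OF xs] by (intro sum.cong) (auto simp: Plus_def Minus_def)
      then show ?thesis
        using that by (simp add: sum_subtractf sum.inter_restrict[symmetric] Int_commute)
    qed
    \<comment> \<open>Net numbers of \<open>a\<close>-parts and of unit parts. From
      \<open>a * u + v = 0\<close> it follows that \<open>a\<close> divides \<open>v\<close>, and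
      the absolute value of \<open>v\<close> is below \<open>a\<close>; hence \<open>v = 0\<close>
      and then \<open>u = 0\<close>.\<close>
    define u where "u = int (card (Plus x \<inter> {r+1..r+k})) - int (card (Minus x \<inter> {r+1..r+k}))"
    define v where "v = int (card (Plus x \<inter> ?O)) - int (card (Minus x \<inter> ?O))"
    have "real a * real_of_int u + real_of_int v = 0"
      using x unfolding mixed_cut_def u_def v_def by (simp add: int)
    then have uv: "int a * u + v = 0"
      by (metis of_int_add of_int_eq_0_iff of_int_mult of_int_of_nat_eq)
    have "\<bar>v\<bar> < int a" using P M by (simp add: v_def)
    moreover have "int a dvd v" using uv by (metis add.commute dvd_minus_iff dvd_triv_left eq_neg_iff_add_eq_0)
    ultimately have "v = 0"
      by (metis abs_of_nat dvd_imp_le_int not_le abs_dvd_iff)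
    with uv a have "u = 0" by simp
    have "sum x {r+1..r+k} = 0" "sum x ?O = 0"
      using int[of "{r+1..r+k}"] int[of ?O] \<open>u = 0\<close> \<open>v = 0\<close> by (simp_all add: u_def v_def)
    then show ?thesis
      using x unfolding prod_mixed_ones_iff[OF a1] by (simp add: mixed_cut_def)
  qed
  then show ?thesis
    using prod_mixed_ones_subset[OF a1, of r k l] unfolding remove_partitions_def by blast
qed

lemma diff_vec_in_prod_ones:
  assumes "a \<ge> 1" "i \<in> {r+k+1..r+k+l}" "j \<in> {r+k+1..r+k+l}" "i \<noteq> j"
  shows "diff_vec i j \<in> prod_cut (r + k) (mixed_cut a r k 0) (ones_cut l)"
proof -
  have "sum (diff_vec i j) {r+k+1..r+k+l} = (\<Sum>t\<in>{r+k+1..r+k+l}. (if t = i then 1 else 0) - (if t = j then 1 else 0))"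
    using assms(4) by (intro sum.cong) (auto simp: diff_vec_def)
  also have "\<dots> = 0"
    using assms by (simp add: sum_subtractf)
  finally have "sum (diff_vec i j) {r+k+1..r+k+l} = 0" .
  moreover have "sum (diff_vec i j) {r+1..r+k} = 0"
    using assms by (intro sum.neutral) (auto simp: diff_vec_def)
  ultimately show ?thesis
    unfolding prod_mixed_ones_iff[OF assms(1)] using assms by (auto simp: diff_vec_def signvecs_def)
qed

section \<open>Resonance functors\<close>

text \<open>The cut of the product of \<open>n\<close> copies of \<open>(1)\<close>. Since objects
  carry their length separately, one set serves for every \<open>n\<close>.\<close>

abbreviation zero_cut :: "rvec set" where
  "zero_cut \<equiv> {0}"

section \<open>Iterated products and degenerate cuts\<close>

lemma pointed_equiv_smash_pt:
  assumes "pointed_space X" "pointed_space Y"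
  shows "smash X Y \<simeq>\<^sub>* smash_pt X Y"
  unfolding smash_pt_def
  by (rule pointed_equiv_transport) (auto simp: inj_on_def pointed_space_smash assms)

lemma pointed_equiv_susp_pt:
  assumes "pointed_space X"
  shows "reduced_susp X \<simeq>\<^sub>* susp_pt X"
  unfolding susp_pt_def
  by (rule pointed_equiv_transport) (auto simp: inj_on_def pointed_space_reduced_susp assms)

lemma smash_power_1: "smash_power X 1 = transport Pt X"
  by (simp add: smash_power_def)

lemma smash_power_Suc:
  "n \<ge> 1 \<Longrightarrow> smash_power X (Suc n) = smash_pt (transport Pt X) (smash_power X n)"
  by (cases n) (auto simp: smash_power_def)

lemma zero_in_cut:
  assumes "S \<in> cuts n"
  shows "0 \<in> S"
proof -
  have "(0 :: rvec) \<in> signvecs n"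
    by (simp add: signvecs_iff)
  then have "0 \<in> span_closure n S"
    by (simp add: span_closure_def module.span_zero[OF module_rvec])
  then show ?thesis
    using assms by (simp add: cuts_def)
qed

lemma signvecs_0: "signvecs 0 = zero_cut"
  by (auto simp: signvecs_def fun_eq_iff)

lemma cuts_0: "S \<in> cuts 0 \<Longrightarrow> S = zero_cut"
  using zero_in_cut[of S 0] cuts_subset[of S 0] by (auto simp: signvecs_0)

lemma prod_cut_0_right:
  assumes "S \<in> cuts n"
  shows "prod_cut n S zero_cut = S"
proof -
  have "concat_vec n x 0 = x" if "x \<in> S" for x
    using signvecs_eq_0[of x n] cuts_subset[OF assms] that by (auto simp: concat_vec_def fun_eq_iff)
  then show ?thesis
    by (auto simp: prod_cut_def; metis)
qed

lemma prod_cut_0_left: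
  assumes "T \<in> cuts m"
  shows "prod_cut 0 zero_cut T = T"
proof -
  have "concat_vec 0 0 y = y" if "y \<in> T" for y
    using signvecs_eq_0[of y m] cuts_subset[OF assms] that by (auto simp: concat_vec_def fun_eq_iff)
  then show ?thesis
    by (auto simp: prod_cut_def; metis)
qed

lemma prod_cut_zero: "prod_cut n zero_cut zero_cut = zero_cut"
proof -
  have "concat_vec n 0 0 = 0"
    by (auto simp: concat_vec_def fun_eq_iff)
  then show ?thesis
    by (simp add: prod_cut_def)
qed

lemma mixed_cut_no_ones: "a \<ge> 1 \<Longrightarrow> mixed_cut a 0 k 0 = ones_cut k"
  by (auto simp: mixed_cut_def ones_cut_eq)

lemma mixed_cut_zero: "mixed_cut a n 0 0 = zero_cut"
proof -
  have "x = 0" if "x \<in> signvecs n" "\<forall>i\<in>{1..n}. x i = 0" for x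
  proof
    fix i
    show "x i = 0 i"
      using that signvecs_eq_0[OF that(1), of i] by (cases "i \<in> {1..n}") auto
  qed
  then show ?thesis
    by (auto simp: mixed_cut_def signvecs_iff)
qed

lemma zero_in_cuts: "zero_cut \<in> cuts n"
  using mixed_cut_in_cuts[of 1 n 0 0] by (simp add: mixed_cut_zero)

lemma ones_cut_in_cuts: "ones_cut l \<in> cuts l"
  using mixed_cut_in_cuts[of 1 0 0 l] by (simp add: ones_cut_def)

text \<open>With fewer than \<open>a\<close> unit parts no block is big, nothing is removed, and the
  equality of relative cuts becomes an equality of cuts.\<close>

lemma mixed_cut_few_ones:
  assumes "2 \<le> a" "l < a"
  shows "mixed_cut a r k l = prod_cut (r + k) (mixed_cut a r k 0) (ones_cut l)"
proof -
  have "card (B \<inter> {n+1..n+l}) < a" for B n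
    using card_mono[of "{n+1..n+l}" "B \<inter> {n+1..n+l}"] assms by simp
  then have "big_block_partitions (r + k) a l = {}"
    unfolding big_block_partitions_def by (auto simp: not_le[symmetric])
  then show ?thesis
    using remove_big_blocks_eq[OF assms(1), of r k l] by (simp add: remove_partitions_def)
qed

lemma mixed_cut_one_block_zero: "a \<ge> 1 \<Longrightarrow> mixed_cut a r 1 0 = zero_cut"
proof -
  assume "a \<ge> 1"
  have "x = 0" if "x \<in> mixed_cut a r 1 0" for x
  proof
    fix i
    have "x i = 0" if "i = r + 1"
      using \<open>x \<in> mixed_cut a r 1 0\<close> \<open>a \<ge> 1\<close> that by (simp add: mixed_cut_def)
    moreover have "x i = 0" if "i \<in> {1..r}"
      using \<open>x \<in> mixed_cut a r 1 0\<close> that by (simp add: mixed_cut_def)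
    moreover have "x i = 0" if "i = 0 \<or> i > r + 1"
      using \<open>x \<in> mixed_cut a r 1 0\<close> signvecs_eq_0[OF _ that] by (simp add: mixed_cut_def)
    ultimately show "x i = 0 i"
      by (simp add: zero_fun_def) (metis Suc_leI atLeastAtMost_iff le_SucE not_gr0 not_le One_nat_def)
  qed
  moreover have "0 \<in> mixed_cut a r 1 0"
    by (simp add: mixed_cut_def signvecs_iff)
  ultimately show ?thesis by blast
qed

lemma ones_cut_small: "e \<le> 1 \<Longrightarrow> ones_cut e = zero_cut"
  using mixed_cut_one_block_zero[of 1 0] mixed_cut_no_ones[of 1 1] ones_cut_eq[of 0] signvecs_0
  by (cases e) (auto simp: le_Suc_eq)

text \<open>Since \<open>e < a\<close>, the cut splits, and neither \<open>(a)\<close> nor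
  \<open>(1^e)\<close> with at most one part admits a nonzero vector.\<close>

lemma mixed_cut_small_zero:
  assumes "2 \<le> a" "e \<le> 1"
  shows "mixed_cut a r 1 e = zero_cut"
  using mixed_cut_few_ones[of a e r 1] mixed_cut_one_block_zero[of a r] ones_cut_small[of e] assms
  by (simp add: prod_cut_zero)

lemma cut_of_mixed: "cut_of (replicate k a @ replicate l 1) = mixed_cut a 0 k l"
proof -
  have "(\<Sum>i=1..k+l. x i * real ((replicate k a @ replicate l 1) ! (i - 1))) =
      (\<Sum>i=1..k+l. x i * real (weight a 0 k i))" for x :: rvec
    by (intro sum.cong) (auto simp: weight_def nth_append)
  moreover have "(\<Sum>i=1..k+l. x i * real (weight a 0 k i)) = real a * sum x {1..k} + sum x {k+1..k+l}" for x
    using mixed_cut_weight_sum[where r = 0 and k = k and l = l and a = a and x = x] by simp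
  ultimately show ?thesis
    unfolding cut_of_def mixed_cut_def by simp
qed

lemma F_vec_mixed: "F_vec F (replicate k a @ replicate l 1) = F (k + l, mixed_cut a 0 k l)"
  unfolding F_vec_def cut_of_mixed by simp

lemma F_vec_ones: "F_vec F (replicate j 1) = F (j, ones_cut j)"
  using F_vec_mixed[of F 0 1 j] by (simp add: ones_cut_def)

lemma F_vec_1: "F_vec F [1] = F (1, zero_cut)"
  using F_vec_ones[of F 1] ones_cut_small[of 1] by simp

section \<open>The axioms applied to cuts\<close>

locale resonance =
  fixes F :: "cut \<Rightarrow> 'a pspace" and Fm :: "res_mor \<Rightarrow> 'a \<Rightarrow> 'a"
  assumes resonance_functor: "resonance_functor F Fm"
begin

lemma pointed_space_F: "S \<in> cuts n \<Longrightarrow> n \<ge> 1 \<Longrightarrow> pointed_space (F (n, S))"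
  using resonance_functor
  by (auto simp: resonance_functor_def functor_to_pointed_spaces_def res_objects_def)

lemma inclusion:
  assumes "S \<in> cuts n" "n \<ge> 1" "p \<in> ordered_partitions {1..n}"
  shows "pointed_cofibration (F (length p, pull p S)) (F (n, S)) (Fm (incl_mor n S p))"
    and "pquotient (F (n, S)) (Fm (incl_mor n S p) ` topspace (fst (F (length p, pull p S))))
      \<simeq>\<^sub>* F_Q F Fm n S (down n S (set p))"
proof -
  have "inclusion_axiom F Fm"
    using resonance_functor by (simp add: resonance_functor_def)
  moreover have "(n, S) \<in> res_objects"
    using assms by (simp add: res_objects_def)
  ultimately have "inclusion_map (F (length p, pull p S)) (F (n, S)) (Fm (incl_mor n S p)) \<and>
        pquotient (F (n, S)) (F_image F Fm n S p) \<simeq>\<^sub>* F_Q F Fm n S (down n S (set p))"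
    using assms(3) unfolding inclusion_axiom_def by blast
  then show "pointed_cofibration (F (length p, pull p S)) (F (n, S)) (Fm (incl_mor n S p))"
    "pquotient (F (n, S)) (Fm (incl_mor n S p) ` topspace (fst (F (length p, pull p S))))
      \<simeq>\<^sub>* F_Q F Fm n S (down n S (set p))"
    by (simp_all add: inclusion_map_def F_image_def)
qed

text \<open>Collapsing the contractible subspace changes nothing, and the inclusion axiom identifies
  the quotient with the value on the relative cut.\<close>

lemma equiv_F_Q:
  assumes "S \<in> cuts n" "n \<ge> 1" "p \<in> ordered_partitions {1..n}"
    and "pull p S \<in> cuts (length p)" "length p \<ge> 1"
    and "pointed_contractible (F (length p, pull p S))"
  shows "F (n, S) \<simeq>\<^sub>* F_Q F Fm n S (down n S (set p))"
  using pointed_equiv_quotient_contractible[OF inclusion(1)[OF assms(1-3)]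
      pointed_space_F[OF assms(4,5)] pointed_space_F[OF assms(1,2)] assms(6)]
    inclusion(2)[OF assms(1-3)]
  by (rule pointed_equiv_trans)

text \<open>The complementary case: now the ambient space is contractible, so the quotient of the
  inclusion axiom is the suspension of the subspace.\<close>

lemma F_Q_equiv_susp:
  assumes "S \<in> cuts n" "n \<ge> 1" "p \<in> ordered_partitions {1..n}"
    and "pull p S \<in> cuts (length p)" "length p \<ge> 1"
    and "pointed_contractible (F (n, S))"
  shows "F_Q F Fm n S (down n S (set p)) \<simeq>\<^sub>* reduced_susp (F (length p, pull p S))"
  using pointed_equiv_sym[OF inclusion(2)[OF assms(1-3)]]
    quotient_equiv_reduced_susp[OF inclusion(1)[OF assms(1-3)]
      pointed_space_F[OF assms(4,5)] pointed_space_F[OF assms(1,2)] assms(6)]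
  by (rule pointed_equiv_trans)

lemma F_rel_cut:
  assumes "S \<in> cuts n"
  shows "F_rel F Fm n (S, {}) = F (n, S)"
  using assms by (simp add: F_rel_def F_Q_def cuts_def)

text \<open>The product axiom for empty sets of partitions: their product is empty again, and a
  quotient by the empty set is the space itself.\<close>

lemma F_prod_cut:
  assumes S: "S \<in> cuts n" "n \<ge> 1" and T: "T \<in> cuts m" "m \<ge> 1"
  shows "smash (F (n, S)) (F (m, T)) \<simeq>\<^sub>* F (n + m, prod_cut n S T)"
proof -
  have rel: "relative_cut n' (S', {})" if "S' \<in> cuts n'" for n' S'
    using that by (auto simp: relative_cut_def cuts_def remove_partitions_def closed_under_def)
  have "product_axiom F Fm"
    using resonance_functor by (simp add: resonance_functor_def)
  then have "smash (F_rel F Fm n (S, {})) (F_rel F Fm m (T, {})) \<simeq>\<^sub>*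
      F_rel F Fm (n + m) (rel_cut_times n (S, {}) m (T, {}))"
    unfolding product_axiom_def using rel[OF S(1)] rel[OF T(1)] S(2) T(2) by blast
  moreover have "rel_cut_times n (S, {}) m (T, {}) = (prod_cut n S T, {})"
    by (simp add: rel_cut_times_def prod_cut_def partitions_times_def)
  ultimately show ?thesis
    by (simp add: F_rel_cut S T prod_cut_in_cuts)
qed

text \<open>Smashing with a contractible factor gives a contractible space. A factor of length 0 is
  no object of the category, so the product axiom does not speak of it; such a factor leaves the cut
  as it is.\<close>

lemma contractible_prod_left:
  assumes S: "S \<in> cuts n" "n \<ge> 1" and T: "T \<in> cuts m"
    and contr: "pointed_contractible (F (n, S))"
  shows "pointed_contractible (F (n + m, prod_cut n S T))"
proof (cases "m = 0")
  case True
  then have "T = zero_cut" using T cuts_0 by simp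
  then show ?thesis using True contr by (simp add: prod_cut_0_right[OF S(1)])
next
  case False
  then have m: "m \<ge> 1" by simp
  note P = pointed_space_F[OF S] pointed_space_F[OF T m]
  show ?thesis
    using pointed_contractible_cong[OF F_prod_cut[OF S T m] pointed_space_smash[OF P]]
      pointed_contractible_smash_left[OF contr P] by simp
qed

lemma contractible_prod_right:
  assumes S: "S \<in> cuts n" and T: "T \<in> cuts m" "m \<ge> 1"
    and contr: "pointed_contractible (F (m, T))"
  shows "pointed_contractible (F (n + m, prod_cut n S T))"
proof (cases "n = 0")
  case True
  then have "S = zero_cut" using S cuts_0 by simp
  then show ?thesis using True contr by (simp add: prod_cut_0_left[OF T(1)])
next
  case False
  then have n: "n \<ge> 1" by simp
  note P = pointed_space_F[OF S n] pointed_space_F[OF T]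
  show ?thesis
    using pointed_contractible_cong[OF F_prod_cut[OF S n T] pointed_space_smash[OF P]]
      pointed_contractible_smash_right[OF contr P] by simp
qed

text \<open>The product axiom splits off one coordinate at a time; every intermediate space is moved
  into the datatype by a homeomorphic copy.\<close>

lemma F_zero_smash_power:
  "n \<ge> 1 \<Longrightarrow> F (n, zero_cut) \<simeq>\<^sub>* smash_power (F (1, zero_cut)) n"
proof (induction n rule: nat_induct_at_least)
  case base
  show ?case
    unfolding smash_power_1
    by (rule pointed_equiv_transport[OF _ pointed_space_F[OF zero_in_cuts]]) (simp_all add: inj_on_def)
next
  case (Suc n)
  let ?X = "F (1, zero_cut)"
  have X: "pointed_space ?X" and Fn: "pointed_space (F (n, zero_cut))"
    by (rule pointed_space_F[OF zero_in_cuts order_refl], rule pointed_space_F[OF zero_in_cuts Suc.hyps])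
  have tX: "?X \<simeq>\<^sub>* transport Pt ?X"
    by (rule pointed_equiv_transport[OF _ X]) (simp add: inj_on_def)
  have "F (Suc n, zero_cut) \<simeq>\<^sub>* smash ?X (F (n, zero_cut))"
    using pointed_equiv_sym[OF F_prod_cut[OF zero_in_cuts order_refl zero_in_cuts Suc.hyps]]
    by (simp only: prod_cut_zero plus_1_eq_Suc)
  moreover have "smash ?X (F (n, zero_cut)) \<simeq>\<^sub>* smash (transport Pt ?X) (smash_power ?X n)"
    by (rule smash_cong[OF tX Suc.IH X Fn])
  moreover have "smash (transport Pt ?X) (smash_power ?X n) \<simeq>\<^sub>* smash_power ?X (Suc n)"
    unfolding smash_power_Suc[OF Suc.hyps]
    by (rule pointed_equiv_smash_pt[OF pointed_space_equiv[OF tX X] pointed_space_equiv[OF Suc.IH Fn]])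
  ultimately show ?case
    by (blast intro: pointed_equiv_trans)
qed

section \<open>Induction on the number of unit parts\<close>

context
  fixes a :: nat
  assumes a: "2 \<le> a"
    and ones: "\<And>j. j \<ge> 2 \<Longrightarrow> pointed_contractible (F (j, ones_cut j))"
begin

lemma a1: "1 \<le> a"
  using a by simp

text \<open>The cut \<open>D\<close> of the overview, with \<open>r\<close> further free factors
  \<open>(1)\<close>.\<close>

abbreviation split_cut :: "nat \<Rightarrow> nat \<Rightarrow> nat \<Rightarrow> rvec set" where
  "split_cut r k l \<equiv> prod_cut (r + k) (mixed_cut a r k 0) (ones_cut l)"

lemma mixed_no_ones_in_cuts: "mixed_cut a r k 0 \<in> cuts (r + k)"
  using mixed_cut_in_cuts[OF a1, of r k 0] by simp

lemma split_cut_in_cuts: "split_cut r k l \<in> cuts (r + k + l)"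
  by (rule prod_cut_in_cuts[OF mixed_no_ones_in_cuts ones_cut_in_cuts])

lemma down_mixed_cut:
  "a \<le> l \<Longrightarrow> down (r + k + l) (mixed_cut a r k l) (set (block_partition (r + k) a l)) =
     big_block_partitions (r + k) a l"
  using prod_mixed_ones_subset[OF a1, of r k l] diff_vec_in_prod_ones[OF a1]
  by (intro down_block_partition a order_refl) blast+

lemma down_split_cut:
  "a \<le> l \<Longrightarrow> down (r + k + l) (split_cut r k l) (set (block_partition (r + k) a l)) =
     big_block_partitions (r + k) a l"
  by (intro down_block_partition a prod_mixed_ones_subset[OF a1] diff_vec_in_prod_ones[OF a1])

text \<open>The two relative cuts are equal as pairs, so their orbits agree and the relative
  resonance axiom applies.\<close>

lemma F_Q_mixed_split:
  assumes "a \<le> l" "r + k \<ge> 1"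
  shows "F_Q F Fm (r + k + l) (mixed_cut a r k l) (big_block_partitions (r + k) a l) \<simeq>\<^sub>*
    F_Q F Fm (r + k + l) (split_cut r k l) (big_block_partitions (r + k) a l)"
proof -
  let ?n = "r + k + l" and ?P = "big_block_partitions (r + k) a l"
  have "relative_resonance_axiom F Fm"
    using resonance_functor by (simp add: resonance_functor_def)
  moreover have "(?n, mixed_cut a r k l) \<in> res_objects" "(?n, split_cut r k l) \<in> res_objects"
    using assms(2) mixed_cut_in_cuts[OF a1] split_cut_in_cuts by (simp_all add: res_objects_def)
  moreover have "closed_under ?n (mixed_cut a r k l) ?P" "closed_under ?n (split_cut r k l) ?P"
    using closed_under_down[of ?n "mixed_cut a r k l"] closed_under_down[of ?n "split_cut r k l"]
      down_mixed_cut[OF assms(1)] down_split_cut[OF assms(1)] by metis+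
  moreover have "Q_cut ?n (mixed_cut a r k l) ?P = Q_cut ?n (split_cut r k l) ?P"
    using remove_big_blocks_eq[OF a, of r k l] by (simp add: Q_cut_def)
  ultimately show ?thesis
    unfolding relative_resonance_axiom_def by metis
qed

lemma block_partition_n:
  "a \<le> l \<Longrightarrow> block_partition (r + k) a l \<in> ordered_partitions {1..r + k + l}"
  using block_partition_ordered[OF a1, of l "r + k"] by simp

text \<open>The target is written with \<open>down\<close> of the split cut, the form in which
  \<open>equiv_F_Q\<close> and \<open>F_Q_equiv_susp\<close> deliver it from the other side.\<close>

lemma mixed_cut_equiv_split:
  assumes "a \<le> l" "r + k \<ge> 1"
    and "pointed_contractible (F (r + (k + 1) + (l - a), mixed_cut a r (k + 1) (l - a)))"
  shows "F (r + k + l, mixed_cut a r k l) \<simeq>\<^sub>*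
    F_Q F Fm (r + k + l) (split_cut r k l) (down (r + k + l) (split_cut r k l) (set (block_partition (r + k) a l)))"
proof -
  have len: "length (block_partition (r + k) a l) = r + (k + 1) + (l - a)" by simp
  have "F (r + k + l, mixed_cut a r k l) \<simeq>\<^sub>* F_Q F Fm (r + k + l) (mixed_cut a r k l)
      (down (r + k + l) (mixed_cut a r k l) (set (block_partition (r + k) a l)))"
  proof (rule equiv_F_Q[OF mixed_cut_in_cuts[OF a1] _ block_partition_n[OF assms(1)]])
    show "pull (block_partition (r + k) a l) (mixed_cut a r k l) \<in> cuts (length (block_partition (r + k) a l))"
      unfolding pull_mixed_cut[OF a1 assms(1)] len by (rule mixed_cut_in_cuts[OF a1])
    show "pointed_contractible (F (length (block_partition (r + k) a l),
        pull (block_partition (r + k) a l) (mixed_cut a r k l)))"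
      unfolding pull_mixed_cut[OF a1 assms(1)] len by (rule assms(3))
  qed (use assms(2) in simp_all)
  then show ?thesis
    unfolding down_mixed_cut[OF assms(1)] down_split_cut[OF assms(1)]
    by (rule pointed_equiv_trans) (rule F_Q_mixed_split[OF assms(1,2)])
qed

lemma pull_split_cut:
  "a \<le> l \<Longrightarrow> pull (block_partition (r + k) a l) (split_cut r k l) =
    prod_cut (r + k) (mixed_cut a r k 0) (mixed_cut a 0 1 (l - a))"
  by (rule pull_prod_ones[OF a1 _ cuts_subset[OF mixed_no_ones_in_cuts]])

lemma mixed_0_1_in_cuts: "mixed_cut a 0 1 l \<in> cuts (1 + l)"
  using mixed_cut_in_cuts[OF a1, of 0 1 l] by simp

lemma pull_split_cut_in_cuts:
  "prod_cut (r + k) (mixed_cut a r k 0) (mixed_cut a 0 1 l) \<in> cuts (r + k + 1 + l)"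
  using prod_cut_in_cuts[OF mixed_no_ones_in_cuts mixed_0_1_in_cuts] by (simp add: add.assoc)

text \<open>Without unit parts the common value \<open>a\<close> can be cancelled, so the cut is
  that of \<open>(1)^r\<close> times \<open>(1^k)\<close>.\<close>

lemma contractible_mixed_no_ones:
  assumes "k \<ge> 2"
  shows "pointed_contractible (F (r + k, mixed_cut a r k 0))"
proof -
  have "mixed_cut a r k 0 = prod_cut r (mixed_cut a r 0 0) (ones_cut k)"
    using prod_zero_mixed[of r a k 0] by (simp add: mixed_cut_no_ones[OF a1])
  moreover have "mixed_cut a r 0 0 \<in> cuts r"
    by (simp add: mixed_cut_zero zero_in_cuts)
  ultimately show ?thesis
    using contractible_prod_right[OF _ ones_cut_in_cuts, of "mixed_cut a r 0 0" r k] ones[OF assms] assms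
    by simp
qed

text \<open>Both glued subspaces are contractible, so \<open>F(C)\<close> and \<open>F(D)\<close>
  are equivalent to the same quotient. Gluing turns \<open>k\<close> into \<open>k + 1\<close>,
  hence the induction over all \<open>k\<close> at once.\<close>

lemma contractible_mixed:
  "k \<ge> 2 \<Longrightarrow> pointed_contractible (F (r + k + l, mixed_cut a r k l))"
proof (induction l arbitrary: k rule: less_induct)
  case (less l)
  note B = contractible_mixed_no_ones[OF less.prems, of r]
  have rk: "r + k \<ge> 1" using less.prems by simp
  have D: "pointed_contractible (F (r + k + l, split_cut r k l))"
    by (rule contractible_prod_left[OF mixed_no_ones_in_cuts rk ones_cut_in_cuts B])
  show ?case
  proof (cases "l < a")
    case True
    then show ?thesis using D mixed_cut_few_ones[OF a True] by simp
  next
    case False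
    then have al: "a \<le> l" by simp
    let ?p = "block_partition (r + k) a l"
    have "pointed_contractible (F (r + (k + 1) + (l - a), mixed_cut a r (k + 1) (l - a)))"
      by (rule less.IH) (use less.prems a al in auto)
    then have 1: "F (r + k + l, mixed_cut a r k l) \<simeq>\<^sub>*
        F_Q F Fm (r + k + l) (split_cut r k l) (down (r + k + l) (split_cut r k l) (set ?p))"
      by (rule mixed_cut_equiv_split[OF al rk])
    have "pointed_contractible (F (r + k + (1 + (l - a)), prod_cut (r + k) (mixed_cut a r k 0) (mixed_cut a 0 1 (l - a))))"
      by (rule contractible_prod_left[OF mixed_no_ones_in_cuts rk mixed_0_1_in_cuts B])
    then have "pointed_contractible (F (length ?p, pull ?p (split_cut r k l)))"
      by (simp add: pull_split_cut[OF al] add.assoc)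
    then have 2: "F (r + k + l, split_cut r k l) \<simeq>\<^sub>*
        F_Q F Fm (r + k + l) (split_cut r k l) (down (r + k + l) (split_cut r k l) (set ?p))"
      by (intro equiv_F_Q split_cut_in_cuts block_partition_n al)
        (use rk in \<open>simp_all add: pull_split_cut[OF al] pull_split_cut_in_cuts del: One_nat_def\<close>)
    have "pointed_space (F (r + k + l, split_cut r k l))"
      by (rule pointed_space_F[OF split_cut_in_cuts]) (use rk in simp)
    then show ?thesis
      by (rule iffD1[OF pointed_contractible_cong[OF pointed_equiv_trans[OF 2 pointed_equiv_sym[OF 1]]] D])
  qed
qed

text \<open>The subspace that gets suspended is again of the mixed form with one part
  \<open>a\<close>, now with \<open>r + 1\<close> free factors, so the step can be iterated.\<close>

lemma mixed_equiv_susp: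
  assumes al: "a \<le> l"
  shows "F (r + 1 + l, mixed_cut a r 1 l) \<simeq>\<^sub>*
    reduced_susp (F (r + 1 + 1 + (l - a), mixed_cut a (r + 1) 1 (l - a)))"
proof -
  let ?p = "block_partition (r + 1) a l"
  have "F (r + 1 + l, mixed_cut a r 1 l) \<simeq>\<^sub>*
      F_Q F Fm (r + 1 + l) (split_cut r 1 l) (down (r + 1 + l) (split_cut r 1 l) (set ?p))"
    \<comment> \<open>Gluing produces a second part \<open>a\<close>, so the glued cut is
      contractible by the case \<open>k = 2\<close>.\<close>
    by (rule mixed_cut_equiv_split[OF al]) (use contractible_mixed[of "1 + 1" r "l - a"] in simp_all)
  moreover have "pointed_contractible (F (r + 1 + l, split_cut r 1 l))"
    by (rule contractible_prod_right[OF mixed_no_ones_in_cuts ones_cut_in_cuts])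
      (use ones[of l] a al in auto)
  then have "F_Q F Fm (r + 1 + l) (split_cut r 1 l) (down (r + 1 + l) (split_cut r 1 l) (set ?p)) \<simeq>\<^sub>*
      reduced_susp (F (length ?p, pull ?p (split_cut r 1 l)))"
    by (intro F_Q_equiv_susp split_cut_in_cuts block_partition_n al)
      (simp_all add: pull_split_cut[OF al] pull_split_cut_in_cuts del: One_nat_def)
  \<comment> \<open>The lone part \<open>a\<close> on the left admits only zero and so joins the
    \<open>r\<close> free coordinates.\<close>
  moreover have "pull ?p (split_cut r 1 l) = mixed_cut a (r + 1) 1 (l - a)"
    using prod_zero_mixed[of "r + 1" a 1 "l - a"]
    unfolding pull_split_cut[OF al] unfolding mixed_cut_one_block_zero[OF a1] mixed_cut_zero .
  ultimately show ?thesis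
    using pointed_equiv_trans by (simp only: length_block_partition)
qed

text \<open>Each step trades \<open>a\<close> unit parts for one suspension and one free coordinate.
  At the bottom the \<open>1 + e\<close> remaining coordinates are free as well, which gives
  \<open>r + m + e + 1\<close> factors.\<close>

lemma mixed_iterated_susp:
  assumes "e \<le> 1"
  shows "F (r + 1 + (a * m + e), mixed_cut a r 1 (a * m + e)) \<simeq>\<^sub>*
    iterated_susp m (smash_power (F (1, zero_cut)) (r + m + e + 1))"
proof (induction m arbitrary: r)
  case 0
  have "F (r + 1 + e, zero_cut) \<simeq>\<^sub>* smash_power (F (1, zero_cut)) (r + 1 + e)"
    by (rule F_zero_smash_power) simp
  moreover have "a * 0 + e = e" "r + 0 + e + 1 = r + 1 + e"
    by simp_all
  moreover have "iterated_susp 0 Y = Y" for Y :: "'a pt pspace"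
    by (simp add: iterated_susp_def)
  ultimately show ?case
    by (simp only: mixed_cut_small_zero[OF a assms])
next
  case (Suc m)
  let ?X = "F (r + 1 + 1 + (a * m + e), mixed_cut a (r + 1) 1 (a * m + e))"
  let ?Y = "iterated_susp m (smash_power (F (1, zero_cut)) (r + 1 + m + e + 1))"
  have X: "pointed_space ?X"
    by (intro pointed_space_F mixed_cut_in_cuts[OF a1]) simp
  have "F (r + 1 + (a * Suc m + e), mixed_cut a r 1 (a * Suc m + e)) \<simeq>\<^sub>* reduced_susp ?X"
    using mixed_equiv_susp[of "a * Suc m + e" r] by simp
  also have "reduced_susp ?X \<simeq>\<^sub>* reduced_susp ?Y"
    by (rule reduced_susp_cong[OF Suc.IH X])
  also have "reduced_susp ?Y \<simeq>\<^sub>* susp_pt ?Y"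
    by (rule pointed_equiv_susp_pt[OF pointed_space_equiv[OF Suc.IH X]])
  also have "susp_pt ?Y = iterated_susp (Suc m) (smash_power (F (1, zero_cut)) (r + Suc m + e + 1))"
    by (simp add: iterated_susp_def)
  finally show ?case .
qed

text \<open>The same descent ends at a cut with the contractible factor \<open>(1^e)\<close>, and
  suspensions preserve contractibility.\<close>

lemma contractible_mixed_one:
  assumes "2 \<le> e" "e < a"
  shows "pointed_contractible (F (r + 1 + (a * m + e), mixed_cut a r 1 (a * m + e)))"
proof (induction m arbitrary: r)
  case 0
  have "pointed_contractible (F (r + 1 + e, split_cut r 1 e))"
    by (rule contractible_prod_right[OF mixed_no_ones_in_cuts ones_cut_in_cuts _ ones[OF assms(1)]])
      (use assms in simp)
  then show ?case
    using mixed_cut_few_ones[OF a assms(2), of r 1] by simp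
next
  case (Suc m)
  let ?X = "F (r + 1 + 1 + (a * m + e), mixed_cut a (r + 1) 1 (a * m + e))"
  have "F (r + 1 + (a * Suc m + e), mixed_cut a r 1 (a * Suc m + e)) \<simeq>\<^sub>* reduced_susp ?X"
    using mixed_equiv_susp[of "a * Suc m + e" r] by simp
  moreover have "pointed_space (F (r + 1 + (a * Suc m + e), mixed_cut a r 1 (a * Suc m + e)))"
    by (intro pointed_space_F mixed_cut_in_cuts[OF a1]) simp
  moreover have "pointed_contractible (reduced_susp ?X)"
    by (intro pointed_contractible_reduced_susp Suc.IH pointed_space_F mixed_cut_in_cuts[OF a1]) simp
  ultimately show ?case
    by (rule iffD2[OF pointed_contractible_cong])
qed

end

end

theorem theorem4p2:
  fixes F :: "cut \<Rightarrow> 'a pspace" and Fm :: "res_mor \<Rightarrow> 'a \<Rightarrow> 'a"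
    and a k l m e :: nat
  assumes "resonance_functor F Fm"
    and "\<And>j. j \<ge> 2 \<Longrightarrow> pointed_contractible (F_vec F (replicate j 1))"
    and "a \<ge> 2" and "k \<ge> 1" and "l \<ge> 1"
    and "l = a * m + e" and "e \<le> a - 1"
  shows "(k \<noteq> 1 \<or> e \<ge> 2 \<longrightarrow> pointed_contractible (F_vec F (replicate k a @ replicate l 1))) \<and>
         (k = 1 \<and> e \<in> {0, 1} \<longrightarrow>
            F_vec F (replicate k a @ replicate l 1)
              \<simeq>\<^sub>* iterated_susp m (smash_power (F_vec F [1]) (m + e + 1)))"
proof -
  interpret resonance F Fm
    by unfold_locales (rule assms(1))
  have ones: "pointed_contractible (F (j, ones_cut j))" if "j \<ge> 2" for j
    using assms(2)[OF that] unfolding F_vec_ones .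
  have "pointed_contractible (F (k + l, mixed_cut a 0 k l))" if "k \<noteq> 1 \<or> e \<ge> 2"
  proof (cases "k = 1")
    case True
    then show ?thesis
      using contractible_mixed_one[OF assms(3) ones, of e 0 m] that assms by simp
  next
    case False
    then show ?thesis
      using contractible_mixed[OF assms(3) ones, of k 0 l] assms(4) by simp
  qed
  moreover have "F (k + l, mixed_cut a 0 k l) \<simeq>\<^sub>* iterated_susp m (smash_power (F (1, zero_cut)) (m + e + 1))"
    if "k = 1 \<and> e \<in> {0, 1}"
    using mixed_iterated_susp[OF assms(3) ones, of e 0 m] that assms(6) by auto
  ultimately show ?thesis
    unfolding F_vec_mixed F_vec_1 by blast
qed

end
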